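(* (Frobenius trace formula for elliptic curves.) Let $k$ be a fixed positive integer. Let $p_1,\dots,p_k$ be distinct primes $\geq 5$ such that $\prod_{i=1}^{k}p_i=O(X^{\frac13-\epsilon})$ for a fixed $\epsilon>0$. For $i=1,\dots,k$ assume that $e_i=1$ or $2$, and that the positive integer $r_i$ is odd or equal to $2$ if $e_i=1$, and $r_i=1$ if $e_i=2$. Then $$\sum_{E\in\mathcal{E}(X)}\widehat{a}_E(p_1^{e_1})^{r_1}\widehat{a}_E(p_2^{e_2})^{r_2}\cdots\widehat{a}_E(p_k^{e_k})^{r_k}=c\,|\mathcal{E}(X)|+O_k\left(2^r\left(\prod_{i=1}^kp_i\right)X^{\frac12}\right)+O_k\left(\left(\sum_{i=1}^k\frac1{p_i}\right)X^{\frac56}\right),$$ where $c=0$ if $e_j=1$ and $r_j$ is odd for some $j$; $c=-1$ if $r_j=2$ for all $j$ with $e_j=1$ and the sum of the $r_j$'s with $e_j=2$ is odd; and $c=1$ otherwise. Here $r$ is the smallest odd integer among the $r_i$, or $r=0$ if there is no odd $r_i$, and the last error term exists only if, for all $i$, either $e_i=1$ and $r_i=2$, or $e_i=2$. Also, with the same $r$, $$\sum_{E\in\mathcal{E}(X)}\lambda_E(p_1^{e_1})^{r_1}\lambda_E(p_2^{e_2})^{r_2}\cdots\lambda_E(p_k^{e_k})^{r_k}=d\,|\mathcal{E}(X)|+O_k\left(2^r\left(\prod_{i=1}^kp_i\right)X^{\frac12}\right)+O_k\left(\left(\sum_{i=1}^k\frac1{p_i}\right)X^{\frac56}\right),$$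 where $d=0$ if for some $j$ either $e_j=2$, or $e_j=1$ and $r_j$ is odd; and $d=1$ if $e_i=1$ and $r_i=2$ for all $i$. Again the last error term exists only if, for all $i$, either $e_i=1$ and $r_i=2$, or $e_i=2$.
   Context: For $(A,B)\in\mathbb{Z}^2$ with $4A^3+27B^2\neq 0$ let $E_{A,B}: y^2=x^3+Ax+B$. Say $(A,B)$ satisfies (M) if there is no prime $q$ with both $q^4\mid A$ and $q^6\mid B$. For $X>0$ let $\mathcal{E}(X)$ be the set of $(A,B)\in\mathbb{Z}^2$ with $4A^3+27B^2\neq 0$, $\max(|A|^3,|B|^2)\leq X$, and satisfying (M); elements are identified with the elliptic curves $E=E_{A,B}$ over $\mathbb{Q}$. Let $L(s,E)$ be the normalized $L$-function of $E$ (critical line $\mathrm{Re}(s)=1/2$), and define $\lambda_E(n)$ and $\widehat{a}_E(n)$ by $$L(s,E)=\sum_{n\ge1}\frac{\lambda_E(n)}{n^s},\qquad -\frac{L'}{L}(s,E)=\sum_{n\ge1}\frac{\widehat{a}_E(n)\Lambda(n)}{n^s},$$ with $\Lambda$ the von Mangoldt function. Thus, for primes $p\ge5$, $\lambda_E(p)=\widehat a_E(p)=a_p(E)/\sqrt p$ (with $a_p(E)=p+1-\#E(\mathbb{F}_p)$ for good reduction, and $a_p(E)=1,-1,0$ for split multiplicative, non-split multiplicative, additive reduction respectively); $\widehat a_E(p^2)=\widehat a_E(p)^2-2$ and $\lambda_E(p^2)=\widehat a_E(p)^2-1$ if $E$ has good reduction at $p$, while $\widehat a_E(p^2)=\lambda_E(p^2)=\widehat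 a_E(p)^2$ if $E$ has bad reduction at $p$. The notation $O_k$ indicates that the implied constant depends on $k$.
   Formalization: The implied constants may depend, besides k (and the fixed ε and the constant in the bound on ∏p_i), on the sum of the odd r_i with one copy of the smallest, r, left out; with dependence on k alone the estimate fails, e.g. k=2, e=(1,1), r_1→∞ odd, r_2=1. *)

theory Defs
  imports
    Complex_Main
    "HOL-Number_Theory.Number_Theory"
    "HOL-Computational_Algebra.Computational_Algebra"
begin

section \<open>Integral Weierstrass models\<close>

text \<open>\<open>Weier a1 a2 a3 a4 a6\<close> is the equation
  \<open>y^2 + a1 x y + a3 y = x^3 + a2 x^2 + a4 x + a6\<close>.  General models are needed
  because the short model of a curve over the rationals need not be minimal at 2 and 3.\<close>

datatype weier = Weier (a1: int) (a2: int) (a3: int) (a4: int) (a6: int)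

definition b2 :: "weier \<Rightarrow> int" where
  "b2 W = a1 W ^ 2 + 4 * a2 W"

definition b4 :: "weier \<Rightarrow> int" where
  "b4 W = 2 * a4 W + a1 W * a3 W"

definition b6 :: "weier \<Rightarrow> int" where
  "b6 W = a3 W ^ 2 + 4 * a6 W"

definition b8 :: "weier \<Rightarrow> int" where
  "b8 W = a1 W ^ 2 * a6 W + 4 * a2 W * a6 W - a1 W * a3 W * a4 W + a2 W * a3 W ^ 2 - a4 W ^ 2"

definition c4 :: "weier \<Rightarrow> int" where
  "c4 W = b2 W ^ 2 - 24 * b4 W"

definition disc :: "weier \<Rightarrow> int" where
  "disc W = - (b2 W ^ 2 * b8 W) - 8 * b4 W ^ 3 - 27 * b6 W ^ 2 + 9 * b2 W * b4 W * b6 W"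

text \<open>Isomorphism over the rationals: the substitution
  \<open>x = u^2 x' + r\<close>, \<open>y = u^3 y' + s u^2 x' + t\<close> carries \<open>W\<close> to \<open>W'\<close>.\<close>

definition weier_iso :: "weier \<Rightarrow> weier \<Rightarrow> bool" where
  "weier_iso W W' \<longleftrightarrow> (\<exists>u r s t :: rat. u \<noteq> 0 \<and>
     u * of_int (a1 W') = of_int (a1 W) + 2 * s \<and>
     u ^ 2 * of_int (a2 W') = of_int (a2 W) - s * of_int (a1 W) + 3 * r - s ^ 2 \<and>
     u ^ 3 * of_int (a3 W') = of_int (a3 W) + r * of_int (a1 W) + 2 * t \<and>
     u ^ 4 * of_int (a4 W') = of_int (a4 W) - s * of_int (a3 W) + 2 * r * of_int (a2 W)
        - (t + r * s) * of_int (a1 W) + 3 * r ^ 2 - 2 * s * t \<and>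
     u ^ 6 * of_int (a6 W') = of_int (a6 W) + r * of_int (a4 W) + r ^ 2 * of_int (a2 W) + r ^ 3
        - t * of_int (a3 W) - t ^ 2 - r * t * of_int (a1 W))"

text \<open>A curve \<open>E\<close> given by \<open>y^2 = x^3 + A x + B\<close> is represented by the pair \<open>(A, B)\<close>.\<close>

type_synonym curve = "int \<times> int"

definition short_model :: "curve \<Rightarrow> weier" where
  "short_model E = Weier 0 0 0 (fst E) (snd E)"

definition minimal_at :: "curve \<Rightarrow> nat \<Rightarrow> weier \<Rightarrow> bool" where
  "minimal_at E p W \<longleftrightarrow> weier_iso (short_model E) W \<and>
     (\<forall>W'. weier_iso (short_model E) W' \<longrightarrow>
        multiplicity (int p) (disc W) \<le> multiplicity (int p) (disc W'))"

text \<open>The reduction type and the reduced curve do not depend on the minimal model chosen here.\<close>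

definition min_model :: "curve \<Rightarrow> nat \<Rightarrow> weier" where
  "min_model E p = (SOME W. minimal_at E p W)"


section \<open>Reduction and the trace of Frobenius\<close>

definition affine_points :: "weier \<Rightarrow> nat \<Rightarrow> (int \<times> int) set" where
  "affine_points W p = {(x, y). x \<in> {0..<int p} \<and> y \<in> {0..<int p} \<and>
     [y ^ 2 + a1 W * x * y + a3 W * y = x ^ 3 + a2 W * x ^ 2 + a4 W * x + a6 W] (mod int p)}"

definition singular_point :: "weier \<Rightarrow> nat \<Rightarrow> int \<times> int \<Rightarrow> bool" where
  "singular_point W p P \<longleftrightarrow> P \<in> affine_points W p \<and>
     (case P of (x, y) \<Rightarrow>
        [a1 W * y = 3 * x ^ 2 + 2 * a2 W * x + a4 W] (mod int p) \<and>
        [2 * y + a1 W * x + a3 W = 0] (mod int p))"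

definition good_reduction :: "curve \<Rightarrow> nat \<Rightarrow> bool" where
  "good_reduction E p \<longleftrightarrow> \<not> int p dvd disc (min_model E p)"

definition multiplicative_reduction :: "curve \<Rightarrow> nat \<Rightarrow> bool" where
  "multiplicative_reduction E p \<longleftrightarrow>
     int p dvd disc (min_model E p) \<and> \<not> int p dvd c4 (min_model E p)"

text \<open>Split means that the two tangent directions at the node are defined over the prime field.
  At a singular point \<open>(x0, y0)\<close> the tangent cone is
  \<open>Y^2 + a1 X Y - (3 x0 + a2) X^2 = 0\<close>, and \<open>m\<close> below is the slope of a tangent.\<close>

definition split_multiplicative_reduction :: "curve \<Rightarrow> nat \<Rightarrow> bool" where
  "split_multiplicative_reduction E p \<longleftrightarrow> multiplicative_reduction E p \<and>
     (let W = min_model E p in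
      \<exists>x y m. singular_point W p (x, y) \<and>
        [m ^ 2 + a1 W * m - (3 * x + a2 W) = 0] (mod int p))"

text \<open>The number of points of the reduced curve is \<open>card (affine_points W p) + 1\<close>,
  because of the point at infinity.\<close>

definition frob_trace :: "curve \<Rightarrow> nat \<Rightarrow> int" where
  "frob_trace E p =
     (if good_reduction E p
        then int p + 1 - (int (card (affine_points (min_model E p) p)) + 1)
      else if split_multiplicative_reduction E p then 1
      else if multiplicative_reduction E p then -1
      else 0)"


section \<open>The normalized L-function and its coefficients\<close>

text \<open>The local factor at \<open>p\<close> of the L-function, normalized to have critical line
  \<open>Re s = 1/2\<close>, as a power series in \<open>T = p^(-s)\<close>.\<close>

definition euler_factor :: "curve \<Rightarrow> nat \<Rightarrow> real fps" where
  "euler_factor E p =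
     inverse (1 - fps_const (of_int (frob_trace E p) / sqrt (real p)) * fps_X
              + (if good_reduction E p then fps_X ^ 2 else 0))"

text \<open>The Dirichlet coefficients of \<open>L(s, E)\<close>, obtained by expanding the Euler product.\<close>

definition lambda_coeff :: "curve \<Rightarrow> nat \<Rightarrow> real" where
  "lambda_coeff E n =
     (if n = 0 then 0 else \<Prod>p\<in>prime_factors n. fps_nth (euler_factor E p) (multiplicity p n))"

text \<open>For a Dirichlet series \<open>F\<close> with coefficients \<open>f\<close> and \<open>f 1 = 1\<close>, \<open>neg_logderiv f\<close> gives the
  coefficients \<open>g\<close> of \<open>-F'/F\<close>: comparing coefficients in \<open>-F' = F * (-F'/F)\<close> yields
  \<open>f n * ln n = (\<Sum>d | d dvd n. g d * f (n div d))\<close>, and the term \<open>d = n\<close> is \<open>g n\<close>.\<close>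

function neg_logderiv :: "(nat \<Rightarrow> real) \<Rightarrow> nat \<Rightarrow> real" where
  "neg_logderiv f n =
     f n * ln (real n) - (\<Sum>d\<in>{d. d dvd n \<and> d < n}. neg_logderiv f d * f (n div d))"
  by auto
termination by (relation "measure snd") auto

declare neg_logderiv.simps [simp del]

text \<open>Defined by \<open>-L'/L(s, E) = \<Sum>n. ahat n * mangoldt n / n^s\<close>.  When \<open>n\<close> is not a prime
  power this leaves the value open, and it is \<open>0\<close> here.\<close>

definition ahat :: "curve \<Rightarrow> nat \<Rightarrow> real" where
  "ahat E n = neg_logderiv (lambda_coeff E) n / mangoldt n"


section \<open>The family of curves and the terms of the trace formula\<close>

definition minimal_condition :: "curve \<Rightarrow> bool" where
  "minimal_condition E \<longleftrightarrow> \<not> (\<exists>q::int. prime q \<and> q ^ 4 dvd fst E \<and> q ^ 6 dvd snd E)"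

definition curves_upto :: "real \<Rightarrow> curve set" where
  "curves_upto X = {(A, B). 4 * A ^ 3 + 27 * B ^ 2 \<noteq> 0 \<and>
     max (\<bar>real_of_int A\<bar> ^ 3) (\<bar>real_of_int B\<bar> ^ 2) \<le> X \<and> minimal_condition (A, B)}"

definition smallest_odd :: "nat \<Rightarrow> (nat \<Rightarrow> nat) \<Rightarrow> nat" where
  "smallest_odd k r =
     (if \<exists>i\<in>{1..k}. odd (r i) then Min {r i |i. i \<in> {1..k} \<and> odd (r i)} else 0)"

text \<open>The sum of the odd exponents, one occurrence of the smallest being left out.  The implied
  constants are allowed to depend on it: an estimate with the factor \<open>2 ^ smallest_odd k r\<close> cannot
  be uniform in two or more odd exponents, since for fixed \<open>X\<close> and primes the sum may grow
  exponentially in the larger of them.\<close>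

definition remaining_odd :: "nat \<Rightarrow> (nat \<Rightarrow> nat) \<Rightarrow> nat" where
  "remaining_odd k r = (\<Sum>i\<in>{i\<in>{1..k}. odd (r i)}. r i) - smallest_odd k r"

definition c_const :: "nat \<Rightarrow> (nat \<Rightarrow> nat) \<Rightarrow> (nat \<Rightarrow> nat) \<Rightarrow> real" where
  "c_const k e r =
     (if \<exists>j\<in>{1..k}. e j = 1 \<and> odd (r j) then 0
      else if (\<forall>j\<in>{1..k}. e j = 1 \<longrightarrow> r j = 2) \<and> odd (\<Sum>j\<in>{j\<in>{1..k}. e j = 2}. r j) then -1
      else 1)"

definition d_const :: "nat \<Rightarrow> (nat \<Rightarrow> nat) \<Rightarrow> (nat \<Rightarrow> nat) \<Rightarrow> real" where
  "d_const k e r =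
     (if \<exists>j\<in>{1..k}. e j = 2 \<or> e j = 1 \<and> odd (r j) then 0 else 1)"

text \<open>The common size of the two error terms, without the implied constant.  The second summand
  is absent unless every \<open>i\<close> has \<open>e i = 1\<close>, \<open>r i = 2\<close> or \<open>e i = 2\<close>.\<close>

definition error_size ::
    "nat \<Rightarrow> (nat \<Rightarrow> nat) \<Rightarrow> (nat \<Rightarrow> nat) \<Rightarrow> (nat \<Rightarrow> nat) \<Rightarrow> real \<Rightarrow> real" where
  "error_size k p e r X =
     2 ^ smallest_odd k r * (\<Prod>i=1..k. real (p i)) * X powr (1/2)
     + (if \<forall>i\<in>{1..k}. e i = 1 \<and> r i = 2 \<or> e i = 2
        then (\<Sum>i=1..k. 1 / real (p i)) * X powr (5/6) else 0)"

end

theory Submission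
  imports Defs "HOL-Library.Cardinality" "Berlekamp_Zassenhaus.Finite_Field"
begin

text \<open>
  By \<open>frob_trace_eq\<close>, for a prime \<open>p \<ge> 5\<close> the trace of Frobenius of a curve with (M) is the character sum
  \<open>- (\<Sum>x. (x^3 + A x + B | p))\<close>, since a change of model multiplies \<open>c4\<close> and \<open>c6\<close> by the fourth and sixth
  power of a unit at \<open>p\<close>.  So every term of the trace formula is a function of \<open>(A, B)\<close> modulo the
  product \<open>P\<close> of the primes, and its mean value factors by the Chinese remainder theorem.  Odd
  powers average to \<open>0\<close> by quadratic twisting, and the mean square of the trace is
  \<open>p - p/(p+1)\<close> on the nonzero pairs.  A function of mean value \<open>0\<close> modulo \<open>P\<close> sums to \<open>O(P X^(1/2))\<close>
  over the box, because complete blocks cancel; a sieve passes from the box to the pairs with (M).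

  The factor \<open>2^r\<close> needs Hasse's bound with its exact constant.  Following Manin, let \<open>d n\<close> be the
  degree of the numerator of the \<open>x\<close>-coordinate of \<open>(t^p, f(t)^((p-1)/2)) + n (t, 1)\<close> on the twist
  \<open>f(t) y^2 = f(x)\<close> over the rational functions in \<open>t\<close>.  Then \<open>d (n+1) + d (n-1) = 2 d n + 2\<close>, hence
  \<open>d n = n^2 + a n + p\<close>, where \<open>a\<close> is the trace, and nonnegativity for all integers \<open>n\<close> gives \<open>a^2 \<le> 4 p\<close>.
  Only \<open>x\<close>-coordinates occur in the recursion, so no group law is needed.
\<close>

section \<open>Hasse's bound\<close>

text \<open>Points of the twist over the rational functions correspond to morphisms of the curve to
  itself that commute with negation: \<open>(t, 1)\<close> is the identity,
  \<open>(t^p, f(t)^((p-1)/2))\<close> is Frobenius, and \<open>d n\<close> is the degree of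
  Frobenius plus \<open>n\<close>. This is why \<open>d\<close> has to be a quadratic polynomial
  without negative values. The recursion is exact only if numerator and denominator never acquire a
  common factor and no degree drops; the nonzero discriminant secures the first, the reduction at
  infinity the second.

  The sieve meets another obstacle: pairs divisible by some \<open>p i\<close> are rarer among
  minimal pairs than among all pairs, so a mean over all residues is not the mean over the family.
  Every local term vanishes at the zero pair, so the comparison function is the indicator of the
  nonzero pairs, which scaling by \<open>(d^4, d^6)\<close> with \<open>d\<close> coprime to
  \<open>P\<close> preserves. Hence means are normalized by \<open>p^2 - 1\<close>. The error with
  \<open>X^(5/6)\<close> comes from the curves divisible by some \<open>p i\<close> and from local
  means that are only close to 1 or \<open>1 - w\<close>.\<close>

lemma coeff_mult_le:
  fixes p q :: "'a::comm_semiring_0 poly"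
  assumes "degree p \<le> m" "degree q \<le> n"
  shows "coeff (p * q) (m + n) = coeff p m * coeff q n"
proof -
  have "coeff (p * q) (m + n) = (\<Sum>i\<le>m+n. coeff p i * coeff q (m + n - i))"
    by (simp add: coeff_mult)
  also have "\<dots> = (\<Sum>i\<in>{m}. coeff p i * coeff q (m + n - i))"
  proof (rule sum.mono_neutral_right)
    show "\<forall>i\<in>{..m + n} - {m}. coeff p i * coeff q (m + n - i) = 0"
    proof
      fix i assume i: "i \<in> {..m + n} - {m}"
      then consider "i > m" | "m + n - i > n" by force
      then show "coeff p i * coeff q (m + n - i) = 0"
        by cases (use assms in \<open>auto simp: coeff_eq_0\<close>)
    qed
  qed auto
  finally show ?thesis by simp
qed

lemma degree_mult_le_add:
  fixes p q :: "'a::comm_semiring_0 poly"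
  assumes "degree p \<le> m" "degree q \<le> n"
  shows "degree (p * q) \<le> m + n"
  using degree_mult_le[of p q] assms by linarith

section \<open>Addition of a fixed point in terms of x-coordinates\<close>

context
  fixes a b :: "'a::field_gcd"
begin

text \<open>On the twist \<open>f(t) y^2 = f(x)\<close>, \<open>f(x) = x^3 + a x + b\<close>, over the rational functions in \<open>t\<close>, let
  a point have the \<open>x\<close>-coordinate \<open>F/G\<close>.  After adding and subtracting the point \<open>(t, 1)\<close> the two
  \<open>x\<close>-coordinates have the sum \<open>ksum F G / kdiff F G ^ 2\<close> and the product
  \<open>kprod F G / kdiff F G ^ 2\<close>, so both are zeros of the quadratic form \<open>kummer F G\<close>.  The point at
  infinity is \<open>F/G = 1/0\<close>.\<close>

definition ksum :: "'a poly \<Rightarrow> 'a poly \<Rightarrow> 'a poly" where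
  "ksum F G = 2 * ((F * [:0, 1:] + [:a:] * G) * (F + [:0, 1:] * G) + 2 * [:b:] * G ^ 2)"

definition kprod :: "'a poly \<Rightarrow> 'a poly \<Rightarrow> 'a poly" where
  "kprod F G = ([:0, 1:] * F - [:a:] * G) ^ 2 - 4 * [:b:] * G * (F + [:0, 1:] * G)"

definition kdiff :: "'a poly \<Rightarrow> 'a poly \<Rightarrow> 'a poly" where
  "kdiff F G = F - [:0, 1:] * G"

definition kummer :: "'a poly \<Rightarrow> 'a poly \<Rightarrow> 'a poly \<Rightarrow> 'a poly \<Rightarrow> 'a poly" where
  "kummer F G H I = kdiff F G ^ 2 * H ^ 2 - ksum F G * H * I + kprod F G * I ^ 2"

text \<open>The form vanishes when two points differ by \<open>(t, 1)\<close> up to signs, a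
  symmetric relation. Because of the symmetry a chain of x-coordinates continues after the two pairs
  have exchanged roles.\<close>

lemma kummer_commute: "kummer F G H I = kummer H I F G"
  unfolding kummer_def kdiff_def ksum_def kprod_def by Groebner_Basis.algebra

text \<open>The degree and coefficient conditions record the (cuspidal) reduction of the twist at
  \<open>t = \<infinity>\<close>: its smooth points form an additive group, and \<open>x/t\<close> specializes to \<open>1/m^2\<close> at the
  point with parameter \<open>m\<close>; \<open>(t, 1)\<close> has the parameter 1.\<close>

definition xcoord :: "'a \<Rightarrow> 'a poly \<Rightarrow> 'a poly \<Rightarrow> bool" where
  "xcoord m F G \<longleftrightarrow> F \<noteq> 0 \<and> coprime F G \<and> degree ([:0, 1:] * G) \<le> degree F \<and>
     coeff ([:0, 1:] * G) (degree F) = m ^ 2 * lead_coeff F"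

text \<open>A Bezout identity for the cubic and its derivative whose constant is the discriminant up
  to sign; it excludes common zeros.\<close>

lemma bezout_cubic:
  "([:0, 1:] ^ 3 + [:a:] * [:0, 1:] + [:b:]) * (27 * [:b:] - 18 * [:a:] * [:0, 1:]) +
     (3 * [:0, 1:] ^ 2 + [:a:]) * (6 * [:a:] * [:0, 1:] ^ 2 - 9 * [:b:] * [:0, 1:] + 4 * [:a:] ^ 2) = [:4 * a ^ 3 + 27 * b ^ 2:]"
proof -
  have "[:4 * a ^ 3 + 27 * b ^ 2:] = 4 * [:a:] ^ 3 + 27 * [:b:] ^ 2"
    by (simp add: power3_eq_cube power2_eq_square numeral_poly)
  then show ?thesis by Groebner_Basis.algebra
qed

text \<open>A common prime factor \<open>q\<close> forces \<open>F = t G\<close> modulo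
  \<open>q\<close>, and the form becomes that of doubling \<open>(t, 1)\<close>: \<open>ksum\<close>
  reduces to \<open>4 G^2 f\<close> and \<open>kprod\<close> to \<open>G^2 (f'^2 - 8 t f)\<close>.
  So \<open>q\<close> divides \<open>f\<close> and \<open>f'\<close>, against the Bezout
  identity.\<close>

lemma kummer_primitive:
  assumes co: "coprime F G" and d: "4 * a ^ 3 + 27 * b ^ 2 \<noteq> 0" and two: "(2::'a) \<noteq> 0"
    and q: "prime_elem q" and "q dvd kdiff F G" "q dvd ksum F G" "q dvd kprod F G"
  shows False
proof -
  define V f where "V = kdiff F G" and "f = [:0, 1:] ^ 3 + [:a:] * [:0, 1:] + [:b:]"
  have F: "F = [:0, 1:] * G + V" by (simp add: V_def kdiff_def)
  have qV: "q dvd V" using assms by (simp add: V_def)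
  have qG: "\<not> q dvd G"
  proof
    assume "q dvd G"
    then have "q dvd F" using qV unfolding F by (intro dvd_add dvd_mult)
    with \<open>q dvd G\<close> co q show False by (meson coprime_common_divisor prime_elem_not_unit)
  qed
  have "ksum F G - 4 * G ^ 2 * f = V * (2 * (F * [:0, 1:] + [:a:] * G) + 4 * G * [:0, 1:] ^ 2)"
    unfolding ksum_def f_def F by Groebner_Basis.algebra
  then have "q dvd 4 * G ^ 2 * f"
    using qV assms(6) by (metis dvd_mult2 dvd_diff_right_iff)
  moreover have "\<not> q dvd (4 :: 'a poly)"
  proof
    assume *: "q dvd 4"
    have "(4::'a) \<noteq> 0" using two by (metis mult_eq_0_iff mult_2 numeral_Bit0)
    then have "is_unit [:4 :: 'a:]" by (simp only: is_unit_const_poly_iff dvd_field_iff) simp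
    then have "is_unit (4 :: 'a poly)" by (simp only: numeral_poly)
    then show False using * q prime_elem_not_unit dvd_trans by blast
  qed
  ultimately have qf: "q dvd f"
    using q qG by (metis prime_elem_dvd_mult_iff prime_elem_dvd_power)
  have "kprod F G - G ^ 2 * ((3 * [:0, 1:] ^ 2 + [:a:]) ^ 2 - 8 * [:0, 1:] * f)
      = V * ([:0, 1:] * ([:0, 1:] * F - [:a:] * G + [:0, 1:] ^ 2 * G - [:a:] * G) - 4 * [:b:] * G)"
    unfolding kprod_def f_def F by Groebner_Basis.algebra
  then have "q dvd G ^ 2 * ((3 * [:0, 1:] ^ 2 + [:a:]) ^ 2 - 8 * [:0, 1:] * f)"
    using qV assms(7) by (metis dvd_mult2 dvd_diff_right_iff)
  then have "q dvd (3 * [:0, 1:] ^ 2 + [:a:]) ^ 2 - 8 * [:0, 1:] * f"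
    using q qG by (metis prime_elem_dvd_mult_iff prime_elem_dvd_power)
  then have "q dvd (3 * [:0, 1:] ^ 2 + [:a:]) ^ 2"
    using qf by (metis dvd_mult dvd_diff_left_iff)
  then have "q dvd 3 * [:0, 1:] ^ 2 + [:a:]" using q prime_elem_dvd_power by blast
  then have "q dvd [:4 * a ^ 3 + 27 * b ^ 2:]"
    using qf bezout_cubic f_def by (metis dvd_add dvd_mult2)
  moreover have "is_unit [:4 * a ^ 3 + 27 * b ^ 2:]" using d by (simp only: is_unit_const_poly_iff dvd_field_iff) simp
  ultimately show False using q prime_elem_not_unit dvd_trans by blast
qed

text \<open>Vieta's formulas over the polynomial ring: a root \<open>H/I\<close> in lowest terms
  splits off a linear factor with polynomial cofactor, as in Gauss's lemma.\<close>

lemma kummer_other_root: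
  assumes co: "coprime H I" and U: "kprod F G \<noteq> 0" and root: "kummer F G H I = 0"
  obtains H' I' where "kdiff F G ^ 2 = I * I'" "kprod F G = H * H'" "ksum F G = H * I' + H' * I"
proof -
  define V W U where "V = kdiff F G" and "W = ksum F G" and "U = kprod F G"
  have root: "V ^ 2 * H ^ 2 - W * H * I + U * I ^ 2 = 0"
    using root by (simp add: kummer_def V_def W_def U_def)
  have U0: "U \<noteq> 0" using U by (simp add: U_def)
  have "U * I ^ 2 = H * (W * I - V ^ 2 * H)" using root by Groebner_Basis.algebra
  then have "H dvd U * I ^ 2" by simp
  then have "H dvd U" using co by (simp add: coprime_dvd_mult_left_iff)
  then obtain H' where H': "U = H * H'" unfolding dvd_def by blast
  then have H0: "H \<noteq> 0" using U0 by auto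
  have "V ^ 2 * H ^ 2 = I * (W * H - U * I)" using root by Groebner_Basis.algebra
  then have "I dvd V ^ 2 * H ^ 2" by simp
  then have "I dvd V ^ 2" using co by (simp add: coprime_dvd_mult_left_iff coprime_commute)
  then obtain I' where I': "V ^ 2 = I * I'" unfolding dvd_def by blast
  show thesis
  proof (cases "I = 0")
    case False
    have "H * I * (I' * H - W + H' * I) = 0" using root unfolding H' I' by Groebner_Basis.algebra
    then have "I' * H - W + H' * I = 0" using False H0 by simp
    then have "W = H * I' + H' * I" by Groebner_Basis.algebra
    then show thesis using that[of I' H'] H' I' by (simp add: V_def W_def U_def)
  next
    \<comment> \<open>\<open>H/I\<close> is the point at infinity, so \<open>I * I' = 0\<close>
      leaves \<open>I'\<close> free. It is read off from \<open>ksum\<close>, as \<open>H\<close> is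
      a unit.\<close>
    case True
    then have "is_unit H" using co by simp
    then have "H dvd W" by (meson dvd_trans one_dvd)
    then obtain J where "W = H * J" unfolding dvd_def by blast
    moreover have "I * J = I * I'" using True by simp
    ultimately show thesis using that[of J H'] H' I' True by (simp add: V_def W_def U_def)
  qed
qed

lemma degree_le_degree_T: "degree (p :: 'a poly) \<le> degree ([:0, 1:] * p)"
  by (cases "p = 0") auto

text \<open>The degree \<open>2 * degree F + 2\<close> of \<open>kprod\<close> is the source of the
  summand 2 in the recursion. The coefficient \<open>2 * (1 + m^2) = (m - 1)^2 + (m + 1)^2\<close>
  reflects that the parameters at infinity add.\<close>

lemma kummer_coeffs:
  assumes "xcoord m F G"
  shows "degree (kprod F G) \<le> 2 * degree F + 2"
    and "coeff (kprod F G) (2 * degree F + 2) = lead_coeff F ^ 2"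
    and "degree ([:0, 1:] * ksum F G) \<le> 2 * degree F + 2"
    and "coeff ([:0, 1:] * ksum F G) (2 * degree F + 2) = 2 * lead_coeff F ^ 2 * (1 + m ^ 2)"
proof -
  define D where "D = degree F"
  have F0: "F \<noteq> 0" and TG: "degree ([:0, 1:] * G) \<le> D" and lc: "coeff ([:0, 1:] * G) D = m ^ 2 * lead_coeff F"
    using assms by (auto simp: xcoord_def D_def)
  have G: "degree G \<le> D" using TG degree_le_degree_T[of G] by linarith
  have TF: "degree ([:0, 1:] * F) \<le> D + 1" by (simp add: D_def F0)
  have AG: "degree ([:a:] * G) \<le> D" using G by (simp add: degree_mult_le_add[of "[:a:]" 0 G D, simplified])
  define P where "P = [:0, 1:] * F - [:a:] * G"
  have P: "degree P \<le> D + 1" unfolding P_def by (rule degree_diff_le) (use TF AG in auto)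
  have cP: "coeff P (D + 1) = lead_coeff F"
    using G by (simp add: P_def coeff_eq_0 D_def)
  define Q where "Q = F * [:0, 1:] + [:a:] * G"
  have Q: "degree Q \<le> D + 1" unfolding Q_def
    by (rule degree_add_le) (use TF AG in \<open>auto simp: mult.commute\<close>)
  have cQ: "coeff Q (D + 1) = lead_coeff F"
    using G by (simp add: Q_def coeff_eq_0 D_def mult.commute[of F])
  define R where "R = F + [:0, 1:] * G"
  have R: "degree R \<le> D" unfolding R_def by (rule degree_add_le) (use TG in \<open>auto simp: D_def\<close>)
  have cR: "coeff R D = (1 + m ^ 2) * lead_coeff F"
    using lc unfolding R_def by (simp add: D_def algebra_simps)
  have d2: "degree (2 :: 'a poly) \<le> 0" by simp
  have BG: "degree (4 * [:b:] * G) \<le> D"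
    using degree_mult_le_add[of "4 * [:b:]" 0 G D] G by (simp add: numeral_poly)
  have BGR: "degree (4 * [:b:] * G * R) \<le> 2 * D" using degree_mult_le_add[OF BG R] by simp
  have P2: "degree (P ^ 2) \<le> 2 * D + 2" using degree_mult_le_add[OF P P] by (simp add: power2_eq_square)
  have U: "kprod F G = P ^ 2 - 4 * [:b:] * G * R" by (simp add: kprod_def P_def R_def)
  show "degree (kprod F G) \<le> 2 * degree F + 2"
    unfolding U by (rule degree_diff_le) (use P2 BGR D_def in auto)
  have "coeff (P ^ 2) (2 * D + 2) = lead_coeff F ^ 2"
    using coeff_mult_le[OF P P] cP by (simp add: power2_eq_square mult_2)
  then show "coeff (kprod F G) (2 * degree F + 2) = lead_coeff F ^ 2"
    unfolding U using coeff_eq_0[OF le_less_trans[OF BGR], of "2 * D + 2"] by (simp add: D_def)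
  have BGG: "degree (2 * [:b:] * G ^ 2) \<le> 2 * D"
    using degree_mult_le_add[of "2 * [:b:]" 0 "G ^ 2" "2 * D"] degree_mult_le_add[OF G G]
    by (simp add: numeral_poly power2_eq_square)
  have QR: "degree (Q * R) \<le> 2 * D + 1" using degree_mult_le_add[OF Q R] by simp
  have S: "degree (Q * R + 2 * [:b:] * G ^ 2) \<le> 2 * D + 1"
    by (rule degree_add_le) (use QR BGG in auto)
  have cS: "coeff (Q * R + 2 * [:b:] * G ^ 2) (2 * D + 1) = lead_coeff F ^ 2 * (1 + m ^ 2)"
  proof -
    have "coeff (Q * R) (2 * D + 1) = lead_coeff F * ((1 + m ^ 2) * lead_coeff F)"
      using coeff_mult_le[OF Q R] cQ cR by (simp add: mult_2)
    moreover have "coeff (2 * [:b:] * G ^ 2) (2 * D + 1) = 0"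
      using BGG by (intro coeff_eq_0) linarith
    ultimately show ?thesis by (simp add: power2_eq_square)
  qed
  have W: "ksum F G = 2 * (Q * R + 2 * [:b:] * G ^ 2)" by (simp add: ksum_def Q_def R_def)
  have dW: "degree (ksum F G) \<le> 2 * D + 1" unfolding W
    using degree_mult_le_add[OF d2 S] by simp
  show "degree ([:0, 1:] * ksum F G) \<le> 2 * degree F + 2"
    using degree_mult_le_add[of "[:0, 1:]" 1, OF _ dW] by (simp add: D_def)
  have "coeff ([:0, 1:] * ksum F G) (2 * D + 2) = coeff (ksum F G) (2 * D + 1)"
    by (simp add: numeral_eq_Suc)
  also have "\<dots> = 2 * coeff (Q * R + 2 * [:b:] * G ^ 2) (2 * D + 1)"
    unfolding W using coeff_mult_le[OF d2 S] by (simp add: numeral_poly)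
  finally show "coeff ([:0, 1:] * ksum F G) (2 * degree F + 2) = 2 * lead_coeff F ^ 2 * (1 + m ^ 2)"
    using cS unfolding D_def by (metis mult.assoc)
qed

text \<open>\<open>H * H' = kprod F G\<close> turns the degree of \<open>kprod\<close> into the
  degree recursion. A common factor of \<open>H'\<close> and \<open>I'\<close> would divide all
  three coefficients of the form, which \<open>kummer_primitive\<close> excludes. The leading data
  of \<open>I'\<close> follow from \<open>ksum = H * I' + H' * I\<close>.\<close>

lemma xcoord_step:
  assumes d: "4 * a ^ 3 + 27 * b ^ 2 \<noteq> 0" and two: "(2::'a) \<noteq> 0"
    and FG: "xcoord m F G" and HI: "xcoord (m - 1) H I" and root: "kummer F G H I = 0"
  obtains H' I' where "xcoord (m + 1) H' I'" "degree H + degree H' = 2 * degree F + 2"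
    "kummer F G H' I' = 0"
proof -
  let ?D = "degree F"
  note co = kummer_coeffs[OF FG]
  have F0: "lead_coeff F \<noteq> 0" using FG by (simp add: xcoord_def)
  then have U0: "kprod F G \<noteq> 0" using co(2) by auto
  then have dU: "degree (kprod F G) = 2 * ?D + 2"
    using co(1,2) F0 le_degree[of "kprod F G" "2 * ?D + 2"] by (intro antisym) auto
  from HI have coHI: "coprime H I" and H0: "H \<noteq> 0" and TI: "degree ([:0, 1:] * I) \<le> degree H"
    and lI: "coeff ([:0, 1:] * I) (degree H) = (m - 1) ^ 2 * lead_coeff H"
    by (auto simp: xcoord_def)
  obtain H' I' where V: "kdiff F G ^ 2 = I * I'" and U: "kprod F G = H * H'"
    and W: "ksum F G = H * I' + H' * I"
    using kummer_other_root[OF coHI U0 root] by blast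
  have H'0: "H' \<noteq> 0" using U U0 by auto
  have deg: "degree H + degree H' = 2 * ?D + 2" using dU U H0 H'0 by (simp add: degree_mult_eq)
  have cop: "coprime H' I'"
  proof (rule ccontr)
    assume "\<not> coprime H' I'"
    then have "\<not> is_unit (gcd H' I')" by (metis coprime_iff_gcd_eq_1 is_unit_gcd_iff)
    moreover have "gcd H' I' \<noteq> 0" using H'0 by simp
    ultimately obtain q where q: "prime q" "q dvd gcd H' I'"
      using prime_divisor_exists by blast
    then have "q dvd kprod F G" "q dvd kdiff F G ^ 2" "q dvd ksum F G"
      unfolding U V W by auto
    moreover from this q(1) have "q dvd kdiff F G" using prime_dvd_power by blast
    ultimately show False
      using kummer_primitive[OF _ d two] q(1) FG by (auto simp: xcoord_def)
  qed
  have HTI: "H * ([:0, 1:] * I') = [:0, 1:] * ksum F G - H' * ([:0, 1:] * I)" unfolding W by (simp add: algebra_simps)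
  have d1: "degree (H' * ([:0, 1:] * I)) \<le> 2 * ?D + 2"
    using degree_mult_le_add[OF order.refl TI, of H'] deg by linarith
  have d2: "degree (H * ([:0, 1:] * I')) \<le> 2 * ?D + 2"
    unfolding HTI by (rule degree_diff_le) (use co d1 in auto)
  have TI': "degree ([:0, 1:] * I') \<le> degree H'"
  proof (cases "I' = 0")
    case False
    then have "degree (H * ([:0, 1:] * I')) = degree H + degree ([:0, 1:] * I')"
      using H0 by (intro degree_mult_eq) auto
    then show ?thesis using d2 deg by linarith
  qed auto
  have "lead_coeff H * coeff ([:0, 1:] * I') (degree H') = coeff (H * ([:0, 1:] * I')) (2 * ?D + 2)"
    using coeff_mult_le[OF order.refl TI', of H] deg by simp
  also have "\<dots> = 2 * lead_coeff F ^ 2 * (1 + m ^ 2) - lead_coeff H' * ((m - 1) ^ 2 * lead_coeff H)"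
    unfolding HTI coeff_diff co(4) using coeff_mult_le[OF order.refl TI, of H'] deg lI
    by (simp add: add.commute)
  also have "lead_coeff F ^ 2 = lead_coeff H * lead_coeff H'"
    using co(2) dU U by (metis lead_coeff_mult)
  finally have "lead_coeff H * coeff ([:0, 1:] * I') (degree H')
      = lead_coeff H * ((m + 1) ^ 2 * lead_coeff H')"
    by (simp add: power2_eq_square algebra_simps)
  then have "coeff ([:0, 1:] * I') (degree H') = (m + 1) ^ 2 * lead_coeff H'" using H0 by simp
  then have X: "xcoord (m + 1) H' I'" using H'0 cop TI' by (simp add: xcoord_def)
  have "kummer F G H' I' = 0" unfolding kummer_def U V W by Groebner_Basis.algebra
  then show thesis using that X deg by blast
qed

text \<open>A recursion of second order is determined by two values, so the terms of
  \<open>D\<close> are degrees. The parameter \<open>m + of_nat n\<close> may return to 0 in the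
  field; \<open>xcoord\<close> allows this, so no residue class of \<open>n\<close> is
  exceptional.\<close>

lemma xcoord_chain:
  assumes d: "4 * a ^ 3 + 27 * b ^ 2 \<noteq> 0" and two: "(2::'a) \<noteq> 0"
    and FG: "xcoord m F G" and HI: "xcoord (m - 1) H I" and root: "kummer F G H I = 0"
    and rec: "\<And>n::nat. D (Suc (Suc n)) + D n = 2 * D (Suc n) + (2::int)"
    and D: "D 0 = int (degree H)" "D 1 = int (degree F)"
  shows "D n \<ge> 0"
proof -
  have "\<exists>F G H I. xcoord (m + of_nat n) F G \<and> xcoord (m + of_nat n - 1) H I \<and> kummer F G H I = 0
      \<and> D n = int (degree H) \<and> D (Suc n) = int (degree F)"
  proof (induction n)
    case 0
    then show ?case using assms by (intro exI[of _ F] exI[of _ G] exI[of _ H] exI[of _ I]) auto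
  next
    case (Suc n)
    then obtain F G H I where *: "xcoord (m + of_nat n) F G" "xcoord (m + of_nat n - 1) H I"
      "kummer F G H I = 0" "D n = int (degree H)" "D (Suc n) = int (degree F)" by blast
    obtain H' I' where 1: "xcoord (m + of_nat n + 1) H' I'"
      "degree H + degree H' = 2 * degree F + 2" "kummer F G H' I' = 0"
      using xcoord_step[OF d two *(1-3)] by blast
    have "D (Suc (Suc n)) = int (degree H')" using rec[of n] 1(2) *(4,5) by linarith
    moreover have "m + of_nat (Suc n) = m + of_nat n + 1" by simp
    ultimately show ?case using * 1 kummer_commute[of F G]
      by (intro exI[of _ H'] exI[of _ I'] exI[of _ F] exI[of _ G]) (simp add: algebra_simps)
  qed
  then show ?thesis by force
qed

end

section \<open>Polynomials with prescribed linear factors\<close>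

lemma linear_dvd_iff: "[:- c, 1:] dvd p \<longleftrightarrow> poly p c = (0::'a::field_gcd)"
  by (simp add: poly_eq_0_iff_dvd)

lemma coprime_linear_iff: "coprime p [:- c, 1:] \<longleftrightarrow> poly p c \<noteq> (0::'a::field_gcd)"
proof
  assume "coprime p [:- c, 1:]"
  moreover have "\<not> is_unit [:- c, 1:]" by (simp add: is_unit_iff_degree)
  ultimately show "poly p c \<noteq> 0"
    by (metis coprime_common_divisor dvd_refl linear_dvd_iff)
next
  assume "poly p c \<noteq> 0"
  moreover have "prime_elem [:- c, 1:]"
    by (rule irreducible_imp_prime_elem, rule irreducible_linear_poly) auto
  ultimately show "coprime p [:- c, 1:]"
    by (metis coprime_commute linear_dvd_iff prime_elem_imp_coprime)
qed

lemma prod_linear_dvd: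
  fixes A :: "'a::field_gcd set"
  assumes "finite A" "\<And>c. c \<in> A \<Longrightarrow> poly p c = 0"
  shows "(\<Prod>c\<in>A. [:- c, 1:]) dvd p"
  using assms
proof (induction A)
  case (insert c A)
  have "coprime [:- c, 1:] (\<Prod>d\<in>A. [:- d, 1:])"
    using insert.hyps by (intro prod_coprime_right) (auto simp: coprime_linear_iff)
  then have "[:- c, 1:] * (\<Prod>d\<in>A. [:- d, 1:]) dvd p"
    using insert by (intro divides_mult) (auto simp: linear_dvd_iff)
  then show ?case using insert.hyps by simp
qed auto

lemma monic_prod_linear:
  fixes A :: "'a::field_gcd set"
  assumes "finite A"
  shows "degree (\<Prod>c\<in>A. [:- c, 1:]) = card A" "lead_coeff (\<Prod>c\<in>A. [:- c, 1:]) = 1"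
proof -
  show "lead_coeff (\<Prod>c\<in>A. [:- c, 1:]) = 1" by (subst lead_coeff_prod) simp
qed (simp add: degree_prod_eq_sum_degree)

text \<open>Only integers are tested, while the minimum may lie halfway between two of them. For odd
  \<open>\<alpha>\<close> this would give just \<open>4 * p + 1\<close>; the gap closes because
  \<open>k^2 + k\<close> is even and \<open>p\<close> is odd.\<close>

lemma int_quadratic_discriminant:
  fixes \<alpha> p :: int
  assumes "\<And>n. n ^ 2 + \<alpha> * n + p \<ge> 0" "odd p"
  shows "\<alpha> ^ 2 \<le> 4 * p"
proof (cases "even \<alpha>")
  case True
  then obtain k where "\<alpha> = 2 * k" by (auto elim: evenE)
  then show ?thesis using assms(1)[of "- k"] by (simp add: power2_eq_square)
next
  case False
  then obtain k where k: "\<alpha> = 2 * k + 1" by (auto elim: oddE)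
  have "p \<ge> k ^ 2 + k" using assms(1)[of "- k"] by (simp add: k power2_eq_square algebra_simps)
  moreover have "even (k ^ 2 + k)" by simp
  ultimately have "p \<ge> k ^ 2 + k + 1" using assms(2) by (metis add_le_imp_le_left le_less zless_imp_add1_zle)
  then show ?thesis by (simp add: k power2_eq_square algebra_simps)
qed

text \<open>Two values start the recursion: \<open>d 0 = p\<close>, and \<open>d (-1)\<close> from
  the addition formula, whose denominator \<open>(t^p - t)^2\<close> vanishes at every element
  \<open>c\<close> of the field. The factor at \<open>c\<close> cancels twice, once or not at all
  according as \<open>f(c)^h\<close> is -1, 0 or 1.\<close>

theorem hasse_bound_field:
  fixes a b :: "'a::{field_gcd,finite_field}"
  assumes d: "4 * a ^ 3 + 27 * b ^ 2 \<noteq> 0" and p: "CARD('a) = p" "CHAR('a) = p" "p \<ge> 5"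
  shows "(int (card {c. (c ^ 3 + a * c + b) ^ ((p - 1) div 2) = - 1})
           - int (card {c. (c ^ 3 + a * c + b) ^ ((p - 1) div 2) = 1})) ^ 2 \<le> 4 * int p"
proof -
  define h where "h = (p - 1) div 2"
  have prime: "prime p" using CHAR_prime[where ?'a='a] p by simp
  then have "odd p" using p(3) prime_odd_nat[of p] by linarith
  then have h: "2 * h + 1 = p" "h > 0" using p(3) by (auto simp: h_def elim!: oddE)
  have "\<not> p dvd 2" using p(3) by (auto dest: dvd_imp_le)
  then have two: "(2::'a) \<noteq> 0"
    using of_nat_eq_0_iff_char_dvd[where ?'a='a, of 2] p by simp
  define f :: "'a poly" where "f = [:0, 1:] ^ 3 + [:a:] * [:0, 1:] + [:b:]"
  define Tp \<Phi> :: "'a poly" where "Tp = [:0, 1:] ^ p" and "\<Phi> = f ^ h"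
  have pf: "poly f c = c ^ 3 + a * c + b" for c by (simp add: f_def)
  have pw: "c ^ p = c" for c :: 'a using finite_field_power_card_eq_same[of c] p by simp
  have frob: "(u + v) ^ p = u ^ p + v ^ p" for u v :: "'a poly"
    by (rule freshmans_dream) (use p prime in simp_all)
  have const: "[:c:] ^ p = [:c:]" for c :: 'a by (simp add: poly_const_pow pw)
  define Np Nm N0 where "Np = {c. poly f c ^ h = 1}" and "Nm = {c. poly f c ^ h = - 1}"
    and "N0 = {c. poly f c = 0}"
  have E: "f * \<Phi> ^ 2 = Tp ^ 3 + [:a:] * Tp + [:b:]"
  proof -
    have "f * \<Phi> ^ 2 = f ^ p" unfolding \<Phi>_def by (simp flip: h(1) add: power_mult mult.commute)
    also have "\<dots> = ([:0, 1:] ^ 3) ^ p + ([:a:] * [:0, 1:]) ^ p + [:b:] ^ p" by (simp only: f_def frob)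
    also have "\<dots> = Tp ^ 3 + [:a:] * Tp + [:b:]"
      by (simp only: power_mult_distrib const Tp_def) (simp only: mult.commute flip: power_mult)
    finally show ?thesis .
  qed
  \<comment> \<open>\<open>R / S\<close> and \<open>R' / S\<close> are the \<open>x\<close>-coordinates of the point \<open>(Tp, \<Phi>)\<close> minus and plus \<open>(t, 1)\<close>.\<close>
  define V where "V = Tp - [:0, 1:]"
  define S R R' where "S = V ^ 2" and "R = f * (\<Phi> + 1) ^ 2 - (Tp + [:0, 1:]) * V ^ 2"
    and "R' = f * (\<Phi> - 1) ^ 2 - (Tp + [:0, 1:]) * V ^ 2"
  have ksum1: "ksum a b Tp 1 = 2 * ((Tp * [:0, 1:] + [:a:]) * (Tp + [:0, 1:]) + 2 * [:b:])"
    by (simp only: ksum_def mult_1_right power_one)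
  have kprod1: "kprod a b Tp 1 = ([:0, 1:] * Tp - [:a:]) ^ 2 - 4 * [:b:] * (Tp + [:0, 1:])"
    by (simp only: kprod_def mult_1_right)
  have W: "ksum a b Tp 1 = R + R'"
  proof -
    have "R + R' = 2 * (f * \<Phi> ^ 2) + 2 * f - 2 * (Tp + [:0, 1:]) * V ^ 2"
      unfolding R_def R'_def by Groebner_Basis.algebra
    also have "\<dots> = ksum a b Tp 1" unfolding E ksum1 V_def unfolding f_def by Groebner_Basis.algebra
    finally show ?thesis ..
  qed
  have U: "kprod a b Tp 1 * V ^ 2 = R * R'"
  proof -
    have "R * R' = (f * \<Phi> ^ 2 - f) ^ 2 - 2 * (Tp + [:0, 1:]) * V ^ 2 * (f * \<Phi> ^ 2 + f) + (Tp + [:0, 1:]) ^ 2 * V ^ 4"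
      unfolding R_def R'_def by Groebner_Basis.algebra
    also have "\<dots> = kprod a b Tp 1 * V ^ 2" unfolding E kprod1 V_def unfolding f_def by Groebner_Basis.algebra
    finally show ?thesis ..
  qed
  have "kdiff Tp 1 = V" by (simp add: kdiff_def V_def)
  then have "kummer a b Tp 1 R S = V ^ 2 * (R ^ 2 - ksum a b Tp 1 * R + kprod a b Tp 1 * V ^ 2)"
    unfolding kummer_def S_def by (simp add: algebra_simps power2_eq_square)
  also have "\<dots> = 0" unfolding U unfolding W by Groebner_Basis.algebra
  finally have root: "kummer a b Tp 1 R S = 0" .
  have fin: "finite A" for A :: "'a set" by (rule finite_subset[OF subset_UNIV finite])
  have "lead_coeff Tp = 1" by (simp only: Tp_def lead_coeff_power) simp
  moreover have "degree Tp = p" by (simp add: Tp_def degree_power_eq)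
  ultimately have dTp: "degree Tp = p" "lead_coeff Tp = 1" "coeff Tp p = 1" by auto
  have one: "(1::'a) \<noteq> - 1" using two by (metis add.left_inverse one_add_one)
  have part: "Np \<inter> Nm = {}" "(Np \<union> Nm) \<inter> N0 = {}" "Np \<union> Nm \<union> N0 = UNIV"
  proof -
    show "Np \<inter> Nm = {}" "(Np \<union> Nm) \<inter> N0 = {}"
      using one h(2) by (auto simp: Np_def Nm_def N0_def zero_power)
    have "c \<in> Np \<union> Nm" if "c \<notin> N0" for c
    proof -
      have "poly f c * (poly f c ^ h) ^ 2 = poly f c"
        using pw[of "poly f c"] by (simp flip: h(1) add: power_mult mult.commute)
      then have "(poly f c ^ h) ^ 2 = 1" using that by (simp add: N0_def)
      then show ?thesis by (auto simp: Np_def Nm_def power2_eq_1_iff)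
    qed
    then show "Np \<union> Nm \<union> N0 = UNIV" by blast
  qed
  have cards: "card Np + card Nm + card N0 = p"
    using part card_Un_disjoint[OF fin fin, of Np Nm] card_Un_disjoint[OF fin fin, of "Np \<union> Nm" N0] p
    by simp
  define L where "L = (\<lambda>A::'a set. \<Prod>c\<in>A. [:- c, 1:])"
  have L: "degree (L A) = card A" "lead_coeff (L A) = 1" "coeff (L A) (card A) = 1" for A
    unfolding L_def using monic_prod_linear[OF fin, of A] by auto
  have LU: "L (A \<union> B) = L A * L B" if "A \<inter> B = {}" for A B
    unfolding L_def by (rule prod.union_disjoint[OF fin fin that])
  have V_prod: "V = L UNIV"
  proof (rule poly_eqI_degree_lead_coeff)
    have dV: "degree V = p" unfolding V_def diff_conv_add_uminus
      using dTp p(3) by (subst degree_add_eq_left) auto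
    show "degree V \<le> p" "degree (L UNIV) \<le> p" "p \<le> card (UNIV :: 'a set)" using dV L p by auto
    show "coeff V p = coeff (L UNIV) p"
      using L[of UNIV] dTp p by (simp add: V_def coeff_eq_0)
    show "poly V c = poly (L UNIV) c" if "c \<in> UNIV" for c
    proof -
      have "poly V c = 0" by (simp add: V_def Tp_def pw)
      moreover have "poly (L UNIV) c = 0" by (auto simp: L_def poly_prod fin)
      ultimately show ?thesis by simp
    qed
  qed
  have V: "V = L Np * L Nm * L N0" unfolding V_prod part(3)[symmetric] using LU part(1,2) by simp
  \<comment> \<open>\<open>C\<close> is the part of the denominator that cancels; this brings the point count into the degree.\<close>
  define C G' where "C = L Nm ^ 2 * L N0" and "G' = L Np ^ 2 * L N0"
  have S: "S = C * G'" unfolding S_def C_def G'_def V by Groebner_Basis.algebra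
  have cop0: "coprime (L Nm ^ 2) (L N0)"
    unfolding L_def using part(2)
    by (auto intro!: prod_coprime_left prod_coprime_right simp: coprime_linear_iff)
  have m\<Phi>: "L Nm dvd \<Phi> + 1"
    unfolding L_def by (rule prod_linear_dvd[OF fin]) (auto simp: \<Phi>_def Nm_def)
  have "L Nm ^ 2 dvd R"
    unfolding R_def by (intro dvd_diff dvd_mult dvd_power_same m\<Phi>) (simp add: V)
  moreover have "L N0 dvd f"
    unfolding L_def by (rule prod_linear_dvd[OF fin]) (auto simp: N0_def)
  then have "L N0 dvd R" unfolding R_def
    by (intro dvd_diff dvd_mult2[of _ f] dvd_mult) (auto simp: V power2_eq_square)
  ultimately have "C dvd R" unfolding C_def using cop0 by (intro divides_mult)
  then obtain F' where R: "R = C * F'" unfolding dvd_def by blast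
  have V0: "poly V c = 0" for c by (simp add: V_def Tp_def pw)
  have "poly F' c \<noteq> 0" if "c \<in> Np" for c
  proof -
    have c: "poly f c \<noteq> 0" "poly \<Phi> c = 1" using that h(2) by (auto simp: Np_def \<Phi>_def zero_power)
    have "poly R c = poly f c * (1 + 1) ^ 2" by (simp only: R_def poly_diff poly_mult poly_power poly_add V0 c) simp
    moreover have "poly f c * (1 + 1) ^ 2 \<noteq> 0" using c two
      by (simp only: mult_eq_0_iff power_eq_0_iff one_add_one) simp
    ultimately have "poly R c \<noteq> 0" by simp
    then show ?thesis by (auto simp: R)
  qed
  \<comment> \<open>A zero of \<open>F'\<close> would make \<open>c\<close> a double zero of
    \<open>R\<close>. As \<open>V^2\<close> has a double zero and \<open>\<Phi> + 1\<close> is 1 at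
    \<open>c\<close>, it would be a double zero of \<open>f\<close>, which is separable.\<close>
  moreover have "poly F' c \<noteq> 0" if c: "c \<in> N0" for c
  proof
    let ?l = "[:- c, 1:]"
    assume "poly F' c = 0"
    then have "?l dvd F'" by (simp add: linear_dvd_iff)
    moreover have "?l dvd L N0" unfolding L_def by (rule dvd_prodI[OF fin c])
    ultimately have "?l * ?l dvd L N0 * F'" by (simp only: mult_dvd_mono mult.commute)
    then have "?l ^ 2 dvd R" unfolding R C_def power2_eq_square by (metis dvd_mult mult.assoc)
    moreover have "?l dvd V" using V0 by (simp only: linear_dvd_iff)
    then have "?l ^ 2 dvd (Tp + [:0, 1:]) * V ^ 2" by (intro dvd_mult dvd_power_same)
    ultimately have "?l ^ 2 dvd f * (\<Phi> + 1) ^ 2"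
      unfolding R_def by (metis dvd_diff_left_iff)
    moreover have "coprime (?l ^ 2) ((\<Phi> + 1) ^ 2)"
      using c h(2)
      by (subst coprime_commute) (simp add: coprime_linear_iff N0_def \<Phi>_def zero_power)
    ultimately have "?l ^ 2 dvd f" by (simp add: coprime_dvd_mult_left_iff)
    then obtain k where "f = ?l ^ 2 * k" unfolding dvd_def by blast
    moreover have "pderiv (l ^ 2 * k) = l * (2 * pderiv l * k + l * pderiv k)" for l
      by (simp only: power2_eq_square pderiv_mult) Groebner_Basis.algebra
    ultimately have "poly (pderiv f) c = 0" by simp
    moreover have "pderiv f = 3 * [:0, 1:] ^ 2 + [:a:]"
      by (simp add: f_def pderiv_add pderiv_mult pderiv_pCons power3_eq_cube power2_eq_square
          numeral_poly algebra_simps)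
    ultimately have "poly (3 * [:0, 1:] ^ 2 + [:a:]) c = 0" by simp
    moreover have "poly ([:0, 1:] ^ 3 + [:a:] * [:0, 1:] + [:b:]) c = 0" using c by (simp add: N0_def f_def)
    ultimately have "poly [:4 * a ^ 3 + 27 * b ^ 2:] c = 0"
      unfolding bezout_cubic[symmetric] by (simp only: poly_add poly_mult) simp
    then show False using d by simp
  qed
  ultimately have cop: "coprime F' G'"
    unfolding G'_def L_def
    by (auto intro!: prod_coprime_right simp: coprime_linear_iff)
  have dC: "degree C = 2 * card Nm + card N0" "lead_coeff C = 1"
  proof -
    have "L Nm \<noteq> 0" "L N0 \<noteq> 0" using L(2) by (metis coeff_0 zero_neq_one)+
    then show "degree C = 2 * card Nm + card N0"
      by (simp add: C_def degree_mult_eq degree_power_eq L)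
    show "lead_coeff C = 1" by (simp add: C_def lead_coeff_mult lead_coeff_power L)
  qed
  have dG': "degree G' = 2 * card Np + card N0" "lead_coeff G' = 1"
  proof -
    have "L Np \<noteq> 0" "L N0 \<noteq> 0" using L(2) by (metis coeff_0 zero_neq_one)+
    then show "degree G' = 2 * card Np + card N0"
      by (simp add: G'_def degree_mult_eq degree_power_eq L)
    show "lead_coeff G' = 1" by (simp add: G'_def lead_coeff_mult lead_coeff_power L)
  qed
  have dR: "degree R = 2 * p + 1" "lead_coeff R = 1"
  proof -
    \<comment> \<open>The cubes of \<open>Tp\<close> cancel between \<open>f * \<Phi>^2\<close> and
      \<open>(Tp + t) * (Tp - t)^2\<close>. The next term \<open>Tp^2 * t\<close> decides the
      degree; \<open>Z\<close> is the rest, where \<open>2 * f^(h + 1)\<close> has degree at most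
      \<open>3 * h + 3 \<le> 4 * h + 2 = 2 * p\<close>.\<close>
    define Z where "Z = Tp * [:0, 1:] ^ 2 - [:0, 1:] ^ 3 + [:a:] * Tp + [:b:] + 2 * f ^ Suc h + f"
    have df: "degree f \<le> 3"
      unfolding f_def by (intro degree_add_le) (auto simp: degree_power_eq)
    have "degree (f ^ Suc h) \<le> 3 * Suc h"
      using degree_power_le[of f "Suc h"] df by (meson le_trans mult_le_mono1)
    then have 1: "degree (2 * f ^ Suc h) \<le> 2 * p"
      using degree_mult_le_add[of "2::'a poly" 0 "f ^ Suc h" "2 * p"] h p(3) by simp
    have 2: "degree (Tp * [:0, 1:] ^ 2) \<le> 2 * p"
      using degree_mult_le_add[of Tp p "[:0, 1:] ^ 2" 2] dTp p(3) by (simp add: degree_power_eq)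
    have 3: "degree ([:a:] * Tp) \<le> 2 * p"
      using degree_mult_le_add[of "[:a:]" 0 Tp p] dTp by simp
    have Z: "degree Z \<le> 2 * p" unfolding Z_def
      by (intro degree_add_le degree_diff_le) (use 1 2 3 df p(3) in \<open>auto simp: degree_power_eq\<close>)
    define k where "k = f ^ Suc h"
    have fk: "f * \<Phi> = k" by (simp add: \<Phi>_def k_def)
    have "R = f * \<Phi> ^ 2 + 2 * (f * \<Phi>) + f - (Tp + [:0, 1:]) * V ^ 2" unfolding R_def by Groebner_Basis.algebra
    then have "R = Tp ^ 3 + [:a:] * Tp + [:b:] + 2 * k + f - (Tp + [:0, 1:]) * (Tp - [:0, 1:]) ^ 2"
      unfolding E fk V_def .
    then have RZ: "R = Tp ^ 2 * [:0, 1:] + Z" unfolding Z_def k_def[symmetric] by Groebner_Basis.algebra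
    have Tp0: "Tp \<noteq> 0" using dTp by auto
    then have dT: "degree (Tp ^ 2 * [:0, 1:]) = 2 * p + 1"
      by (simp add: degree_mult_eq degree_power_eq dTp)
    show dR: "degree R = 2 * p + 1" unfolding RZ using Z dT by (subst degree_add_eq_left) auto
    have "coeff Z (2 * p + 1) = 0" using Z by (intro coeff_eq_0) auto
    moreover have "coeff (Tp ^ 2 * [:0, 1:]) (2 * p + 1) = lead_coeff (Tp ^ 2 * [:0, 1:])" using dT by simp
    moreover have "\<dots> = 1" by (simp only: lead_coeff_mult lead_coeff_power dTp) simp
    ultimately show "lead_coeff R = 1" unfolding dR unfolding RZ by simp
  qed
  have F'0: "F' \<noteq> 0" and C0: "C \<noteq> 0" using dR R by auto
  have dF': "degree F' = 2 * card Np + card N0 + 1" "lead_coeff F' = 1"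
  proof -
    show "degree F' = 2 * card Np + card N0 + 1"
      using dR(1) dC(1) cards degree_mult_eq[OF C0 F'0] R by simp
    show "lead_coeff F' = 1" using dR(2) dC(2) R by (simp add: lead_coeff_mult)
  qed
  have seed1: "xcoord m F' G'" if "m ^ 2 = 1" for m
    using cop F'0 dF' dG' that unfolding xcoord_def by auto
  have seed0: "xcoord 0 Tp 1"
    using dTp p(3) unfolding xcoord_def by (auto simp: coeff_eq_0)
  have "C ^ 2 * kummer a b Tp 1 F' G' = kummer a b Tp 1 R S"
    unfolding kummer_def R S by Groebner_Basis.algebra
  then have K: "kummer a b Tp 1 F' G' = 0" using root C0 by simp
  define \<alpha> where "\<alpha> = int (card Nm) - int (card Np)"
  have dF: "int (degree F') = 1 - \<alpha> + int p"
    using dF' cards by (simp add: \<alpha>_def)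
  \<comment> \<open>A chain runs in one direction only, so there are two: \<open>up\<close> starts
    with \<open>d (-1), d 0\<close> and \<open>down\<close> with \<open>d 0, d (-1)\<close>. Since
    x-coordinates do not see signs, \<open>F'/G'\<close> may carry the parameter -1 in the first and
    1 in the second.\<close>
  have up: "(int n - 1) ^ 2 + \<alpha> * (int n - 1) + int p \<ge> 0" for n
    by (rule xcoord_chain[OF d two seed0 seed1 K, of "\<lambda>n. (int n - 1) ^ 2 + \<alpha> * (int n - 1) + int p"])
      (use dF dTp in \<open>auto simp: power2_eq_square algebra_simps\<close>)
  have down: "int n ^ 2 - \<alpha> * int n + int p \<ge> 0" for n
    by (rule xcoord_chain[OF d two seed1 _ K[unfolded kummer_commute[of a b Tp]], of 1
        "\<lambda>n. int n ^ 2 - \<alpha> * int n + int p"])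
      (use seed0 dF dTp in \<open>auto simp: power2_eq_square algebra_simps\<close>)
  have "n ^ 2 + \<alpha> * n + int p \<ge> 0" for n
    using up[of "nat (n + 1)"] down[of "nat (- n)"] by (cases "n \<ge> 0") auto
  then have "\<alpha> ^ 2 \<le> 4 * int p" by (rule int_quadratic_discriminant) (use \<open>odd p\<close> in simp)
  then show ?thesis by (simp add: \<alpha>_def Nm_def Np_def h_def pf)
qed

section \<open>From the field with \<open>p\<close> elements to Legendre symbols of integers\<close>

definition cubic_trace :: "nat \<Rightarrow> int \<Rightarrow> int \<Rightarrow> int" where
  "cubic_trace p A B = - (\<Sum>x\<in>{0..<int p}. Legendre (x ^ 3 + A * x + B) (int p))"

lemma Legendre_values: "Legendre a m \<in> {-1, 0, 1}"
  by (auto simp: Legendre_def)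

lemma Legendre_cong:
  assumes "[a = b] (mod m)"
  shows "Legendre a m = Legendre b m"
proof -
  have "[a = 0] (mod m) \<longleftrightarrow> [b = 0] (mod m)" "QuadRes m a \<longleftrightarrow> QuadRes m b"
    using assms unfolding QuadRes_def by (meson cong_trans cong_sym)+
  then show ?thesis by (simp add: Legendre_def)
qed

lemma of_int_Legendre:
  assumes "CHAR('a::comm_ring_1) = p" "prime p" "2 < p"
  shows "of_int (Legendre a (int p)) = (of_int a :: 'a) ^ ((p - 1) div 2)"
proof -
  have "[Legendre a (int p) = a ^ ((p - 1) div 2)] (mod int CHAR('a))"
    using euler_criterion assms by simp
  then have "(of_int (Legendre a (int p)) :: 'a) = of_int (a ^ ((p - 1) div 2))"
    by (simp only: of_int_eq_iff_cong_CHAR)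
  then show ?thesis by simp
qed

definition hasse_at :: "nat \<Rightarrow> bool" where
  "hasse_at p \<longleftrightarrow> (\<forall>A B. \<not> int p dvd 4 * A ^ 3 + 27 * B ^ 2 \<longrightarrow> cubic_trace p A B ^ 2 \<le> 4 * int p)"

lemma sum_sign_values:
  fixes f :: "'a \<Rightarrow> int"
  assumes "finite S" "\<And>x. x \<in> S \<Longrightarrow> f x \<in> {-1, 0, 1}"
  shows "(\<Sum>x\<in>S. f x) = int (card {x\<in>S. f x = 1}) - int (card {x\<in>S. f x = -1})"
proof -
  have "(\<Sum>x\<in>S. f x) = (\<Sum>x\<in>S. (if f x = 1 then 1 else 0) - (if f x = -1 then 1 else 0))"
    by (intro sum.cong) (use assms in force)+
  also have "\<dots> = int (card {x\<in>S. f x = 1}) - int (card {x\<in>S. f x = -1})"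
    using assms(1) by (simp add: sum_subtractf sum.If_cases Int_def)
  finally show ?thesis .
qed

lemma hasse_transfer:
  assumes "CARD('a::{field_gcd,finite_field}) = p" "CHAR('a) = p" "p \<ge> 5"
  shows "hasse_at p"
  unfolding hasse_at_def
proof (intro allI impI)
  fix A B
  assume d: "\<not> int p dvd 4 * A ^ 3 + 27 * B ^ 2"
  have prime: "prime p" using CHAR_prime[where ?'a='a] assms by simp
  let ?a = "of_int A :: 'a" and ?b = "of_int B :: 'a"
  let ?f = "\<lambda>x. x ^ 3 + A * x + B" and ?h = "(p - 1) div 2"
  let ?S = "{0..<int p}"
  have inj: "inj_on (of_int :: int \<Rightarrow> 'a) ?S"
    using assms by (auto intro!: inj_onI simp: of_int_eq_iff_cong_CHAR cong_def)
  then have "card ((of_int :: int \<Rightarrow> 'a) ` ?S) = CARD('a)" using assms by (simp add: card_image)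
  then have surj: "(of_int :: int \<Rightarrow> 'a) ` ?S = UNIV"
    by (intro card_subset_eq finite) auto
  have L: "Legendre (?f x) p = s \<longleftrightarrow> (of_int x ^ 3 + ?a * of_int x + ?b) ^ ?h = of_int s"
    if "s \<in> {-1, 0, 1}" for s x
  proof -
    have "(of_int x ^ 3 + ?a * of_int x + ?b) ^ ?h = of_int (Legendre (?f x) p)"
      using of_int_Legendre[OF assms(2) prime, of "?f x"] assms(3)
      by (simp only: of_int_add of_int_mult of_int_power)
    moreover have "(of_int (Legendre (?f x) p) :: 'a) = of_int s \<longleftrightarrow> Legendre (?f x) p = s"
    proof
      assume "(of_int (Legendre (?f x) p) :: 'a) = of_int s"
      then have "int p dvd Legendre (?f x) p - s"
        by (simp only: of_int_eq_iff_cong_CHAR cong_iff_dvd_diff assms(2))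
      moreover have "\<bar>Legendre (?f x) p - s\<bar> < int p"
        using Legendre_values[of "?f x" p] that assms(3) by auto
      ultimately show "Legendre (?f x) p = s"
        using dvd_imp_le_int[of "Legendre (?f x) p - s" "int p"] by linarith
    qed auto
    ultimately show ?thesis by metis
  qed
  have card: "card {x \<in> ?S. Legendre (?f x) p = s} = card {c. (c ^ 3 + ?a * c + ?b) ^ ?h = of_int s}"
    if "s \<in> {-1, 0, 1}" for s
  proof -
    have "(of_int :: int \<Rightarrow> 'a) ` {x \<in> ?S. Legendre (?f x) p = s}
        = {c \<in> of_int ` ?S. (c ^ 3 + ?a * c + ?b) ^ ?h = of_int s}"
      using L[OF that] by blast
    moreover have "card ((of_int :: int \<Rightarrow> 'a) ` {x \<in> ?S. Legendre (?f x) p = s})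
        = card {x \<in> ?S. Legendre (?f x) p = s}"
      by (rule card_image, rule inj_on_subset[OF inj]) blast
    ultimately show ?thesis using surj by simp
  qed
  have "(of_int (4 * A ^ 3 + 27 * B ^ 2) :: 'a) \<noteq> of_int 0"
    using d unfolding of_int_eq_iff_cong_CHAR by (simp add: cong_0_iff assms(2))
  then have "4 * ?a ^ 3 + 27 * ?b ^ 2 \<noteq> 0" by simp
  from hasse_bound_field[OF this assms]
  have "(int (card {x \<in> ?S. Legendre (?f x) p = -1})
      - int (card {x \<in> ?S. Legendre (?f x) p = 1})) ^ 2 \<le> 4 * int p"
    using card[of 1] card[of "-1"] by simp
  moreover have "cubic_trace p A B = int (card {x \<in> ?S. Legendre (?f x) p = -1})
      - int (card {x \<in> ?S. Legendre (?f x) p = 1})"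
    unfolding cubic_trace_def by (subst sum_sign_values) (use Legendre_values in auto)
  ultimately show "cubic_trace p A B ^ 2 \<le> 4 * int p" by simp
qed

text \<open>A type cannot depend on a variable prime.  Hence the field is built for one constant prime,
  chosen to be a counterexample to Hasse's bound if there is any.\<close>

definition critical_prime :: nat where
  "critical_prime = (SOME p. prime p \<and> p \<ge> 5 \<and> ((\<exists>q. prime q \<and> q \<ge> 5 \<and> \<not> hasse_at q) \<longrightarrow> \<not> hasse_at p))"

lemma critical_prime:
  "prime critical_prime" "critical_prime \<ge> 5"
  "hasse_at critical_prime \<Longrightarrow> prime q \<Longrightarrow> q \<ge> 5 \<Longrightarrow> hasse_at q"
proof -
  let ?P = "\<lambda>p::nat. prime p \<and> p \<ge> 5 \<and> ((\<exists>q. prime q \<and> q \<ge> 5 \<and> \<not> hasse_at q) \<longrightarrow> \<not> hasse_at p)"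
  have five: "prime (5::nat)" by simp
  have "\<exists>p. ?P p"
  proof (cases "\<exists>q. prime q \<and> q \<ge> 5 \<and> \<not> hasse_at q")
    case False
    then show ?thesis using five by (intro exI[of _ 5]) auto
  qed blast
  then have *: "?P critical_prime" unfolding critical_prime_def by (rule someI_ex)
  show "prime critical_prime" "critical_prime \<ge> 5" using * by auto
  show "hasse_at q" if "hasse_at critical_prime" "prime q" "q \<ge> 5" using * that by blast
qed

typedef critical_index = "{..<critical_prime}"
  using critical_prime(2) by (intro exI[of _ 0]) auto

lemma CARD_critical_index: "CARD(critical_index) = critical_prime"
  using type_definition.card[OF type_definition_critical_index] by simp

instance critical_index :: prime_card
  by standard (simp add: CARD_critical_index critical_prime)

lemma CHAR_mod_ring: "CHAR('a::prime_card mod_ring) = CARD('a)"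
proof -
  have "CHAR('a mod_ring) dvd CARD('a)"
    using of_nat_card_eq_0[where ?'a='a] by (simp add: of_nat_eq_0_iff_char_dvd)
  moreover have "CHAR('a mod_ring) \<noteq> 1"
    using of_nat_CHAR[where ?'a="'a mod_ring"] by (metis of_nat_1 zero_neq_one)
  ultimately show ?thesis using prime_card[where ?'a='a] unfolding prime_nat_iff by blast
qed

theorem hasse_bound:
  assumes "prime p" "p \<ge> 5" "\<not> int p dvd 4 * A ^ 3 + 27 * B ^ 2"
  shows "cubic_trace p A B ^ 2 \<le> 4 * int p"
proof -
  have "hasse_at critical_prime"
    by (rule hasse_transfer[where ?'a="critical_index mod_ring"])
      (simp_all only: CARD_critical_index CHAR_mod_ring CARD_mod_ring critical_prime(2))
  then show ?thesis using critical_prime(3) assms by (auto simp: hasse_at_def)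
qed

section \<open>Character sums modulo a prime\<close>

definition periodic :: "int \<Rightarrow> (int \<Rightarrow> 'a) \<Rightarrow> bool" where
  "periodic m F \<longleftrightarrow> (\<forall>x y. [x = y] (mod m) \<longrightarrow> F x = F y)"

lemma periodicD: "periodic m F \<Longrightarrow> [x = y] (mod m) \<Longrightarrow> F x = F y"
  by (auto simp: periodic_def)

lemma periodic_mod: "periodic m F \<Longrightarrow> F (x mod m) = F x"
  by (auto simp: periodic_def)

lemma sum_periodic_affine:
  fixes F :: "int \<Rightarrow> 'a::comm_monoid_add"
  assumes "periodic m F" "m > 0" "coprime u m"
  shows "(\<Sum>x\<in>{0..<m}. F (u * x + v)) = (\<Sum>x\<in>{0..<m}. F x)"
proof -
  let ?g = "\<lambda>x. (u * x + v) mod m"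
  have inj: "inj_on ?g {0..<m}"
  proof (rule inj_onI)
    fix x y assume xy: "x \<in> {0..<m}" "y \<in> {0..<m}" "?g x = ?g y"
    then have "[u * x + v = u * y + v] (mod m)" by (simp add: cong_def)
    then have "[x = y] (mod m)"
      using assms(3) by (simp add: cong_add_rcancel cong_mult_lcancel)
    then show "x = y" using xy by (simp add: cong_def)
  qed
  moreover have "?g ` {0..<m} \<subseteq> {0..<m}" using assms(2) by auto
  ultimately have "bij_betw ?g {0..<m} {0..<m}"
    by (simp add: bij_betw_def endo_inj_surj)
  then have "(\<Sum>x\<in>{0..<m}. F x) = (\<Sum>x\<in>{0..<m}. F (?g x))"
    by (rule sum.reindex_bij_betw[symmetric])
  also have "\<dots> = (\<Sum>x\<in>{0..<m}. F (u * x + v))"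
    by (simp add: periodic_mod[OF assms(1)])
  finally show ?thesis ..
qed

lemma sum_periodic_shift:
  fixes F :: "int \<Rightarrow> 'a::comm_monoid_add"
  assumes "periodic m F" "m > 0"
  shows "(\<Sum>x\<in>{0..<m}. F (x + v)) = (\<Sum>x\<in>{0..<m}. F x)"
  using sum_periodic_affine[OF assms, of 1 v] by simp

lemma sum_periodic_scale:
  fixes F :: "int \<Rightarrow> 'a::comm_monoid_add"
  assumes "periodic m F" "m > 0" "coprime u m"
  shows "(\<Sum>x\<in>{0..<m}. F (u * x)) = (\<Sum>x\<in>{0..<m}. F x)"
  using sum_periodic_affine[OF assms, of 0] by simp

lemma dvd_small_int: "0 \<le> x \<Longrightarrow> x < m \<Longrightarrow> m dvd x \<longleftrightarrow> x = (0::int)"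
  using zdvd_not_zless[of x m] by fastforce

locale odd_prime =
  fixes p :: nat
  assumes prime: "prime p" and gt2: "p > 2"
begin

abbreviation leg :: "int \<Rightarrow> int" where "leg a \<equiv> Legendre a (int p)"

lemma prime_int: "prime (int p)" using prime by simp

lemma periodic_leg: "periodic (int p) leg"
  unfolding periodic_def using Legendre_cong by blast

lemma leg_eq_iff_cong: "s \<in> {-1, 0, 1} \<Longrightarrow> t \<in> {-1, 0, 1} \<Longrightarrow> [s = t] (mod int p) \<longleftrightarrow> s = t"
proof
  assume *: "s \<in> {-1, 0, 1}" "t \<in> {-1, 0, 1}" "[s = t] (mod int p)"
  then have "int p dvd s - t" by (simp add: cong_iff_dvd_diff)
  moreover have "\<bar>s - t\<bar> < int p" using * gt2 by auto
  ultimately show "s = t" using dvd_imp_le_int[of "s - t" "int p"] by linarith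
qed auto

text \<open>Euler's criterion gives the congruence, and \<open>p > 2\<close> separates -1, 0 and 1
  modulo \<open>p\<close>.\<close>

lemma leg_mult: "leg (a * b) = leg a * leg b"
proof -
  let ?h = "(p - 1) div 2"
  have "[leg (a * b) = (a * b) ^ ?h] (mod int p)" using euler_criterion[OF prime gt2] .
  also have "(a * b) ^ ?h = a ^ ?h * b ^ ?h" by (rule power_mult_distrib)
  also have "[a ^ ?h * b ^ ?h = leg a * leg b] (mod int p)"
    by (intro cong_mult cong_sym[OF euler_criterion[OF prime gt2]])
  finally have "[leg (a * b) = leg a * leg b] (mod int p)" .
  then show ?thesis
    using Legendre_values[of a "int p"] Legendre_values[of b "int p"] Legendre_values[of "a * b" "int p"]
    by (subst (asm) leg_eq_iff_cong) auto
qed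

lemma leg_eq_0_iff: "leg a = 0 \<longleftrightarrow> int p dvd a"
  by (simp add: Legendre_def cong_0_iff)

lemma leg_power2: "leg (a ^ 2) = (if int p dvd a then 0 else 1)"
  using leg_eq_0_iff[of a] Legendre_values[of a "int p"] by (auto simp: power2_eq_square leg_mult)

lemma coprime_iff: "coprime u (int p) \<longleftrightarrow> \<not> int p dvd u"
  using prime_int by (metis coprime_commute not_prime_unit coprime_absorb_left prime_imp_coprime)

lemma card_square_roots: "int (card {y\<in>{0..<int p}. [y ^ 2 = a] (mod int p)}) = 1 + leg a"
proof -
  let ?R = "{y\<in>{0..<int p}. [y ^ 2 = a] (mod int p)}"
  have root: "[z ^ 2 = y ^ 2] (mod int p) \<longleftrightarrow> [z = y] (mod int p) \<or> [z = - y] (mod int p)" for y z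
  proof -
    have "z ^ 2 - y ^ 2 = (z - y) * (z - - y)" by (simp add: power2_eq_square algebra_simps)
    then show ?thesis unfolding cong_iff_dvd_diff using prime_dvd_mult_iff[OF prime_int] by simp
  qed
  show ?thesis
  proof (cases "int p dvd a")
    case True
    then have "?R = {0}"
      using gt2 prime_dvd_power_iff[OF prime_int]
      by (auto simp: cong_def dvd_eq_mod_eq_0[symmetric] dvd_small_int)
    then show ?thesis using True leg_eq_0_iff[of a] by simp
  next
    case False
    show ?thesis
    proof (cases "QuadRes (int p) a")
      case True
      then obtain z where z: "[z ^ 2 = a] (mod int p)" by (auto simp: QuadRes_def)
      then have pz: "\<not> int p dvd z"
        using False cong_dvd_iff[OF z] by (auto simp: power2_eq_square)
      have "?R = {z mod int p, (- z) mod int p}"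
      proof (rule Set.set_eqI)
        fix y
        have "[y ^ 2 = a] (mod int p) \<longleftrightarrow> [y ^ 2 = z ^ 2] (mod int p)"
          using z by (meson cong_trans cong_sym)
        then show "y \<in> ?R \<longleftrightarrow> y \<in> {z mod int p, (- z) mod int p}"
          using root[of y z] gt2 by (auto simp: cong_def)
      qed
      moreover have "z mod int p \<noteq> (- z) mod int p"
      proof
        assume "z mod int p = (- z) mod int p"
        then have "int p dvd 2 * z" by (simp add: mod_eq_dvd_iff)
        then have "int p dvd 2" using pz prime_dvd_mult_iff[OF prime_int] by blast
        then show False using gt2 zdvd_imp_le by fastforce
      qed
      moreover have "leg a = 1" using True False by (simp add: Legendre_def cong_0_iff)
      ultimately show ?thesis by simp
    next
      case nonres: False
      then have "?R = {}" by (auto simp: QuadRes_def)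
      moreover have "leg a = - 1" using nonres False by (simp add: Legendre_def cong_0_iff)
      ultimately show ?thesis by (simp only:) simp
    qed
  qed
qed

text \<open>Counts the pairs \<open>(a, y)\<close> with \<open>y^2 = a\<close> twice: every
  \<open>y\<close> has one \<open>a\<close>, and every \<open>a\<close> has \<open>1 + leg a\<close>
  square roots.\<close>

lemma sum_leg: "(\<Sum>x\<in>{0..<int p}. leg x) = 0"
proof -
  let ?S = "{0..<int p}"
  have "(\<Sum>a\<in>?S. int (card {y\<in>?S. [y ^ 2 = a] (mod int p)})) = (\<Sum>a\<in>?S. \<Sum>y\<in>?S. if [y ^ 2 = a] (mod int p) then 1 else 0)"
    by (simp add: sum.If_cases Int_def)
  also have "\<dots> = (\<Sum>y\<in>?S. \<Sum>a\<in>?S. if [y ^ 2 = a] (mod int p) then 1 else 0)" by (rule sum.swap)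
  also have "\<dots> = (\<Sum>y\<in>?S. 1)"
  proof (intro sum.cong refl)
    fix y
    have "(\<Sum>a\<in>?S. if [y ^ 2 = a] (mod int p) then 1 else 0) = (\<Sum>a\<in>?S. if a = y ^ 2 mod int p then 1 else (0::int))"
      by (intro sum.cong) (auto simp: cong_def)
    then show "(\<Sum>a\<in>?S. if [y ^ 2 = a] (mod int p) then 1 else 0) = (1::int)"
      using gt2 by simp
  qed
  finally have "(\<Sum>a\<in>?S. 1 + leg a) = (\<Sum>y\<in>?S. 1)" unfolding card_square_roots .
  then show ?thesis by (simp add: sum.distrib)
qed

lemma obtain_nonresidue:
  obtains d where "leg d = - 1"
proof (rule ccontr)
  assume *: "\<not> thesis"
  have "leg x \<ge> 0" for x using Legendre_values[of x "int p"] * that by force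
  moreover have "leg 1 = 1" using leg_power2[of 1] gt2 by auto
  moreover have "(1::int) \<in> {0..<int p}" using gt2 by simp
  ultimately have "(\<Sum>x\<in>{0..<int p}. leg x) > 0"
    by (intro sum_pos2[of _ 1]) auto
  then show False using sum_leg by simp
qed

lemma sum_leg_affine:
  "\<not> int p dvd u \<Longrightarrow> (\<Sum>x\<in>{0..<int p}. leg (u * x + v)) = 0"
  using sum_periodic_affine[OF periodic_leg, of u v] sum_leg gt2 by (simp add: coprime_iff)

abbreviation tr :: "int \<Rightarrow> int \<Rightarrow> int" where "tr \<equiv> cubic_trace p"

lemma tr_cong:
  assumes "[A = A'] (mod int p)" "[B = B'] (mod int p)"
  shows "tr A B = tr A' B'"
proof -
  have "leg (x ^ 3 + A * x + B) = leg (x ^ 3 + A' * x + B')" for x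
    by (intro Legendre_cong cong_add cong_mult assms cong_refl)
  then show ?thesis by (simp add: cubic_trace_def)
qed

text \<open>Substitution of \<open>l * x\<close> for \<open>x\<close>. With \<open>l\<close> a
  nonresidue this is the sign change under twisting; with \<open>l\<close> a square it makes the
  trace independent of the model.\<close>

lemma tr_scale:
  assumes "\<not> int p dvd l"
  shows "tr (l ^ 2 * A) (l ^ 3 * B) = leg l * tr A B"
proof -
  let ?S = "{0..<int p}"
  have per: "periodic (int p) (\<lambda>x. leg (x ^ 3 + l ^ 2 * A * x + l ^ 3 * B))"
    unfolding periodic_def by (intro allI impI Legendre_cong cong_add cong_mult cong_pow cong_refl) auto
  have "(\<Sum>x\<in>?S. leg (x ^ 3 + l ^ 2 * A * x + l ^ 3 * B))
      = (\<Sum>x\<in>?S. leg ((l * x) ^ 3 + l ^ 2 * A * (l * x) + l ^ 3 * B))"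
    using sum_periodic_scale[OF per, of l] assms gt2 by (simp add: coprime_iff)
  also have "\<dots> = (\<Sum>x\<in>?S. leg l * leg (x ^ 3 + A * x + B))"
  proof (intro sum.cong refl)
    fix x
    have "(l * x) ^ 3 + l ^ 2 * A * (l * x) + l ^ 3 * B = l ^ 2 * (l * (x ^ 3 + A * x + B))"
      by (simp add: power2_eq_square power3_eq_cube algebra_simps)
    then show "leg ((l * x) ^ 3 + l ^ 2 * A * (l * x) + l ^ 3 * B) = leg l * leg (x ^ 3 + A * x + B)"
      using assms by (simp only: leg_mult leg_power2 if_False mult_1)
  qed
  finally show ?thesis by (simp add: cubic_trace_def sum_distrib_left)
qed

lemma sum_tr_odd_power:
  assumes "odd r"
  shows "(\<Sum>A\<in>{0..<int p}. \<Sum>B\<in>{0..<int p}. tr A B ^ r) = 0"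
proof -
  let ?S = "{0..<int p}"
  obtain d where d: "leg d = - 1" by (rule obtain_nonresidue)
  then have pd: "\<not> int p dvd d" using leg_eq_0_iff[of d] by simp
  then have cop: "coprime (d ^ 2) (int p)" "coprime (d ^ 3) (int p)" by (simp_all only: coprime_iff prime_dvd_power_iff[OF prime_int] zero_less_numeral not_False_eq_True)
  have per: "periodic (int p) (\<lambda>B. tr A B ^ r)" "periodic (int p) (\<lambda>A. \<Sum>B\<in>?S. tr A B ^ r)" for A
    unfolding periodic_def using tr_cong[OF cong_refl] tr_cong[OF _ cong_refl]
    by (auto intro!: sum.cong)
  have "(\<Sum>A\<in>?S. \<Sum>B\<in>?S. tr A B ^ r) = (\<Sum>A\<in>?S. \<Sum>B\<in>?S. tr (d ^ 2 * A) B ^ r)"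
    using sum_periodic_scale[OF per(2) _ cop(1)] gt2 by simp
  also have "\<dots> = (\<Sum>A\<in>?S. \<Sum>B\<in>?S. tr (d ^ 2 * A) (d ^ 3 * B) ^ r)"
    using sum_periodic_scale[OF per(1) _ cop(2)] gt2 by simp
  also have "\<dots> = (\<Sum>A\<in>?S. \<Sum>B\<in>?S. - (tr A B ^ r))"
    using assms by (simp add: tr_scale[OF pd] d)
  finally show ?thesis by (simp add: sum_negf)
qed

text \<open>Expanding the square gives a sum over pairs \<open>(x, y)\<close>. If
  \<open>x \<noteq> y\<close>, then after a shift of \<open>B\<close> the variable \<open>A\<close>
  occurs in one symbol only, linearly with slope \<open>y - x\<close>, and summing over it gives 0.
  Each of the \<open>p\<close> diagonal pairs gives \<open>p * (p - 1)\<close>.\<close>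

lemma sum_tr_square:
  "(\<Sum>A\<in>{0..<int p}. \<Sum>B\<in>{0..<int p}. tr A B ^ 2) = int p ^ 2 * (int p - 1)"
proof -
  let ?S = "{0..<int p}"
  let ?f = "\<lambda>A B x. leg (x ^ 3 + A * x + B)"
  have inner: "(\<Sum>A\<in>?S. \<Sum>B\<in>?S. ?f A B x * ?f A B y) = (if x = y then int p * (int p - 1) else 0)"
    if xy: "x \<in> ?S" "y \<in> ?S" for x y
  proof -
    define c where "c = y ^ 3 - x ^ 3"
    have per: "periodic (int p) (\<lambda>B. leg B * leg (B + (c + A * (y - x))))" for A
      unfolding periodic_def by (auto intro!: arg_cong2[of _ _ _ _ "(*)"] Legendre_cong cong_add)
    have "(\<Sum>A\<in>?S. \<Sum>B\<in>?S. ?f A B x * ?f A B y)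
        = (\<Sum>A\<in>?S. \<Sum>B\<in>?S. leg (B + (x ^ 3 + A * x)) * leg (B + (x ^ 3 + A * x) + (c + A * (y - x))))"
      by (intro sum.cong refl arg_cong2[of _ _ _ _ "(*)"] arg_cong2[of _ _ _ _ Legendre])
        (simp_all add: c_def algebra_simps)
    also have "\<dots> = (\<Sum>A\<in>?S. \<Sum>B\<in>?S. leg B * leg (B + (c + A * (y - x))))"
      using sum_periodic_shift[OF per] gt2 by simp
    also have "\<dots> = (\<Sum>B\<in>?S. leg B * (\<Sum>A\<in>?S. leg ((y - x) * A + (B + c))))"
      by (subst sum.swap) (simp add: sum_distrib_left algebra_simps)
    also have "\<dots> = (if x = y then int p * (int p - 1) else 0)"
    proof (cases "x = y")
      case True
      have "(\<Sum>B\<in>?S. leg B * (int p * leg B)) = int p * (\<Sum>B\<in>?S. leg (B ^ 2))"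
        by (simp add: sum_distrib_left leg_mult power2_eq_square algebra_simps)
      also have "(\<Sum>B\<in>?S. leg (B ^ 2)) = (\<Sum>B\<in>?S - {0}. 1)"
      proof -
        have "(\<Sum>B\<in>?S. leg (B ^ 2)) = (\<Sum>B\<in>?S - {0}. leg (B ^ 2))"
          by (intro sum.mono_neutral_right) (auto simp: leg_power2)
        also have "\<dots> = (\<Sum>B\<in>?S - {0}. 1)"
          by (intro sum.cong refl) (auto simp: leg_power2 dvd_small_int)
        finally show ?thesis .
      qed
      also have "\<dots> = int p - 1" using gt2 by (simp add: card_Diff_singleton_if of_nat_diff)
      finally show ?thesis using True by (simp add: c_def)
    next
      case False
      then have "\<not> int p dvd y - x"
        using xy dvd_imp_le_int[of "y - x" "int p"] by auto
      then show ?thesis using False by (simp add: sum_leg_affine)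
    qed
    finally show ?thesis .
  qed
  have "(\<Sum>A\<in>?S. \<Sum>B\<in>?S. tr A B ^ 2) = (\<Sum>A\<in>?S. \<Sum>B\<in>?S. \<Sum>x\<in>?S. \<Sum>y\<in>?S. ?f A B x * ?f A B y)"
    by (simp add: cubic_trace_def power2_eq_square sum_product)
  also have "\<dots> = (\<Sum>A\<in>?S. \<Sum>x\<in>?S. \<Sum>B\<in>?S. \<Sum>y\<in>?S. ?f A B x * ?f A B y)"
    by (intro sum.cong refl sum.swap)
  also have "\<dots> = (\<Sum>x\<in>?S. \<Sum>A\<in>?S. \<Sum>y\<in>?S. \<Sum>B\<in>?S. ?f A B x * ?f A B y)"
    by (subst sum.swap) (intro sum.cong refl sum.swap)
  also have "\<dots> = (\<Sum>x\<in>?S. \<Sum>y\<in>?S. \<Sum>A\<in>?S. \<Sum>B\<in>?S. ?f A B x * ?f A B y)"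
    by (intro sum.cong refl sum.swap)
  also have "\<dots> = (\<Sum>x\<in>?S. \<Sum>y\<in>?S. if x = y then int p * (int p - 1) else 0)"
    by (intro sum.cong refl inner)
  also have "\<dots> = int p ^ 2 * (int p - 1)"
    by (simp add: power2_eq_square)
  finally show ?thesis .
qed

end

section \<open>Reduction and the trace of Frobenius\<close>

locale large_prime = odd_prime +
  assumes ge5: "p \<ge> 5"
begin

lemma not_dvd_2: "\<not> int p dvd 2" and not_dvd_3: "\<not> int p dvd 3"
  using ge5 zdvd_imp_le[of "int p" 2] zdvd_imp_le[of "int p" 3] by auto

lemmas p_dvd_mult = prime_dvd_mult_iff[OF prime_int]
lemmas p_dvd_power = prime_dvd_power_iff[OF prime_int]

lemma not_dvd_smooth: "\<not> int p dvd 2 ^ i * 3 ^ j"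
  using not_dvd_2 not_dvd_3 prime_dvd_power[OF prime_int] by (auto simp: p_dvd_mult)

lemma smooth_dvd_cancel:
  assumes "int p dvd s * x" "s = 2 ^ i * 3 ^ j \<or> s = - (2 ^ i * 3 ^ j)"
  shows "int p dvd x"
  using assms not_dvd_smooth[of i j] by (auto simp only: p_dvd_mult minus_mult_left[symmetric] dvd_minus_iff)

lemma smooth_dvd_iff:
  "s = 2 ^ i * 3 ^ j \<or> s = - (2 ^ i * 3 ^ j) \<Longrightarrow> int p dvd s * x \<longleftrightarrow> int p dvd x"
  using smooth_dvd_cancel by (blast intro: dvd_mult)

lemma obtain_inverse:
  assumes "\<not> int p dvd u"
  obtains v where "[u * v = 1] (mod int p)"
  using assms cong_solve_coprime_int[of u "int p"] by (auto simp: coprime_iff)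

lemma obtain_linear_root:
  assumes "\<not> int p dvd u"
  obtains x where "x \<in> {0..<int p}" "int p dvd u * x + c"
proof -
  obtain v where v: "[u * v = 1] (mod int p)" by (rule obtain_inverse[OF assms])
  define x where "x = (- c * v) mod int p"
  have "[u * x + c = u * (- c * v) + c] (mod int p)"
    unfolding x_def by (intro cong_add cong_mult cong_refl) (simp add: cong_def)
  also have "u * (- c * v) + c = - c * (u * v) + c" by Groebner_Basis.algebra
  also have "[\<dots> = - c * 1 + c] (mod int p)" by (intro cong_add cong_mult v cong_refl)
  finally have "int p dvd u * x + c" by (simp add: cong_0_iff)
  then show thesis using that[of x] gt2 by (simp add: x_def)
qed

text \<open>The repeated root of the cubic is \<open>- 3 B / (2 A)\<close> unless \<open>A\<close>
  vanishes modulo \<open>p\<close>, when it is 0; the two divisibilities say that the cubic is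
  \<open>(x - X)^2 (x + 2 X)\<close>.\<close>

lemma double_root:
  assumes "int p dvd 4 * A ^ 3 + 27 * B ^ 2"
  obtains X where "int p dvd A + 3 * X ^ 2" "int p dvd B - 2 * X ^ 3"
proof (cases "int p dvd A")
  case True
  then have "int p dvd 4 * A ^ 3" by (simp add: power3_eq_cube)
  then have "int p dvd 27 * B ^ 2" using assms by (metis dvd_add_right_iff)
  then have "int p dvd B ^ 2" by (rule smooth_dvd_cancel[where i=0 and j=3]) simp
  then show thesis using that[of 0] True by (simp add: p_dvd_power)
next
  case False
  obtain X where X: "int p dvd 2 * A * X + 3 * B"
    by (rule obtain_linear_root[of "2 * A" "3 * B"]) (use False not_dvd_2 in \<open>auto simp: p_dvd_mult\<close>)
  have "(4 * A ^ 2) * (A + 3 * X ^ 2) = (4 * A ^ 3 + 27 * B ^ 2) + (2 * A * X + 3 * B) * (6 * A * X - 9 * B)"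
    by Groebner_Basis.algebra
  then have "int p dvd (4 * A ^ 2) * (A + 3 * X ^ 2)" using assms X by simp
  moreover have "\<not> int p dvd 4 * A ^ 2"
    using False smooth_dvd_cancel[of 4 "A ^ 2" 2 0] by (auto simp: p_dvd_power)
  ultimately have 1: "int p dvd A + 3 * X ^ 2" by (simp add: p_dvd_mult)
  have "3 * (B - 2 * X ^ 3) = (2 * A * X + 3 * B) - 2 * X * (A + 3 * X ^ 2)" by Groebner_Basis.algebra
  then have "int p dvd 3 * (B - 2 * X ^ 3)" using 1 X by (simp only: dvd_diff dvd_mult)
  then have "int p dvd B - 2 * X ^ 3" by (rule smooth_dvd_cancel[where i=0 and j=1]) simp
  then show thesis using that 1 by blast
qed

text \<open>In \<open>(x - X)^2 (x + 2 X)\<close> the square has symbol 1 except at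
  \<open>x = X\<close>. So the character sum is a complete sum of a linear function, which is 0,
  without its term \<open>leg (3 * X)\<close>.\<close>

lemma tr_double_root:
  assumes "int p dvd A + 3 * X ^ 2" "int p dvd B - 2 * X ^ 3"
  shows "tr A B = leg (3 * X)"
proof -
  let ?S = "{0..<int p}"
  have "tr A B = tr (- 3 * X ^ 2) (2 * X ^ 3)"
    by (rule tr_cong) (use assms in \<open>simp_all add: cong_iff_dvd_diff\<close>)
  also have "\<dots> = - (\<Sum>x\<in>?S. leg (x + 2 * X) - (if x = X mod int p then leg (3 * X) else 0))"
    unfolding cubic_trace_def
  proof (intro arg_cong[of _ _ uminus] sum.cong refl)
    fix x assume x: "x \<in> ?S"
    have "x ^ 3 + - 3 * X ^ 2 * x + 2 * X ^ 3 = (x - X) ^ 2 * (x + 2 * X)" by Groebner_Basis.algebra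
    then have "leg (x ^ 3 + - 3 * X ^ 2 * x + 2 * X ^ 3) = leg ((x - X) ^ 2) * leg (x + 2 * X)"
      by (simp only: leg_mult)
    moreover have "int p dvd x - X \<longleftrightarrow> x = X mod int p"
      using x by (auto simp: cong_iff_dvd_diff[symmetric] cong_def)
    moreover have "leg (x + 2 * X) = leg (3 * X)" if "int p dvd x - X"
      by (rule Legendre_cong) (use that in \<open>simp add: cong_iff_dvd_diff\<close>)
    ultimately show "leg (x ^ 3 + - 3 * X ^ 2 * x + 2 * X ^ 3)
        = leg (x + 2 * X) - (if x = X mod int p then leg (3 * X) else 0)"
      by (simp add: leg_power2)
  qed
  also have "\<dots> = leg (3 * X)"
    using sum_leg_affine[of 1 "2 * X"] gt2 ge5 by (simp add: sum_subtractf zdvd1_eq)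
  finally show ?thesis .
qed

lemma tr_bad_bound:
  assumes "int p dvd 4 * A ^ 3 + 27 * B ^ 2"
  shows "\<bar>tr A B\<bar> \<le> 1"
proof -
  obtain X where "int p dvd A + 3 * X ^ 2" "int p dvd B - 2 * X ^ 3" by (rule double_root[OF assms])
  then show ?thesis using tr_double_root[of A X B] Legendre_values[of "3 * X" "int p"] by auto
qed

lemma tr_square_le: "tr A B ^ 2 \<le> 4 * int p"
proof (cases "int p dvd 4 * A ^ 3 + 27 * B ^ 2")
  case True
  then have "tr A B ^ 2 \<le> 1" using tr_bad_bound by (simp add: abs_square_le_1)
  then show ?thesis using gt2 by linarith
qed (use hasse_bound[OF prime ge5] in blast)

end

section \<open>Invariants of models under change of coordinates\<close>

definition c6 :: "weier \<Rightarrow> int" where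
  "c6 W = - (b2 W ^ 3) + 36 * b2 W * b4 W - 216 * b6 W"

lemma disc_c4_c6: "1728 * disc W = c4 W ^ 3 - c6 W ^ 2"
  unfolding disc_def c4_def c6_def b2_def b4_def b6_def b8_def by Groebner_Basis.algebra

lemma short_model_invariants:
  "c4 (short_model E) = - 48 * fst E" "c6 (short_model E) = - 864 * snd E"
  "disc (short_model E) = - 16 * (4 * fst E ^ 3 + 27 * snd E ^ 2)"
  unfolding short_model_def disc_def c4_def c6_def b2_def b4_def b6_def b8_def by auto

lemma weier_iso_short_refl: "weier_iso (short_model E) (short_model E)"
  unfolding weier_iso_def
  by (rule exI[of _ 1], rule exI[of _ 0], rule exI[of _ 0], rule exI[of _ 0]) (simp add: short_model_def)

text \<open>The invariants have weights 4, 6 and 12 in \<open>u\<close>. Writing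
  \<open>u = m / n\<close> in lowest terms clears denominators, so divisibility by a prime can be
  read off from \<open>m\<close> and \<open>n\<close>.\<close>

lemma weier_iso_short_invariants:
  assumes "weier_iso (short_model E) W"
  obtains m n :: int where "coprime m n" "m \<noteq> 0" "n \<noteq> 0"
    "m ^ 4 * c4 W = n ^ 4 * (- 48 * fst E)" "m ^ 6 * c6 W = n ^ 6 * (- 864 * snd E)"
    "m ^ 12 * disc W = n ^ 12 * disc (short_model E)"
proof -
  define A B where "A = (of_int (fst E) :: rat)" and "B = (of_int (snd E) :: rat)"
  define x1 x2 x3 x4 x6 where "x1 = (of_int (a1 W) :: rat)" and "x2 = (of_int (a2 W) :: rat)"
    and "x3 = (of_int (a3 W) :: rat)" and "x4 = (of_int (a4 W) :: rat)" and "x6 = (of_int (a6 W) :: rat)"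
  obtain u r s t :: rat where u: "u \<noteq> 0"
    and e: "u * x1 = 2 * s" "u ^ 2 * x2 = 3 * r - s ^ 2" "u ^ 3 * x3 = 2 * t"
      "u ^ 4 * x4 = A + 3 * r ^ 2 - 2 * s * t" "u ^ 6 * x6 = B + r * A + r ^ 3 - t ^ 2"
    using assms unfolding weier_iso_def short_model_def A_def B_def x1_def x2_def x3_def x4_def x6_def
    by auto
  define y2 y4 y6 where "y2 = x1 ^ 2 + 4 * x2" and "y4 = 2 * x4 + x1 * x3" and "y6 = x3 ^ 2 + 4 * x6"
  have y: "of_int (b2 W) = y2" "of_int (b4 W) = y4" "of_int (b6 W) = y6"
    by (simp_all add: b2_def b4_def b6_def y2_def y4_def y6_def x1_def x2_def x3_def x4_def x6_def)
  have b: "u ^ 2 * y2 = 12 * r" "u ^ 4 * y4 = 2 * A + 6 * r ^ 2"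
    "u ^ 6 * y6 = 4 * B + 4 * r * A + 4 * r ^ 3"
  proof -
    have "u ^ 2 * y2 = (u * x1) ^ 2 + 4 * (u ^ 2 * x2)" unfolding y2_def by Groebner_Basis.algebra
    then show "u ^ 2 * y2 = 12 * r" unfolding e by Groebner_Basis.algebra
    have "u ^ 4 * y4 = 2 * (u ^ 4 * x4) + (u * x1) * (u ^ 3 * x3)" unfolding y4_def by Groebner_Basis.algebra
    then show "u ^ 4 * y4 = 2 * A + 6 * r ^ 2" unfolding e by Groebner_Basis.algebra
    have "u ^ 6 * y6 = (u ^ 3 * x3) ^ 2 + 4 * (u ^ 6 * x6)" unfolding y6_def by Groebner_Basis.algebra
    then show "u ^ 6 * y6 = 4 * B + 4 * r * A + 4 * r ^ 3" unfolding e by Groebner_Basis.algebra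
  qed
  have c4: "u ^ 4 * of_int (c4 W) = - 48 * A"
  proof -
    have "u ^ 4 * of_int (c4 W) = (u ^ 2 * y2) ^ 2 - 24 * (u ^ 4 * y4)"
      by (simp add: c4_def y power2_eq_square algebra_simps numeral_eq_Suc)
    then show ?thesis unfolding b by Groebner_Basis.algebra
  qed
  have c6: "u ^ 6 * of_int (c6 W) = - 864 * B"
  proof -
    have "of_int (c6 W) = - (y2 ^ 3) + 36 * y2 * y4 - 216 * y6" by (simp add: c6_def y)
    then have "u ^ 6 * of_int (c6 W) = - ((u ^ 2 * y2) ^ 3) + 36 * (u ^ 2 * y2) * (u ^ 4 * y4) - 216 * (u ^ 6 * y6)"
      by Groebner_Basis.algebra
    then show ?thesis unfolding b by Groebner_Basis.algebra
  qed
  obtain m n where mn: "u = of_int m / of_int n" "n > 0" "coprime m n"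
    by (metis Fract_of_int_quotient Rat_cases)
  have m0: "m \<noteq> 0" using u mn by auto
  have n0: "(of_int n :: rat) \<noteq> 0" using mn by simp
  have un: "u * of_int n = of_int m" using mn n0 by simp
  have unk: "of_int m ^ k = u ^ k * of_int n ^ k" for k
    unfolding un[symmetric] by (rule power_mult_distrib)
  have "(of_int (m ^ 4 * c4 W) :: rat) = of_int (n ^ 4 * (- 48 * fst E))"
  proof -
    have "of_int (m ^ 4 * c4 W) = of_int n ^ 4 * (u ^ 4 * of_int (c4 W))" by (simp add: unk mult.assoc mult.left_commute)
    then show ?thesis unfolding c4 by (simp add: A_def)
  qed
  then have C4: "m ^ 4 * c4 W = n ^ 4 * (- 48 * fst E)" by (simp only: of_int_eq_iff)
  have "(of_int (m ^ 6 * c6 W) :: rat) = of_int (n ^ 6 * (- 864 * snd E))"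
  proof -
    have "of_int (m ^ 6 * c6 W) = of_int n ^ 6 * (u ^ 6 * of_int (c6 W))" by (simp add: unk)
    then show ?thesis unfolding c6 by (simp add: B_def)
  qed
  then have C6: "m ^ 6 * c6 W = n ^ 6 * (- 864 * snd E)" by (simp only: of_int_eq_iff)
  have "1728 * (m ^ 12 * disc W) = m ^ 12 * (1728 * disc W)" by simp
  also have "\<dots> = (m ^ 4 * c4 W) ^ 3 - (m ^ 6 * c6 W) ^ 2" unfolding disc_c4_c6 by Groebner_Basis.algebra
  also have "\<dots> = n ^ 12 * (1728 * disc (short_model E))"
    unfolding C4 C6 disc_c4_c6 short_model_invariants by Groebner_Basis.algebra
  finally have "m ^ 12 * disc W = n ^ 12 * disc (short_model E)" by simp
  then show thesis using that[of m n] mn m0 C4 C6 by simp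
qed

lemma minimal_at_min_model: "minimal_at E p (min_model E p)"
proof -
  obtain W where "weier_iso (short_model E) W"
    "\<forall>W'. weier_iso (short_model E) W' \<longrightarrow> multiplicity (int p) (disc W) \<le> multiplicity (int p) (disc W')"
    using ex_has_least_nat[of "weier_iso (short_model E)" _ "\<lambda>W. multiplicity (int p) (disc W)"]
      weier_iso_short_refl[of E] by blast
  then have "minimal_at E p W" by (simp add: minimal_at_def)
  then show ?thesis unfolding min_model_def by (rule someI)
qed

context large_prime
begin

text \<open>If \<open>p\<close> divided \<open>m\<close>, it would not divide \<open>n\<close>, and
  the relations for \<open>c4\<close> and \<open>c6\<close> would give \<open>p^4 dvd A\<close> and
  \<open>p^6 dvd B\<close>, against (M). Then \<open>p\<close> does not divide \<open>n\<close>
  either, since otherwise the chosen model would have a discriminant of larger valuation than the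
  short one.\<close>

lemma min_model_invariants:
  assumes nz: "4 * fst E ^ 3 + 27 * snd E ^ 2 \<noteq> 0" and min: "minimal_condition E"
  obtains m n :: int where "\<not> int p dvd m" "\<not> int p dvd n"
    "m ^ 4 * c4 (min_model E p) = n ^ 4 * (- 48 * fst E)"
    "m ^ 6 * c6 (min_model E p) = n ^ 6 * (- 864 * snd E)"
    "m ^ 12 * disc (min_model E p) = n ^ 12 * (- 16 * (4 * fst E ^ 3 + 27 * snd E ^ 2))"
proof -
  define W where "W = min_model E p"
  have W: "weier_iso (short_model E) W"
    "multiplicity (int p) (disc W) \<le> multiplicity (int p) (disc (short_model E))"
    using minimal_at_min_model[of E p] weier_iso_short_refl by (auto simp: W_def minimal_at_def)
  obtain m n where mn: "coprime m n" "m \<noteq> 0" "n \<noteq> 0"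
    and c4: "m ^ 4 * c4 W = n ^ 4 * (- 48 * fst E)" and c6: "m ^ 6 * c6 W = n ^ 6 * (- 864 * snd E)"
    and disc: "m ^ 12 * disc W = n ^ 12 * disc (short_model E)"
    by (rule weier_iso_short_invariants[OF W(1)])
  have d0: "disc (short_model E) \<noteq> 0" using nz by (simp add: short_model_invariants)
  have dW0: "disc W \<noteq> 0" using disc d0 mn by (metis mult_eq_0_iff power_eq_0_iff)
  have m: "\<not> int p dvd m"
  proof
    assume pm: "int p dvd m"
    then have pn: "\<not> int p dvd n" using mn(1) prime_int by (meson coprime_common_divisor not_prime_unit)
    have cop: "coprime (int p ^ j) x" if "\<not> int p dvd x" for j x
      using that by (simp add: coprime_commute coprime_iff)
    have s48: "\<not> int p dvd 48" "\<not> int p dvd 864"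
      using not_dvd_smooth[of 4 1] not_dvd_smooth[of 5 3] by simp_all
    have "int p ^ 4 dvd n ^ 4 * (- 48 * fst E)" using c4 pm by (metis dvd_mult2 dvd_power_same)
    then have "int p ^ 4 dvd (n ^ 4 * 48) * fst E" by (simp add: mult.assoc)
    moreover have "\<not> int p dvd n ^ 4 * 48" using pn s48 by (simp add: p_dvd_mult p_dvd_power)
    ultimately have 1: "int p ^ 4 dvd fst E" using cop coprime_dvd_mult_right_iff by blast
    have "int p ^ 6 dvd n ^ 6 * (- 864 * snd E)" using c6 pm by (metis dvd_mult2 dvd_power_same)
    then have "int p ^ 6 dvd (n ^ 6 * 864) * snd E" by (simp add: mult.assoc)
    moreover have "\<not> int p dvd n ^ 6 * 864" using pn s48 by (simp add: p_dvd_mult p_dvd_power)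
    ultimately have "int p ^ 6 dvd snd E" using cop coprime_dvd_mult_right_iff by blast
    then show False using 1 min prime_int unfolding minimal_condition_def by blast
  qed
  have "\<not> int p dvd n"
  proof -
    have pe: "prime_elem (int p)" using prime_int by simp
    have "multiplicity (int p) (m ^ 12 * disc W) = 12 * multiplicity (int p) m + multiplicity (int p) (disc W)"
      using mn dW0 by (simp add: prime_elem_multiplicity_mult_distrib[OF pe] prime_elem_multiplicity_power_distrib[OF pe])
    moreover have "multiplicity (int p) (n ^ 12 * disc (short_model E))
        = 12 * multiplicity (int p) n + multiplicity (int p) (disc (short_model E))"
      using mn d0 by (simp add: prime_elem_multiplicity_mult_distrib[OF pe] prime_elem_multiplicity_power_distrib[OF pe])
    moreover have "multiplicity (int p) m = 0" using m by (rule not_dvd_imp_multiplicity_0)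
    ultimately have "multiplicity (int p) n = 0" using W(2) disc by simp
    then show ?thesis using mn(3) multiplicity_eq_zero_iff[of n "int p"] not_prime_unit[of "int p"] prime_int by blast
  qed
  then show thesis
    by (rule that[OF m _ c4[unfolded W_def] c6[unfolded W_def] disc[unfolded W_def short_model_invariants]])
qed

section \<open>Point count and node of a general model modulo \<open>p\<close>\<close>

definition completed_cubic :: "weier \<Rightarrow> int \<Rightarrow> int" where
  "completed_cubic W x = 4 * x ^ 3 + b2 W * x ^ 2 + 2 * b4 W * x + b6 W"

lemma completed_cubic_short:
  "(36 * x + 3 * b2 W) ^ 3 + (- 27 * c4 W) * (36 * x + 3 * b2 W) + (- 54 * c6 W) = 108 ^ 2 * completed_cubic W x"
  unfolding completed_cubic_def c4_def c6_def by Groebner_Basis.algebra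

lemma affine_equation:
  "[y ^ 2 + a1 W * x * y + a3 W * y = x ^ 3 + a2 W * x ^ 2 + a4 W * x + a6 W] (mod int p)
    \<longleftrightarrow> [(2 * y + (a1 W * x + a3 W)) ^ 2 = completed_cubic W x] (mod int p)"
proof -
  let ?d = "y ^ 2 + a1 W * x * y + a3 W * y - (x ^ 3 + a2 W * x ^ 2 + a4 W * x + a6 W)"
  have "(2 * y + (a1 W * x + a3 W)) ^ 2 - completed_cubic W x = 4 * ?d"
    unfolding completed_cubic_def b2_def b4_def b6_def by Groebner_Basis.algebra
  moreover have "int p dvd 4 * ?d \<longleftrightarrow> int p dvd ?d"
    by (rule smooth_dvd_iff[where i=2 and j=0]) simp
  ultimately show ?thesis by (simp only: cong_iff_dvd_diff)
qed

text \<open>Completing the square in \<open>y\<close> and the cube in \<open>x\<close> permutes the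
  residues because 2 and 3 are invertible; above each \<open>x\<close> lie
  \<open>1 + leg (completed_cubic W x)\<close> points.\<close>

lemma card_affine_points:
  "int (card (affine_points W p)) = int p - tr (- 27 * c4 W) (- 54 * c6 W)"
proof -
  let ?S = "{0..<int p}"
  let ?Y = "\<lambda>x. {y \<in> ?S. [(2 * y + (a1 W * x + a3 W)) ^ 2 = completed_cubic W x] (mod int p)}"
  have "affine_points W p = Sigma ?S ?Y"
    unfolding affine_points_def by (auto simp: affine_equation)
  moreover have "card (Sigma ?S ?Y) = (\<Sum>x\<in>?S. card (?Y x))"
    by (rule card_SigmaI) (auto intro: finite_subset[of _ ?S])
  ultimately have "card (affine_points W p) = (\<Sum>x\<in>?S. card (?Y x))" by metis
  then have "int (card (affine_points W p)) = (\<Sum>x\<in>?S. int (card (?Y x)))"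
    by (simp only: of_nat_sum)
  also have "\<dots> = (\<Sum>x\<in>?S. 1 + leg (completed_cubic W x))"
  proof (intro sum.cong refl)
    fix x
    let ?P = "\<lambda>z. if [z ^ 2 = completed_cubic W x] (mod int p) then 1 else (0::int)"
    have per: "periodic (int p) ?P"
      unfolding periodic_def by (meson cong_pow cong_trans cong_sym)
    have "int (card (?Y x)) = (\<Sum>y\<in>?S. ?P (2 * y + (a1 W * x + a3 W)))"
      by (simp add: sum.If_cases Int_def)
    also have "\<dots> = (\<Sum>y\<in>?S. ?P y)"
      using sum_periodic_affine[OF per] not_dvd_2 gt2 by (simp add: coprime_iff)
    also have "\<dots> = int (card {y \<in> ?S. [y ^ 2 = completed_cubic W x] (mod int p)})"
      by (simp add: sum.If_cases Int_def)
    finally show "int (card (?Y x)) = 1 + leg (completed_cubic W x)" by (simp only: card_square_roots)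
  qed
  also have "\<dots> = int p + (\<Sum>x\<in>?S. leg (completed_cubic W x))" by (simp add: sum.distrib)
  also have "(\<Sum>x\<in>?S. leg (completed_cubic W x)) = - tr (- 27 * c4 W) (- 54 * c6 W)"
  proof -
    let ?g = "\<lambda>X. leg (X ^ 3 + (- 27 * c4 W) * X + (- 54 * c6 W))"
    have per: "periodic (int p) ?g"
      unfolding periodic_def by (intro allI impI Legendre_cong cong_add cong_mult cong_pow cong_refl) auto
    have "\<not> int p dvd 36" "\<not> int p dvd 108"
      using not_dvd_smooth[of 2 2] not_dvd_smooth[of 2 3] by simp_all
    then have "leg (completed_cubic W x) = ?g (36 * x + 3 * b2 W)" for x
      by (simp only: completed_cubic_short leg_mult leg_power2 if_False mult_1)
    then have "(\<Sum>x\<in>?S. leg (completed_cubic W x)) = (\<Sum>x\<in>?S. ?g (36 * x + 3 * b2 W))" by simp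
    also have "\<dots> = (\<Sum>x\<in>?S. ?g x)"
      using sum_periodic_affine[OF per, of 36] \<open>\<not> int p dvd 36\<close> gt2 by (simp only: coprime_iff) simp
    finally show ?thesis by (simp add: cubic_trace_def)
  qed
  finally show ?thesis by simp
qed

text \<open>In the coordinate \<open>Z = 36 x + 3 b2\<close> the vanishing derivative means
  \<open>Z = X\<close> or \<open>Z = - X\<close>, and the equation means \<open>Z = X\<close> or
  \<open>Z = - 2 X\<close>. As \<open>c4\<close> is not 0 modulo \<open>p\<close>, neither is
  \<open>X\<close>, and only \<open>Z = X\<close> satisfies both.\<close>

lemma singular_point_iff:
  assumes X: "int p dvd - 27 * c4 W + 3 * X ^ 2" "int p dvd - 54 * c6 W - 2 * X ^ 3"
    and c4: "\<not> int p dvd c4 W"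
  shows "singular_point W p (x, y) \<longleftrightarrow> x \<in> {0..<int p} \<and> y \<in> {0..<int p} \<and>
    int p dvd 36 * x + 3 * b2 W - X \<and> int p dvd 2 * y + (a1 W * x + a3 W)"
proof -
  define Z where "Z = 36 * x + 3 * b2 W"
  define L where "L = 2 * y + (a1 W * x + a3 W)"
  define d where "d = 3 * x ^ 2 + 2 * a2 W * x + a4 W - a1 W * y"
  have X0: "\<not> int p dvd X"
  proof
    assume "int p dvd X"
    then have "int p dvd 3 * X ^ 2" by (simp add: power2_eq_square)
    then have "int p dvd (- 27) * c4 W" using X(1) by (metis dvd_add_left_iff)
    then have "int p dvd c4 W" by (rule smooth_dvd_cancel[where i=0 and j=3]) simp
    then show False using c4 by simp
  qed
  have id1: "Z ^ 3 + (- 27 * c4 W) * Z + (- 54 * c6 W) = 108 ^ 2 * completed_cubic W x"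
    unfolding Z_def by (rule completed_cubic_short)
  have id2: "3 * Z ^ 2 + (- 27 * c4 W) = 648 * (2 * d + a1 W * L)"
    unfolding Z_def d_def L_def c4_def b2_def b4_def by Groebner_Basis.algebra
  have pt: "singular_point W p (x, y) \<longleftrightarrow> x \<in> {0..<int p} \<and> y \<in> {0..<int p} \<and>
      int p dvd L ^ 2 - completed_cubic W x \<and> int p dvd d \<and> int p dvd L"
  proof -
    have "singular_point W p (x, y) \<longleftrightarrow> x \<in> {0..<int p} \<and> y \<in> {0..<int p} \<and>
        [y ^ 2 + a1 W * x * y + a3 W * y = x ^ 3 + a2 W * x ^ 2 + a4 W * x + a6 W] (mod int p) \<and>
        [a1 W * y = 3 * x ^ 2 + 2 * a2 W * x + a4 W] (mod int p) \<and>
        [2 * y + a1 W * x + a3 W = 0] (mod int p)"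
      by (auto simp: singular_point_def affine_points_def)
    then show ?thesis
      unfolding affine_equation cong_iff_dvd_diff[of "a1 W * y"] cong_iff_dvd_diff[of "_ ^ 2"] cong_0_iff
      by (simp only: add.assoc dvd_diff_commute[of _ "a1 W * y"] L_def d_def)
  qed
  have s108: "int p dvd 108 ^ 2 * q \<longleftrightarrow> int p dvd q" for q
    by (rule smooth_dvd_iff[where i=4 and j=6]) simp
  have s648: "int p dvd 648 * q \<longleftrightarrow> int p dvd q" for q
    by (rule smooth_dvd_iff[where i=3 and j=4]) simp
  have "int p dvd L ^ 2 - completed_cubic W x \<and> int p dvd d \<longleftrightarrow> int p dvd Z - X" if L: "int p dvd L"
  proof -
    have "int p dvd d \<longleftrightarrow> int p dvd 2 * d" using smooth_dvd_cancel[of 2 d 1 0] by auto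
    also have "\<dots> \<longleftrightarrow> int p dvd 2 * d + a1 W * L" using L by (simp add: dvd_add_left_iff)
    also have "\<dots> \<longleftrightarrow> int p dvd 3 * Z ^ 2 + (- 27 * c4 W)" unfolding id2 by (simp only: s648)
    also have "3 * Z ^ 2 + (- 27 * c4 W) = 3 * ((Z - X) * (Z + X)) + (- 27 * c4 W + 3 * X ^ 2)" by Groebner_Basis.algebra
    also have "int p dvd \<dots> \<longleftrightarrow> int p dvd 3 * ((Z - X) * (Z + X))" using X(1) by (rule dvd_add_left_iff)
    also have "\<dots> \<longleftrightarrow> int p dvd Z - X \<or> int p dvd Z + X"
      using not_dvd_3 by (simp add: p_dvd_mult)
    finally have d: "int p dvd d \<longleftrightarrow> int p dvd Z - X \<or> int p dvd Z + X" .
    have "int p dvd L ^ 2" using L by (simp add: power2_eq_square)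
    then have "int p dvd L ^ 2 - completed_cubic W x \<longleftrightarrow> int p dvd completed_cubic W x"
      by (simp add: dvd_diff_right_iff)
    also have "\<dots> \<longleftrightarrow> int p dvd Z ^ 3 + (- 27 * c4 W) * Z + (- 54 * c6 W)" unfolding id1 by (simp only: s108)
    also have "Z ^ 3 + (- 27 * c4 W) * Z + (- 54 * c6 W)
        = (Z - X) ^ 2 * (Z + 2 * X) + ((- 27 * c4 W + 3 * X ^ 2) * Z + (- 54 * c6 W - 2 * X ^ 3))"
      by Groebner_Basis.algebra
    also have "int p dvd \<dots> \<longleftrightarrow> int p dvd (Z - X) ^ 2 * (Z + 2 * X)"
      using X by (intro dvd_add_left_iff) simp
    also have "\<dots> \<longleftrightarrow> int p dvd Z - X \<or> int p dvd Z + 2 * X" by (simp add: p_dvd_mult p_dvd_power)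
    finally have q: "int p dvd L ^ 2 - completed_cubic W x \<longleftrightarrow> int p dvd Z - X \<or> int p dvd Z + 2 * X" .
    have "\<not> (int p dvd Z + X \<and> int p dvd Z + 2 * X)"
    proof
      assume "int p dvd Z + X \<and> int p dvd Z + 2 * X"
      then have "int p dvd (Z + 2 * X) - (Z + X)" by (blast intro: dvd_diff)
      then show False using X0 by simp
    qed
    then show ?thesis using d q by blast
  qed
  then show ?thesis unfolding pt Z_def L_def by blast
qed

text \<open>The quadratic polynomial of the tangent slopes has discriminant
  \<open>12 x + b2\<close>, and at the node 9 times this is \<open>3 X\<close> modulo
  \<open>p\<close>.\<close>

lemma split_iff:
  assumes X: "int p dvd - 27 * c4 W + 3 * X ^ 2" "int p dvd - 54 * c6 W - 2 * X ^ 3"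
    and c4: "\<not> int p dvd c4 W"
  shows "(\<exists>x y m. singular_point W p (x, y) \<and> [m ^ 2 + a1 W * m - (3 * x + a2 W) = 0] (mod int p))
    \<longleftrightarrow> leg (3 * X) = 1"
proof -
  have X0: "\<not> int p dvd 3 * X"
  proof
    assume "int p dvd 3 * X"
    then have "int p dvd 3 * X * X" by simp
    then have "int p dvd (- 27) * c4 W" using X(1)
      by (metis dvd_add_left_iff power2_eq_square mult.assoc)
    then have "int p dvd c4 W" by (rule smooth_dvd_cancel[where i=0 and j=3]) simp
    then show False using c4 by simp
  qed
  have slope: "[m ^ 2 + a1 W * m - (3 * x + a2 W) = 0] (mod int p)
      \<longleftrightarrow> [(2 * m + a1 W) ^ 2 = 12 * x + b2 W] (mod int p)" for m x
  proof -
    have "(2 * m + a1 W) ^ 2 - (12 * x + b2 W) = 4 * (m ^ 2 + a1 W * m - (3 * x + a2 W))"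
      unfolding b2_def by Groebner_Basis.algebra
    moreover have "int p dvd 4 * q \<longleftrightarrow> int p dvd q" for q
      by (rule smooth_dvd_iff[where i=2 and j=0]) simp
    ultimately show ?thesis by (simp only: cong_0_iff cong_iff_dvd_diff[of "_ ^ 2"])
  qed
  have legX: "leg (12 * x + b2 W) = leg (3 * X)" if "int p dvd 36 * x + 3 * b2 W - X" for x
  proof -
    have "leg (3 * X) = leg (3 ^ 2 * (12 * x + b2 W))"
    proof (rule Legendre_cong)
      have "3 ^ 2 * (12 * x + b2 W) - 3 * X = 3 * (36 * x + 3 * b2 W - X)" by Groebner_Basis.algebra
      then have "int p dvd 3 ^ 2 * (12 * x + b2 W) - 3 * X" using that by (simp only: dvd_mult)
      then show "[3 * X = 3 ^ 2 * (12 * x + b2 W)] (mod int p)" by (simp only: cong_iff_dvd_diff dvd_diff_commute)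
    qed
    then show ?thesis using not_dvd_3 by (simp only: leg_mult leg_power2 if_False mult_1)
  qed
  show ?thesis
  proof
    assume "\<exists>x y m. singular_point W p (x, y) \<and> [m ^ 2 + a1 W * m - (3 * x + a2 W) = 0] (mod int p)"
    then obtain x y m where sp: "singular_point W p (x, y)"
      and m: "[(2 * m + a1 W) ^ 2 = 12 * x + b2 W] (mod int p)" unfolding slope by blast
    have "int p dvd 36 * x + 3 * b2 W - X" using sp singular_point_iff[OF assms] by blast
    then have "leg (3 * X) = leg ((2 * m + a1 W) ^ 2)" using legX Legendre_cong[OF m] by simp
    moreover have "leg (3 * X) \<noteq> 0" using X0 leg_eq_0_iff by blast
    ultimately show "leg (3 * X) = 1" by (simp add: leg_power2 split: if_splits)
  next
    assume l: "leg (3 * X) = 1"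
    have "\<not> int p dvd 36" using not_dvd_smooth[of 2 2] by simp
    then obtain x where x: "x \<in> {0..<int p}" "int p dvd 36 * x + (3 * b2 W - X)"
      by (rule obtain_linear_root)
    obtain y where y: "y \<in> {0..<int p}" "int p dvd 2 * y + (a1 W * x + a3 W)"
      by (rule obtain_linear_root[OF not_dvd_2])
    have x': "int p dvd 36 * x + 3 * b2 W - X" using x(2) by (simp add: algebra_simps)
    have sp: "singular_point W p (x, y)" using x(1) x' y singular_point_iff[OF assms] by blast
    have "leg (12 * x + b2 W) = 1" using legX[OF x'] l by simp
    then have "QuadRes (int p) (12 * x + b2 W)" by (auto simp: Legendre_def split: if_splits)
    then obtain z where z: "[z ^ 2 = 12 * x + b2 W] (mod int p)" by (auto simp: QuadRes_def)
    obtain m where "int p dvd 2 * m + (a1 W - z)" by (rule obtain_linear_root[OF not_dvd_2])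
    then have "[2 * m + a1 W = z] (mod int p)" by (simp add: cong_iff_dvd_diff algebra_simps)
    then have "[(2 * m + a1 W) ^ 2 = 12 * x + b2 W] (mod int p)" using z by (meson cong_pow cong_trans)
    then show "\<exists>x y m. singular_point W p (x, y) \<and> [m ^ 2 + a1 W * m - (3 * x + a2 W) = 0] (mod int p)"
      unfolding slope using sp by blast
  qed
qed

lemma good_reduction_iff:
  assumes nz: "4 * fst E ^ 3 + 27 * snd E ^ 2 \<noteq> 0" and min: "minimal_condition E"
  shows "good_reduction E p \<longleftrightarrow> \<not> int p dvd 4 * fst E ^ 3 + 27 * snd E ^ 2"
proof -
  obtain m n where mn: "\<not> int p dvd m" "\<not> int p dvd n"
    "m ^ 12 * disc (min_model E p) = n ^ 12 * (- 16 * (4 * fst E ^ 3 + 27 * snd E ^ 2))"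
    by (rule min_model_invariants[OF assms])
  have "int p dvd disc (min_model E p) \<longleftrightarrow> int p dvd m ^ 12 * disc (min_model E p)"
    using mn(1) by (simp add: p_dvd_mult p_dvd_power)
  also have "\<dots> \<longleftrightarrow> int p dvd - 16 * (4 * fst E ^ 3 + 27 * snd E ^ 2)"
    unfolding mn(3) using mn(2) by (simp add: p_dvd_mult p_dvd_power)
  also have "\<dots> \<longleftrightarrow> int p dvd 4 * fst E ^ 3 + 27 * snd E ^ 2"
    by (rule smooth_dvd_iff[where i=4 and j=0]) simp
  finally show ?thesis by (simp add: good_reduction_def)
qed

theorem frob_trace_eq:
  assumes nz: "4 * fst E ^ 3 + 27 * snd E ^ 2 \<noteq> 0" and min: "minimal_condition E"
  shows "frob_trace E p = tr (fst E) (snd E)"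
proof -
  define W where "W = min_model E p"
  obtain m n where mn: "\<not> int p dvd m" "\<not> int p dvd n"
    "m ^ 4 * c4 W = n ^ 4 * (- 48 * fst E)" "m ^ 6 * c6 W = n ^ 6 * (- 864 * snd E)"
    unfolding W_def by (rule min_model_invariants[OF assms])
  have tr: "tr (- 27 * c4 W) (- 54 * c6 W) = tr (fst E) (snd E)"
  proof -
    \<comment> \<open>The 6 comes from \<open>27 * 48 = 6^4\<close> and
      \<open>54 * 864 = 6^6\<close>. Both models are scaled by squares, \<open>m^2\<close> and
      \<open>(6 n)^2\<close>, so no sign appears.\<close>
    have n6: "\<not> int p dvd 6 * n" using mn(2) smooth_dvd_iff[of 6 1 1 n] by simp
    have m2: "\<not> int p dvd m ^ 2" and n2: "\<not> int p dvd (6 * n) ^ 2"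
      using mn(1) n6 p_dvd_power zero_less_numeral by blast+
    have "tr (- 27 * c4 W) (- 54 * c6 W) = tr ((m ^ 2) ^ 2 * (- 27 * c4 W)) ((m ^ 2) ^ 3 * (- 54 * c6 W))"
      using mn(1) by (simp only: tr_scale[OF m2] leg_power2 if_False mult_1)
    also have "(m ^ 2) ^ 2 * (- 27 * c4 W) = - 27 * (m ^ 4 * c4 W)" by Groebner_Basis.algebra
    also have "\<dots> = ((6 * n) ^ 2) ^ 2 * fst E" unfolding mn(3) by Groebner_Basis.algebra
    also have "(m ^ 2) ^ 3 * (- 54 * c6 W) = - 54 * (m ^ 6 * c6 W)" by Groebner_Basis.algebra
    also have "\<dots> = ((6 * n) ^ 2) ^ 3 * snd E" unfolding mn(4) by Groebner_Basis.algebra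
    also have "tr (((6 * n) ^ 2) ^ 2 * fst E) (((6 * n) ^ 2) ^ 3 * snd E) = tr (fst E) (snd E)"
      using n6 by (simp only: tr_scale[OF n2] leg_power2 if_False mult_1)
    finally show ?thesis .
  qed
  show ?thesis
  proof (cases "good_reduction E p")
    case True
    then show ?thesis using card_affine_points[of W] tr by (simp add: frob_trace_def W_def)
  next
    case False
    then have dW: "int p dvd disc W" by (simp add: good_reduction_def W_def)
    have "4 * (- 27 * c4 W) ^ 3 + 27 * (- 54 * c6 W) ^ 2 = - 78732 * (c4 W ^ 3 - c6 W ^ 2)" by Groebner_Basis.algebra
    then have "int p dvd 4 * (- 27 * c4 W) ^ 3 + 27 * (- 54 * c6 W) ^ 2"
      using dW unfolding disc_c4_c6[symmetric] by simp
    then obtain X where X: "int p dvd - 27 * c4 W + 3 * X ^ 2" "int p dvd - 54 * c6 W - 2 * X ^ 3"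
      by (rule double_root)
    have l: "tr (fst E) (snd E) = leg (3 * X)" using tr tr_double_root[OF X] by simp
    \<comment> \<open>\<open>X = 0\<close> modulo \<open>p\<close> is a triple root, that is, a
      cusp: the additive case. Otherwise the symbol is 1 or -1 and separates split from
      non-split.\<close>
    have "int p dvd c4 W \<longleftrightarrow> leg (3 * X) = 0"
    proof -
      have "int p dvd 3 * X \<longleftrightarrow> int p dvd 3 * X ^ 2" by (simp add: p_dvd_mult p_dvd_power)
      also have "\<dots> \<longleftrightarrow> int p dvd (- 27) * c4 W"
        using X(1) by (metis dvd_add_left_iff dvd_add_right_iff)
      also have "\<dots> \<longleftrightarrow> int p dvd c4 W"
        by (rule smooth_dvd_iff[where i=0 and j=3]) simp
      finally show ?thesis using leg_eq_0_iff by blast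
    qed
    moreover have "leg (3 * X) \<in> {-1, 0, 1}" by (rule Legendre_values)
    ultimately show ?thesis
      using False dW split_iff[OF X] unfolding l
      by (auto simp: frob_trace_def split_multiplicative_reduction_def multiplicative_reduction_def
          Let_def W_def[symmetric])
  qed
qed

end

section \<open>Sieving for minimal models\<close>

lemma sum_int_interval_split:
  fixes F :: "int \<Rightarrow> 'a::comm_monoid_add"
  assumes "a \<le> b" "b \<le> c"
  shows "(\<Sum>x\<in>{a..<c}. F x) = (\<Sum>x\<in>{a..<b}. F x) + (\<Sum>x\<in>{b..<c}. F x)"
  by (subst sum.union_disjoint[symmetric]) (use assms in \<open>auto simp: ivl_disj_un\<close>)

lemma sum_periodic_blocks:
  fixes F :: "int \<Rightarrow> real"
  assumes "periodic (int P) F" "P > 0"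
  shows "(\<Sum>x\<in>{c..<c + int (q * P)}. F x) = real q * (\<Sum>x\<in>{0..<int P}. F x)"
proof (induction q)
  case (Suc q)
  have "(\<Sum>x\<in>{c..<c + int (Suc q * P)}. F x)
      = (\<Sum>x\<in>{c..<c + int (q * P)}. F x) + (\<Sum>x\<in>{c + int (q * P)..<c + int (Suc q * P)}. F x)"
    by (rule sum_int_interval_split) auto
  moreover have "(\<Sum>x\<in>{c + int (q * P)..<c + int (Suc q * P)}. F x)
      = (\<Sum>x\<in>{0..<int P}. F (x + (c + int (q * P))))"
    by (rule sum.reindex_bij_witness[of _ "\<lambda>x. x + (c + int (q * P))" "\<lambda>x. x - (c + int (q * P))"])
      (auto simp: algebra_simps)
  moreover have "\<dots> = (\<Sum>x\<in>{0..<int P}. F x)"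
    using sum_periodic_shift[OF assms(1)] assms(2) by simp
  ultimately show ?case using Suc.IH by (simp add: algebra_simps)
qed auto

lemma sum_periodic_interval:
  fixes F :: "int \<Rightarrow> real"
  assumes "periodic (int P) F" "P > 0"
  shows "(\<Sum>x\<in>{c..<c + int n}. F x) = real (n div P) * (\<Sum>x\<in>{0..<int P}. F x)
      + (\<Sum>x\<in>{c + int (n div P * P)..<c + int n}. F x)"
proof -
  have "int (n div P * P) \<le> int n" by (simp only: of_nat_le_iff div_times_less_eq_dividend)
  then have "(\<Sum>x\<in>{c..<c + int n}. F x)
      = (\<Sum>x\<in>{c..<c + int (n div P * P)}. F x) + (\<Sum>x\<in>{c + int (n div P * P)..<c + int n}. F x)"
    by (intro sum_int_interval_split) auto
  then show ?thesis using sum_periodic_blocks[OF assms] by simp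
qed

lemma sum_abs_le_card:
  fixes F :: "'b \<Rightarrow> real"
  assumes "\<And>x. x \<in> S \<Longrightarrow> \<bar>F x\<bar> \<le> M" "card S \<le> n" "M \<ge> 0"
  shows "\<bar>\<Sum>x\<in>S. F x\<bar> \<le> real n * M"
proof -
  have "\<bar>\<Sum>x\<in>S. F x\<bar> \<le> (\<Sum>x\<in>S. \<bar>F x\<bar>)" by (rule sum_abs)
  also have "\<dots> \<le> real (card S) * M" using assms(1) by (rule sum_bounded_above)
  also have "\<dots> \<le> real n * M" using assms by (intro mult_right_mono) auto
  finally show ?thesis .
qed

text \<open>The class on which the sieve induction runs. It is stable under scaling by
  \<open>(d^4, d^6)\<close> for \<open>d\<close> coprime to \<open>P\<close>; the last clause makes
  every other \<open>d\<close> contribute 0.\<close>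

definition admissible :: "nat \<Rightarrow> real \<Rightarrow> (int \<Rightarrow> int \<Rightarrow> real) \<Rightarrow> bool" where
  "admissible P M h \<longleftrightarrow> (\<forall>B. periodic (int P) (\<lambda>A. h A B)) \<and> (\<forall>A. periodic (int P) (h A)) \<and>
     (\<forall>A B. \<bar>h A B\<bar> \<le> M) \<and> (\<Sum>A\<in>{0..<int P}. \<Sum>B\<in>{0..<int P}. h A B) = 0 \<and>
     (\<forall>d A B. \<not> coprime d (int P) \<longrightarrow> h (d ^ 4 * A) (d ^ 6 * B) = 0)"

text \<open>Complete \<open>P\<close> by \<open>P\<close> blocks sum to 0. What remains are two
  strips along the sides of the rectangle, each less than \<open>P\<close> wide.\<close>

lemma admissible_rectangle:
  assumes h: "admissible P M h" and P: "P > 0"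
  shows "\<bar>\<Sum>A\<in>{c..<c + int m}. \<Sum>B\<in>{c'..<c' + int n}. h A B\<bar> \<le> M * real P * (real m + real n)"
proof -
  let ?J = "{c'..<c' + int n}"
  have hB: "periodic (int P) (\<lambda>A. h A B)" and hA: "periodic (int P) (h A)" and M: "\<bar>h A B\<bar> \<le> M"
    and zero: "(\<Sum>A\<in>{0..<int P}. \<Sum>B\<in>{0..<int P}. h A B) = 0" for A B
    using h by (auto simp: admissible_def)
  have M0: "M \<ge> 0" using M[of 0 0] by linarith
  have perA: "periodic (int P) (\<lambda>A. \<Sum>B\<in>?J. h A B)"
    unfolding periodic_def using periodicD[OF hB] by (blast intro: sum.cong)
  have perB: "periodic (int P) (\<lambda>B. \<Sum>A\<in>{0..<int P}. h A B)"
    unfolding periodic_def using periodicD[OF hA] by (blast intro: sum.cong)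
  have "(\<Sum>A\<in>{0..<int P}. \<Sum>B\<in>?J. h A B) = (\<Sum>B\<in>?J. \<Sum>A\<in>{0..<int P}. h A B)" by (rule sum.swap)
  also have "\<dots> = real (n div P) * (\<Sum>B\<in>{0..<int P}. \<Sum>A\<in>{0..<int P}. h A B)
      + (\<Sum>B\<in>{c' + int (n div P * P)..<c' + int n}. \<Sum>A\<in>{0..<int P}. h A B)"
    by (rule sum_periodic_interval[OF perB P])
  also have "(\<Sum>B\<in>{0..<int P}. \<Sum>A\<in>{0..<int P}. h A B) = 0" using zero by (subst sum.swap)
  finally have col: "(\<Sum>A\<in>{0..<int P}. \<Sum>B\<in>?J. h A B)
      = (\<Sum>B\<in>{c' + int (n div P * P)..<c' + int n}. \<Sum>A\<in>{0..<int P}. h A B)" by simp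
  have tail: "card {a + int (k div P * P)..<a + int k} \<le> P" for a k
  proof -
    have "card {a + int (k div P * P)..<a + int k} = nat (int k - int (k div P * P))" by simp
    also have "\<dots> = k - k div P * P" by (simp only: nat_minus_as_int[symmetric])
    also have "\<dots> = k mod P" by (rule minus_div_mult_eq_mod)
    finally show ?thesis using P by simp
  qed
  have "\<bar>\<Sum>A\<in>{0..<int P}. h A B\<bar> \<le> real P * M" for B
    by (rule sum_abs_le_card) (use M M0 in auto)
  then have "\<bar>\<Sum>A\<in>{0..<int P}. \<Sum>B\<in>?J. h A B\<bar> \<le> real P * (real P * M)"
    unfolding col by (rule sum_abs_le_card[OF _ tail]) (use M0 in auto)
  then have 1: "\<bar>real (m div P) * (\<Sum>A\<in>{0..<int P}. \<Sum>B\<in>?J. h A B)\<bar> \<le> real (m div P) * (real P * (real P * M))"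
    by (simp add: abs_mult mult_left_mono)
  have "real (m div P) * real P \<le> real m"
    by (metis of_nat_le_iff of_nat_mult div_times_less_eq_dividend)
  then have "real (m div P) * real P * (real P * M) \<le> real m * (real P * M)"
    using M0 by (intro mult_right_mono) auto
  then have 2: "\<bar>real (m div P) * (\<Sum>A\<in>{0..<int P}. \<Sum>B\<in>?J. h A B)\<bar> \<le> M * real P * real m"
    using 1 by (simp add: algebra_simps)
  have "\<bar>\<Sum>B\<in>?J. h A B\<bar> \<le> real n * M" for A
    by (rule sum_abs_le_card) (use M M0 in auto)
  then have "\<bar>\<Sum>A\<in>{c + int (m div P * P)..<c + int m}. \<Sum>B\<in>?J. h A B\<bar> \<le> real P * (real n * M)"
    by (rule sum_abs_le_card[OF _ tail]) (use M0 in auto)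
  then have 3: "\<bar>\<Sum>A\<in>{c + int (m div P * P)..<c + int m}. \<Sum>B\<in>?J. h A B\<bar> \<le> M * real P * real n"
    by (simp add: algebra_simps)
  show ?thesis
    unfolding sum_periodic_interval[OF perA P] using 2 3 by (simp add: algebra_simps)
qed

lemma admissible_scale:
  assumes h: "admissible P M h" and P: "P > 0" and d: "coprime d (int P)"
  shows "admissible P M (\<lambda>A B. h (d ^ 4 * A) (d ^ 6 * B))"
proof -
  have hB: "periodic (int P) (\<lambda>A. h A B)" and hA: "periodic (int P) (h A)" and M: "\<bar>h A B\<bar> \<le> M"
    and zero: "(\<Sum>A\<in>{0..<int P}. \<Sum>B\<in>{0..<int P}. h A B) = 0"
    and nc: "\<not> coprime d (int P) \<Longrightarrow> h (d ^ 4 * A) (d ^ 6 * B) = 0" for d A B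
    using h by (auto simp: admissible_def)
  have 1: "periodic (int P) (\<lambda>A. h (d ^ 4 * A) (d ^ 6 * B))" for B
    unfolding periodic_def by (intro allI impI periodicD[OF hB] cong_mult cong_refl)
  have 2: "periodic (int P) (\<lambda>B. h (d ^ 4 * A) (d ^ 6 * B))" for A
    unfolding periodic_def by (intro allI impI periodicD[OF hA] cong_mult cong_refl)
  have c: "coprime (d ^ 4) (int P)" "coprime (d ^ 6) (int P)" using d by simp_all
  have per: "periodic (int P) (\<lambda>A. \<Sum>B\<in>{0..<int P}. h A B)"
    unfolding periodic_def using periodicD[OF hB] by (blast intro: sum.cong)
  have "(\<Sum>A\<in>{0..<int P}. \<Sum>B\<in>{0..<int P}. h (d ^ 4 * A) (d ^ 6 * B))
      = (\<Sum>A\<in>{0..<int P}. \<Sum>B\<in>{0..<int P}. h (d ^ 4 * A) B)"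
    using sum_periodic_scale[OF hA _ c(2)] P by simp
  also have "\<dots> = 0" using sum_periodic_scale[OF per _ c(1)] P zero by simp
  finally have 3: "(\<Sum>A\<in>{0..<int P}. \<Sum>B\<in>{0..<int P}. h (d ^ 4 * A) (d ^ 6 * B)) = 0" .
  have 4: "h (d ^ 4 * (e ^ 4 * A)) (d ^ 6 * (e ^ 6 * B)) = 0" if "\<not> coprime e (int P)" for e A B
    using nc[of "d * e" A B] that by (simp add: power_mult_distrib mult.assoc)
  show ?thesis unfolding admissible_def using 1 2 3 4 M by auto
qed

section \<open>Pairs in a box and their minimal parts\<close>

definition box :: "real \<Rightarrow> curve set" where
  "box X = {(A, B). \<bar>real_of_int A\<bar> ^ 3 \<le> X \<and> \<bar>real_of_int B\<bar> ^ 2 \<le> X}"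

definition minimal_box :: "real \<Rightarrow> curve set" where
  "minimal_box X = {E \<in> box X. minimal_condition E}"

lemma abs_le_root_iff:
  assumes "X \<ge> 0" "n > 0"
  shows "\<bar>real_of_int A\<bar> ^ n \<le> X \<longleftrightarrow> \<bar>A\<bar> \<le> \<lfloor>root n X\<rfloor>"
proof -
  have "\<bar>real_of_int A\<bar> ^ n \<le> X \<longleftrightarrow> root n (\<bar>real_of_int A\<bar> ^ n) \<le> root n X" using assms by simp
  also have "\<dots> \<longleftrightarrow> \<bar>real_of_int A\<bar> \<le> root n X" using assms by (simp add: real_root_power_cancel)
  also have "\<dots> \<longleftrightarrow> \<bar>A\<bar> \<le> \<lfloor>root n X\<rfloor>" by (simp add: le_floor_iff)
  finally show ?thesis .
qed

lemma box_eq: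
  assumes "X \<ge> 0"
  shows "box X = {- \<lfloor>root 3 X\<rfloor>..<- \<lfloor>root 3 X\<rfloor> + int (nat (2 * \<lfloor>root 3 X\<rfloor> + 1))} \<times>
    {- \<lfloor>root 2 X\<rfloor>..<- \<lfloor>root 2 X\<rfloor> + int (nat (2 * \<lfloor>root 2 X\<rfloor> + 1))}"
proof -
  have "\<lfloor>root n X\<rfloor> \<ge> 0" for n using assms by (cases "n = 0") auto
  then have "int (nat (2 * \<lfloor>root n X\<rfloor> + 1)) = 2 * \<lfloor>root n X\<rfloor> + 1" for n by (simp add: add_nonneg_nonneg)
  then show ?thesis
    unfolding box_def using abs_le_root_iff[OF assms, of 3] abs_le_root_iff[OF assms, of 2] by (auto simp: abs_le_iff)
qed

lemma finite_box [simp, intro]: "finite (box X)"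
proof (cases "X \<ge> 0")
  case False
  have "E \<notin> box X" for E
  proof
    assume "E \<in> box X"
    then have "0 \<le> X" by (auto simp: box_def intro: order_trans[OF zero_le_power2])
    then show False using False by simp
  qed
  then have "box X = {}" by blast
  then show ?thesis by simp
qed (simp add: box_eq)

lemma finite_minimal_box [simp, intro]: "finite (minimal_box X)"
  by (simp add: minimal_box_def)

lemma not_minimal_zero: "\<not> minimal_condition (0, 0)"
  unfolding minimal_condition_def by (auto intro: exI[of _ 2])

lemma box_less_1: "X < 1 \<Longrightarrow> box X \<subseteq> {(0, 0)}"
proof
  fix E assume X: "X < 1" and "E \<in> box X"
  then have E: "\<bar>real_of_int (fst E)\<bar> ^ 3 < 1" "\<bar>real_of_int (snd E)\<bar> ^ 2 < 1"
    by (auto simp: box_def)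
  have "z = 0" if "\<bar>real_of_int z\<bar> ^ n < 1" for z n
  proof (rule ccontr)
    assume "z \<noteq> 0"
    then have "1 \<le> \<bar>real_of_int z\<bar>" by linarith
    then show False using that one_le_power[of "\<bar>real_of_int z\<bar>" n] by linarith
  qed
  then have "fst E = 0" "snd E = 0" using E by blast+
  then show "E \<in> {(0, 0)}" by (simp add: prod_eq_iff)
qed

lemma minimal_box_less_1: "X < 1 \<Longrightarrow> minimal_box X = {}"
  using box_less_1[of X] not_minimal_zero by (auto simp: minimal_box_def)

lemma minimal_power_dvd:
  fixes v :: int
  assumes "minimal_condition (A, B)" "v ^ 4 dvd A" "v ^ 6 dvd B"
  shows "is_unit v"
proof (rule ccontr)
  assume nu: "\<not> is_unit v"
  have "v \<noteq> 0" using assms not_minimal_zero by auto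
  then obtain q where "prime q" "q dvd v" using nu prime_divisor_exists by blast
  then have "q ^ 4 dvd A" "q ^ 6 dvd B" using assms by (meson dvd_power_same dvd_trans)+
  then show False using assms(1) \<open>prime q\<close> by (auto simp: minimal_condition_def)
qed

text \<open>After division by the gcd, \<open>u\<close> and \<open>v\<close> are coprime, so
  \<open>v^4\<close> and \<open>v^6\<close> divide the first minimal pair and \<open>u^4\<close> and
  \<open>u^6\<close> the second. Both are therefore units.\<close>

lemma minimal_scaling_inj:
  fixes d d' :: nat
  assumes min: "minimal_condition (A, B)" "minimal_condition (A', B')" and pos: "d > 0" "d' > 0"
    and eq: "int d ^ 4 * A = int d' ^ 4 * A'" "int d ^ 6 * B = int d' ^ 6 * B'"
  shows "d = d' \<and> A = A' \<and> B = B'"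
proof -
  define g where "g = gcd d d'"
  obtain u v where uv: "d = g * u" "d' = g * v" "coprime u v"
    using gcd_coprime_exists[of d d'] pos unfolding g_def by (metis gcd_eq_0_iff less_irrefl mult.commute)
  have g: "int g \<noteq> 0" using pos uv by auto
  have e4: "int u ^ 4 * A = int v ^ 4 * A'"
    using eq(1) g by (simp add: uv power_mult_distrib mult.assoc)
  have e6: "int u ^ 6 * B = int v ^ 6 * B'"
    using eq(2) g by (simp add: uv power_mult_distrib mult.assoc)
  have c: "coprime (int v ^ i) (int u ^ j)" "coprime (int u ^ i) (int v ^ j)" for i j
    using uv(3) by (simp_all add: coprime_commute)
  have "int v ^ 4 dvd A" "int v ^ 6 dvd B"
    using e4 e6 c(1) by (metis coprime_dvd_mult_right_iff dvd_triv_left)+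
  then have "is_unit (int v)" by (rule minimal_power_dvd[OF min(1)])
  moreover have "int u ^ 4 dvd A'" "int u ^ 6 dvd B'"
    using e4 e6 c(2) by (metis coprime_dvd_mult_right_iff dvd_triv_left)+
  then have "is_unit (int u)" by (rule minimal_power_dvd[OF min(2)])
  ultimately have "u = 1" "v = 1" by simp_all
  then show ?thesis using uv e4 e6 by simp
qed

lemma minimal_scaling_exists:
  assumes nz: "A \<noteq> 0 \<or> B \<noteq> (0::int)"
  obtains d :: nat and A' B' where "d > 0" "A = int d ^ 4 * A'" "B = int d ^ 6 * B'" "minimal_condition (A', B')"
proof -
  define S where "S = {d::nat. d > 0 \<and> int d ^ 4 dvd A \<and> int d ^ 6 dvd B}"
  have bound: "d \<le> nat \<bar>z\<bar>" if "int d ^ n dvd z" "z \<noteq> 0" "n > 0" for d n z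
  proof -
    have "int d dvd z" using that by (meson dvd_power dvd_trans)
    then show ?thesis using that dvd_imp_le_int[of z "int d"] by linarith
  qed
  have "S \<subseteq> {..nat \<bar>A\<bar> + nat \<bar>B\<bar>}"
  proof
    fix d assume "d \<in> S"
    then show "d \<in> {..nat \<bar>A\<bar> + nat \<bar>B\<bar>}" using nz bound[of d 4 A] bound[of d 6 B] by (auto simp: S_def)
  qed
  then have fin: "finite S" using finite_subset by blast
  have "1 \<in> S" by (simp add: S_def)
  define d where "d = Max S"
  have "d \<in> S" unfolding d_def using fin \<open>1 \<in> S\<close> by (intro Max_in) auto
  then obtain A' B' where AB: "d > 0" "A = int d ^ 4 * A'" "B = int d ^ 6 * B'" by (auto simp: S_def elim!: dvdE)
  have "minimal_condition (A', B')"
    unfolding minimal_condition_def fst_conv snd_conv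
  proof
    assume "\<exists>q::int. prime q \<and> q ^ 4 dvd A' \<and> q ^ 6 dvd B'"
    then obtain q :: int where q: "prime q" "q ^ 4 dvd A'" "q ^ 6 dvd B'" by blast
    then have q1: "q > 1" using prime_gt_1_int by blast
    then have "d * nat q \<in> S" using AB q by (auto simp: S_def power_mult_distrib mult_dvd_mono)
    then have "d * nat q \<le> d" unfolding d_def using fin by (intro Max_ge)
    then show False using q1 AB(1) by simp
  qed
  then show thesis using that AB by blast
qed

lemma scaled_in_box_iff:
  assumes "d > 0"
  shows "(int d ^ 4 * A, int d ^ 6 * B) \<in> box X \<longleftrightarrow> (A, B) \<in> box (X / real d ^ 12)"
proof -
  have "\<bar>real_of_int (int d ^ 4 * A)\<bar> ^ 3 = \<bar>real_of_int A\<bar> ^ 3 * real d ^ 12"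
    "\<bar>real_of_int (int d ^ 6 * B)\<bar> ^ 2 = \<bar>real_of_int B\<bar> ^ 2 * real d ^ 12"
    by (simp_all add: abs_mult power_mult_distrib flip: power_mult)
  then show ?thesis using assms by (simp add: box_def pos_le_divide_eq)
qed

lemma sum_box_decomposition:
  fixes g :: "int \<Rightarrow> int \<Rightarrow> real"
  shows "(\<Sum>(A, B)\<in>box X - {(0, 0)}. g A B) =
    (\<Sum>d\<in>{1..nat \<lfloor>X\<rfloor>}. \<Sum>(A, B)\<in>minimal_box (X / real d ^ 12). g (int d ^ 4 * A) (int d ^ 6 * B))"
proof -
  let ?S = "Sigma {1..nat \<lfloor>X\<rfloor>} (\<lambda>d. minimal_box (X / real d ^ 12))"
  let ?\<phi> = "\<lambda>(d::nat, A, B). (int d ^ 4 * A, int d ^ 6 * B)"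
  have "bij_betw ?\<phi> ?S (box X - {(0, 0)})"
    unfolding bij_betw_def
  proof (intro conjI equalityI subsetI)
    show "inj_on ?\<phi> ?S"
    proof (rule inj_onI)
      fix x y assume xy: "x \<in> ?S" "y \<in> ?S" "?\<phi> x = ?\<phi> y"
      obtain d A B d' A' B' where "x = (d, A, B)" "y = (d', A', B')" by (metis prod_cases3)
      then show "x = y"
        using xy minimal_scaling_inj[of A B A' B' d d'] by (simp add: minimal_box_def)
    qed
  next
    fix E assume "E \<in> ?\<phi> ` ?S"
    then obtain d A B where E: "E = (int d ^ 4 * A, int d ^ 6 * B)" "d > 0" "(A, B) \<in> minimal_box (X / real d ^ 12)"
      by force
    moreover have "(A, B) \<noteq> (0, 0)" using E(3) not_minimal_zero by (auto simp: minimal_box_def)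
    ultimately show "E \<in> box X - {(0, 0)}" using scaled_in_box_iff[of d A B X] by (auto simp: minimal_box_def)
  next
    fix E assume E: "E \<in> box X - {(0, 0)}"
    obtain A B where AB: "E = (A, B)" by (cases E)
    then have "A \<noteq> 0 \<or> B \<noteq> 0" using E by auto
    then obtain d A' B' where d: "d > 0" "A = int d ^ 4 * A'" "B = int d ^ 6 * B'" "minimal_condition (A', B')"
      by (rule minimal_scaling_exists)
    then have m: "(A', B') \<in> minimal_box (X / real d ^ 12)"
      using E AB scaled_in_box_iff[of d A' B' X] by (auto simp: minimal_box_def)
    \<comment> \<open>Boxes of size below 1 contain no minimal pair, so \<open>d^12 \<le> X\<close>;
      the cruder range \<open>d \<le> X\<close> suffices to have a finite sum.\<close>
    then have "\<not> X / real d ^ 12 < 1" using minimal_box_less_1 by force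
    then have "real d ^ 12 \<le> X" using d(1) by (simp add: field_simps)
    moreover have "real d \<le> real d ^ 12" using d(1) by (intro self_le_power) auto
    ultimately have "real d \<le> X" by linarith
    then have "d \<le> nat \<lfloor>X\<rfloor>" by (simp add: le_nat_floor)
    then show "E \<in> ?\<phi> ` ?S" using d m AB by (intro image_eqI[of _ _ "(d, A', B')"]) auto
  qed
  then have "(\<Sum>(A, B)\<in>box X - {(0, 0)}. g A B) = (\<Sum>x\<in>?S. case ?\<phi> x of (A, B) \<Rightarrow> g A B)"
    by (rule sum.reindex_bij_betw[symmetric])
  also have "\<dots> = (\<Sum>d\<in>{1..nat \<lfloor>X\<rfloor>}. \<Sum>(A, B)\<in>minimal_box (X / real d ^ 12). g (int d ^ 4 * A) (int d ^ 6 * B))"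
    by (subst sum.Sigma) (auto intro!: sum.cong)
  finally show ?thesis .
qed

text \<open>Telescoping, from \<open>16 * (d - 1) * d \<le> d^6\<close> for
  \<open>d \<ge> 2\<close>.\<close>

lemma sum_inverse_sixth: "(\<Sum>d\<in>{2..Suc n}. 1 / real d ^ 6) \<le> (1 - 1 / real (Suc n)) / 16"
proof (induction n)
  case (Suc n)
  define x where "x = real n"
  have x: "x \<ge> 0" by (simp add: x_def)
  have "(2::real) ^ 4 \<le> (x + 2) ^ 4" using x by (intro power_mono) auto
  moreover have "(x + 1) * (x + 2) \<le> (x + 2) ^ 2" using x by (simp add: power2_eq_square)
  ultimately have "16 * ((x + 1) * (x + 2)) \<le> (x + 2) ^ 4 * (x + 2) ^ 2"
    using x by (intro mult_mono) auto
  then have "16 * ((x + 1) * (x + 2)) \<le> (x + 2) ^ 6" by (simp flip: power_add)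
  then have "1 / (x + 2) ^ 6 \<le> 1 / (16 * ((x + 1) * (x + 2)))"
    using x by (intro divide_left_mono mult_pos_pos) auto
  also have "\<dots> = (1 / (x + 1) - 1 / (x + 2)) / 16" using x by (simp add: field_simps)
  finally have "1 / (x + 2) ^ 6 \<le> (1 / (x + 1) - 1 / (x + 2)) / 16" .
  moreover have "{2..Suc (Suc n)} = insert (Suc (Suc n)) {2..Suc n}" by auto
  then have "(\<Sum>d\<in>{2..Suc (Suc n)}. 1 / real d ^ 6)
      = 1 / (x + 2) ^ 6 + (\<Sum>d\<in>{2..Suc n}. 1 / real d ^ 6)"
    by (simp only:) (subst sum.insert, auto simp: x_def add.commute)
  moreover have "1 / real (Suc n) = 1 / (x + 1)" "1 / real (Suc (Suc n)) = 1 / (x + 2)"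
    by (simp_all add: x_def add.commute)
  ultimately show ?case using Suc by argo
qed auto

lemma root_bounds:
  assumes "X \<ge> 1"
  shows "real (nat (2 * \<lfloor>root 3 X\<rfloor> + 1)) \<le> 3 * root 3 X" "real (nat (2 * \<lfloor>root 2 X\<rfloor> + 1)) \<le> 3 * sqrt X"
    "root 3 X \<le> sqrt X"
proof -
  have 1: "real (nat (2 * \<lfloor>y\<rfloor> + 1)) \<le> 3 * y" if "y \<ge> 1" for y :: real
  proof -
    have "real (nat (2 * \<lfloor>y\<rfloor> + 1)) = 2 * real_of_int \<lfloor>y\<rfloor> + 1" using that by (simp add: of_nat_nat)
    then show ?thesis using that of_int_floor_le[of y] by linarith
  qed
  show "real (nat (2 * \<lfloor>root 3 X\<rfloor> + 1)) \<le> 3 * root 3 X" "real (nat (2 * \<lfloor>root 2 X\<rfloor> + 1)) \<le> 3 * sqrt X"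
    unfolding sqrt_def by (rule 1, use assms in simp)+
  show "root 3 X \<le> sqrt X" unfolding sqrt_def by (rule real_root_decreasing) (use assms in auto)
qed

text \<open>Sorting the pairs in the box by the largest \<open>d\<close> with \<open>d^4\<close> and \<open>d^6\<close> dividing them expresses the
  sum over minimal pairs by the sum over the box and sums over minimal pairs in the boxes of size
  \<open>X / d^12\<close>, \<open>d \<ge> 2\<close>.  The bound is inherited because the sum of \<open>d^(-6)\<close> over \<open>d \<ge> 2\<close> is
  smaller than \<open>1/7\<close>.\<close>

theorem minimal_box_cancellation:
  assumes "admissible P M h" "P > 1" "X \<ge> 0"
  shows "\<bar>\<Sum>(A, B)\<in>minimal_box X. h A B\<bar> \<le> 7 * M * real P * sqrt X"
proof -
  \<comment> \<open>\<open>n\<close> carries the induction, since \<open>d \<ge> 2\<close> at least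
    halves the size of the box. \<open>h\<close> has to vary because each step replaces it by its
    scaled version.\<close>
  have "\<bar>\<Sum>(A, B)\<in>minimal_box X. h A B\<bar> \<le> 7 * M * real P * sqrt X"
    if "X < 2 ^ n" "X \<ge> 0" "admissible P M h" for X h n
    using that
  proof (induction n arbitrary: X h)
    case (0 X h)
    have "minimal_box X = {}" using 0 by (intro minimal_box_less_1) simp
    moreover have "\<bar>h 0 0\<bar> \<le> M" using 0 by (simp add: admissible_def)
    then have "M \<ge> 0" by linarith
    ultimately show ?case using 0 by simp
  next
    case (Suc n X h)
    have M: "\<bar>h A B\<bar> \<le> M" and nc: "\<not> coprime d (int P) \<Longrightarrow> h (d ^ 4 * A) (d ^ 6 * B) = 0" for d A B
      using Suc.prems by (auto simp: admissible_def)
    have M0: "M \<ge> 0" using M[of 0 0] by linarith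
    show ?case
    proof (cases "X < 1")
      case True
      then show ?thesis using minimal_box_less_1 M0 Suc.prems by simp
    next
      case False
      define D where "D = nat \<lfloor>X\<rfloor>"
      have D: "D \<ge> 1" using False by (simp add: D_def le_nat_floor)
      let ?T = "\<lambda>d. \<Sum>(A, B)\<in>minimal_box (X / real d ^ 12). h (int d ^ 4 * A) (int d ^ 6 * B)"
      let ?K = "7 * M * real P * sqrt X"
      have K0: "?K \<ge> 0" using M0 Suc.prems by simp
      have "\<not> coprime (int P) (int P)" using assms(2) by simp
      then have h00: "h 0 0 = 0" using nc[of "int P" 0 0] by simp
      have "(\<Sum>(A, B)\<in>box X. h A B) = (\<Sum>(A, B)\<in>box X - {(0, 0)}. h A B)"
        using h00 by (intro sum.mono_neutral_right) auto
      also have "\<dots> = (\<Sum>d\<in>{1..D}. ?T d)"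
        unfolding D_def by (rule sum_box_decomposition)
      also have "{1..D} = insert 1 {2..D}" using D by auto
      also have "(\<Sum>d\<in>insert 1 {2..D}. ?T d) = ?T 1 + (\<Sum>d\<in>{2..D}. ?T d)"
        by (subst sum.insert) auto
      finally have split: "(\<Sum>(A, B)\<in>minimal_box X. h A B) = (\<Sum>(A, B)\<in>box X. h A B) - (\<Sum>d\<in>{2..D}. ?T d)"
        by simp
      have T: "\<bar>?T d\<bar> \<le> ?K * (1 / real d ^ 6)" if d: "d \<in> {2..D}" for d
      proof (cases "coprime (int d) (int P)")
        case True
        have d12: "(2::real) \<le> real d ^ 12"
        proof -
          have "real d \<ge> 2" using d by simp
          then show ?thesis using self_le_power[of "real d" 12] by linarith
        qed
        have "X / real d ^ 12 < 2 ^ n"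
        proof -
          have "X / real d ^ 12 \<le> X / 2" using d12 d Suc.prems(2) by (intro divide_left_mono) auto
          then show ?thesis using Suc.prems(1) unfolding power_Suc by linarith
        qed
        then have "\<bar>?T d\<bar> \<le> 7 * M * real P * sqrt (X / real d ^ 12)"
          using Suc.prems True assms(2) by (intro Suc.IH admissible_scale) auto
        also have "sqrt (X / real d ^ 12) = sqrt X / real d ^ 6"
        proof -
          have "real d ^ 12 = (real d ^ 6) ^ 2" by (simp flip: power_mult)
          then have "sqrt (real d ^ 12) = real d ^ 6"
            by (simp only: real_sqrt_abs abs_of_nonneg zero_le_power of_nat_0_le_iff)
          then show ?thesis by (simp add: real_sqrt_divide)
        qed
        finally show ?thesis by simp
      next
        case False
        then show ?thesis using K0 by (simp add: nc)
      qed
      have "\<bar>\<Sum>d\<in>{2..D}. ?T d\<bar> \<le> (\<Sum>d\<in>{2..D}. \<bar>?T d\<bar>)" by (rule sum_abs)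
      also have "\<dots> \<le> (\<Sum>d\<in>{2..D}. ?K * (1 / real d ^ 6))" by (rule sum_mono[OF T])
      also have "\<dots> = ?K * (\<Sum>d\<in>{2..D}. 1 / real d ^ 6)" by (rule sum_distrib_left[symmetric])
      also have "\<dots> \<le> ?K * (1 / 16)"
      proof (rule mult_left_mono[OF _ K0])
        obtain m where m: "D = Suc m" using D by (cases D) auto
        have "(1 - 1 / real (Suc m)) / 16 \<le> 1 / 16" by simp
        then show "(\<Sum>d\<in>{2..D}. 1 / real d ^ 6) \<le> 1 / 16"
          unfolding m using sum_inverse_sixth[of m] by linarith
      qed
      finally have tail: "\<bar>\<Sum>d\<in>{2..D}. ?T d\<bar> \<le> ?K * (1 / 16)" .
      let ?m = "nat (2 * \<lfloor>root 3 X\<rfloor> + 1)" and ?n = "nat (2 * \<lfloor>root 2 X\<rfloor> + 1)"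
      have "\<bar>\<Sum>(A, B)\<in>box X. h A B\<bar> \<le> M * real P * (real ?m + real ?n)"
        unfolding box_eq[OF Suc.prems(2)] sum.cartesian_product[symmetric]
        by (rule admissible_rectangle) (use Suc.prems assms(2) in auto)
      also have "\<dots> \<le> M * real P * (6 * sqrt X)"
        using root_bounds[of X] False M0 by (intro mult_left_mono) auto
      finally have main: "\<bar>\<Sum>(A, B)\<in>box X. h A B\<bar> \<le> 6 * (M * real P * sqrt X)" by simp
      \<comment> \<open>The constant 7 closes the induction: the box costs 6, from two sides of
        length at most \<open>3 * sqrt X\<close>, and the tail costs \<open>7 / 16\<close>.\<close>
      have "0 \<le> M * real P * sqrt X" using M0 Suc.prems by simp
      then show ?thesis using main tail unfolding split by linarith
    qed
  qed
  moreover obtain n where "X < 2 ^ n" using real_arch_pow[of 2 X] by auto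
  ultimately show ?thesis using assms by blast
qed

section \<open>Coefficients at primes and their mean values\<close>

lemma fps_nth_inverse_quadratic:
  fixes c g :: real
  defines "q \<equiv> inverse (1 - fps_const c * fps_X + fps_const g * fps_X ^ 2)"
  shows "fps_nth q 1 = c" "fps_nth q 2 = c ^ 2 - g"
proof -
  define f where "f = 1 - fps_const c * fps_X + fps_const g * fps_X ^ 2"
  have f: "fps_nth f 0 = 1" "fps_nth f 1 = - c" "fps_nth f 2 = g"
    by (simp_all add: f_def fps_X_power_iff numeral_2_eq_2)
  have "f * q = 1" unfolding q_def f_def[symmetric] using f by (intro inverse_mult_eq_1') simp
  then have nth: "fps_nth (f * q) n = (if n = 0 then 1 else 0)" for n by simp
  have q0: "fps_nth q 0 = 1" using nth[of 0] f by (simp add: fps_mult_nth)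
  show q1: "fps_nth q 1 = c" using nth[of 1] f q0 by (simp add: fps_mult_nth)
  have "{0..2::nat} = {0, 1, 2}" by auto
  then have "fps_nth q 2 - c * fps_nth q 1 + g * fps_nth q 0 = 0"
    using nth[of 2] f by (simp add: fps_mult_nth)
  then show "fps_nth q 2 = c ^ 2 - g" using q0 q1 by (simp add: power2_eq_square)
qed

lemma neg_logderiv_prime:
  assumes "prime p"
  shows "neg_logderiv f p = f p * ln (real p)"
    and "f 1 = 1 \<Longrightarrow> neg_logderiv f (p ^ 2) = (2 * f (p ^ 2) - f p ^ 2) * ln (real p)"
proof -
  have p: "p > 1" using assms prime_gt_1_nat by blast
  have "{d::nat. d dvd 1 \<and> d < 1} = {}" by auto
  then have "neg_logderiv f 1 = f 1 * ln (real 1) - (\<Sum>d\<in>{}. neg_logderiv f d * f (1 div d))"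
    by (metis neg_logderiv.simps)
  then have 1: "neg_logderiv f 1 = 0" by simp
  have "{d. d dvd p \<and> d < p} = {1}" using assms p by (auto simp: prime_nat_iff)
  then show P: "neg_logderiv f p = f p * ln (real p)" by (subst neg_logderiv.simps) (simp add: 1[simplified])
  have "{d. d dvd p ^ 2 \<and> d < p ^ 2} = {1, p}"
  proof (intro equalityI subsetI)
    fix d assume d: "d \<in> {d. d dvd p ^ 2 \<and> d < p ^ 2}"
    then obtain i where i: "i \<le> 2" "d = p ^ i" using divides_primepow_nat[OF assms] by auto
    moreover have "i \<noteq> 2" using d i by auto
    ultimately have "i = 0 \<or> i = 1" by auto
    then show "d \<in> {1, p}" using i by auto
  qed (use p less_1_mult[OF p p] in \<open>auto simp: power2_eq_square\<close>)
  then have "neg_logderiv f (p ^ 2) = f (p ^ 2) * ln (real (p ^ 2)) - (\<Sum>d\<in>{1, p}. neg_logderiv f d * f (p ^ 2 div d))"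
    by (metis neg_logderiv.simps)
  moreover have "p ^ 2 div p = p" using p by (simp add: power2_eq_square)
  moreover have "ln (real (p ^ 2)) = 2 * ln (real p)" by (simp add: ln_realpow)
  ultimately show "neg_logderiv f (p ^ 2) = (2 * f (p ^ 2) - f p ^ 2) * ln (real p)" if "f 1 = 1"
    using p that by (simp add: 1[simplified] P power2_eq_square[of "f p"] algebra_simps)
qed

text \<open>The weight \<open>w = 2\<close> gives the powers of \<open>ahat\<close>, and \<open>w = 1\<close> those of \<open>lambda_coeff\<close>.\<close>

definition local_factor :: "real \<Rightarrow> nat \<Rightarrow> nat \<Rightarrow> nat \<Rightarrow> int \<Rightarrow> int \<Rightarrow> real" where
  "local_factor w p e r A B =
     (if e = 1 then of_int (cubic_trace p A B) / sqrt (real p)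
      else of_int (cubic_trace p A B) ^ 2 / real p - (if int p dvd 4 * A ^ 3 + 27 * B ^ 2 then 0 else w)) ^ r"

context large_prime
begin

context
  fixes E :: curve
  assumes nz: "4 * fst E ^ 3 + 27 * snd E ^ 2 \<noteq> 0" and min: "minimal_condition E"
begin

lemma lambda_coeff_prime: "lambda_coeff E p = local_factor w p 1 1 (fst E) (snd E)"
  and lambda_coeff_prime_square: "lambda_coeff E (p ^ 2) = local_factor 1 p 2 1 (fst E) (snd E)"
proof -
  let ?c = "of_int (tr (fst E) (snd E)) / sqrt (real p)"
  let ?g = "if good_reduction E p then 1 else (0::real)"
  have "(if good_reduction E p then fps_X ^ 2 else 0) = fps_const ?g * (fps_X :: real fps) ^ 2" by simp
  then have f: "euler_factor E p = inverse (1 - fps_const ?c * fps_X + fps_const ?g * fps_X ^ 2)"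
    unfolding euler_factor_def frob_trace_eq[OF nz min] by simp
  have "lambda_coeff E p = fps_nth (euler_factor E p) 1"
    using prime gt2 by (simp add: lambda_coeff_def prime_factorization_prime)
  then show "lambda_coeff E p = local_factor w p 1 1 (fst E) (snd E)"
    unfolding f fps_nth_inverse_quadratic by (simp add: local_factor_def)
  have "lambda_coeff E (p ^ 2) = fps_nth (euler_factor E p) 2"
    using prime gt2 by (simp add: lambda_coeff_def prime_factors_power prime_factorization_prime)
  then show "lambda_coeff E (p ^ 2) = local_factor 1 p 2 1 (fst E) (snd E)"
    unfolding f fps_nth_inverse_quadratic
    by (simp add: local_factor_def good_reduction_iff[OF nz min] power_divide)
qed

text \<open>At \<open>p^2\<close> the logarithmic derivative gives
  \<open>2 * (c^2 - g) - c^2 = c^2 - 2 * g\<close>, where \<open>g\<close> is 1 for good and 0 for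
  bad reduction; the weight thereby changes from 1 to 2.\<close>

lemma ahat_prime: "ahat E p = local_factor w p 1 1 (fst E) (snd E)"
  and ahat_prime_square: "ahat E (p ^ 2) = local_factor 2 p 2 1 (fst E) (snd E)"
proof -
  have ln: "ln (real p) \<noteq> 0" using gt2 by simp
  have m: "mangoldt p = ln (real p)" "mangoldt (p ^ 2) = ln (real p)"
    using prime mangoldt_primepow[of p 1] mangoldt_primepow[of p 2] by simp_all
  have "lambda_coeff E 1 = 1" by (simp add: lambda_coeff_def)
  then have a: "ahat E p = lambda_coeff E p" "ahat E (p ^ 2) = 2 * lambda_coeff E (p ^ 2) - lambda_coeff E p ^ 2"
    unfolding ahat_def m using neg_logderiv_prime[OF prime, of "lambda_coeff E"] ln by simp_all
  show "ahat E p = local_factor w p 1 1 (fst E) (snd E)"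
    unfolding a by (rule lambda_coeff_prime)
  show "ahat E (p ^ 2) = local_factor 2 p 2 1 (fst E) (snd E)"
    unfolding a lambda_coeff_prime[of 0] lambda_coeff_prime_square by (simp add: local_factor_def power_divide)
qed

end

lemma local_factor_cong:
  assumes "[A = A'] (mod int p)" "[B = B'] (mod int p)"
  shows "local_factor w p e r A B = local_factor w p e r A' B'"
proof -
  have "[4 * A ^ 3 + 27 * B ^ 2 = 4 * A' ^ 3 + 27 * B' ^ 2] (mod int p)"
    by (intro cong_add cong_mult cong_pow cong_refl assms)
  then have "int p dvd 4 * A ^ 3 + 27 * B ^ 2 \<longleftrightarrow> int p dvd 4 * A' ^ 3 + 27 * B' ^ 2"
    by (rule cong_dvd_iff)
  then show ?thesis using tr_cong[OF assms] by (simp add: local_factor_def)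
qed

text \<open>Pairs vanishing modulo \<open>p\<close> reduce to the cusp \<open>y^2 = x^3\<close>: the
  trace is 0, and singularity switches the weight off. The sieve relies on this for \<open>d\<close>
  not coprime to \<open>P\<close>.\<close>

lemma local_factor_zero:
  assumes "int p dvd A" "int p dvd B" "r > 0"
  shows "local_factor w p e r A B = 0"
proof -
  have "tr A B = leg (3 * 0)" by (rule tr_double_root) (use assms in auto)
  then have "tr A B = 0" using leg_eq_0_iff[of 0] by simp
  moreover have "int p dvd 4 * A ^ 3 + 27 * B ^ 2"
    using assms by (intro dvd_add dvd_mult) (auto simp: p_dvd_power)
  ultimately show ?thesis using assms by (simp add: local_factor_def)
qed

text \<open>For odd \<open>r\<close> and \<open>e = 1\<close> Hasse's bound gives
  \<open>2^r\<close>, the source of that factor in the theorem. The 4 covers the squares and the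
  case \<open>e = 2\<close>.\<close>

lemma local_factor_bound:
  assumes "e = 1 \<and> (odd r \<or> r = 2) \<or> e = 2 \<and> r = 1" "0 \<le> w" "w \<le> 2"
  shows "\<bar>local_factor w p e r A B\<bar> \<le> 4 * 2 ^ (if odd r then r else 0)"
proof -
  have p: "real p > 0" using gt2 by simp
  have "real_of_int (tr A B ^ 2) \<le> real_of_int (4 * int p)" using tr_square_le by (simp only: of_int_le_iff)
  then have t: "(of_int (tr A B) :: real) ^ 2 / real p \<le> 4" using p by (simp add: field_simps)
  then have "(of_int (tr A B) / sqrt (real p)) ^ 2 \<le> 2 ^ 2" using p by (simp add: power_divide)
  then have tau: "\<bar>of_int (tr A B) / sqrt (real p)\<bar> \<le> (2::real)"
    unfolding abs_le_square_iff[symmetric] by simp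
  show ?thesis
  proof (cases "e = 1")
    case True
    then have "\<bar>local_factor w p e r A B\<bar> = \<bar>of_int (tr A B) / sqrt (real p)\<bar> ^ r"
      by (simp add: local_factor_def power_abs)
    also have "\<dots> \<le> 2 ^ r" by (rule power_mono[OF tau]) simp
    also have "(2::real) ^ r \<le> 4 * 2 ^ (if odd r then r else 0)" using assms(1) True by auto
    finally show ?thesis .
  next
    case False
    define y where "y = (of_int (tr A B) :: real) ^ 2 / real p"
    have y: "y \<ge> 0" "y \<le> 4" using t by (simp_all add: y_def)
    have "r = 1" "local_factor w p e r A B = y - (if int p dvd 4 * A ^ 3 + 27 * B ^ 2 then 0 else w)"
      using assms(1) False by (auto simp: local_factor_def y_def)
    then show ?thesis using y assms(2,3) by (auto simp: abs_le_iff)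
  qed
qed

lemma sum_local_factor_odd:
  assumes "odd r"
  shows "(\<Sum>A\<in>{0..<int p}. \<Sum>B\<in>{0..<int p}. local_factor w p 1 r A B) = 0"
proof -
  have "(\<Sum>A\<in>{0..<int p}. \<Sum>B\<in>{0..<int p}. local_factor w p 1 r A B)
      = of_int (\<Sum>A\<in>{0..<int p}. \<Sum>B\<in>{0..<int p}. tr A B ^ r) / sqrt (real p) ^ r"
    by (simp add: local_factor_def power_divide sum_divide_distrib)
  then show ?thesis unfolding sum_tr_odd_power[OF assms] by simp
qed

text \<open>Vanishing of the discriminant prescribes the square of \<open>9 * B\<close>, which
  leaves at most two residues.\<close>

lemma card_singular_column: "card {B\<in>{0..<int p}. int p dvd 4 * A ^ 3 + 27 * B ^ 2} \<le> 2"
proof -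
  let ?S = "{0..<int p}"
  let ?P = "\<lambda>z. if [z ^ 2 = - 12 * A ^ 3] (mod int p) then 1 else (0::int)"
  have per: "periodic (int p) ?P"
    unfolding periodic_def by (meson cong_pow cong_trans cong_sym)
  have iff: "int p dvd 4 * A ^ 3 + 27 * B ^ 2 \<longleftrightarrow> [(9 * B) ^ 2 = - 12 * A ^ 3] (mod int p)" for B
  proof -
    have "(9 * B) ^ 2 - (- 12 * A ^ 3) = 3 * (4 * A ^ 3 + 27 * B ^ 2)" by Groebner_Basis.algebra
    moreover have "int p dvd 3 * q \<longleftrightarrow> int p dvd q" for q
      by (rule smooth_dvd_iff[where i=0 and j=1]) simp
    ultimately show ?thesis by (simp only: cong_iff_dvd_diff)
  qed
  have "\<not> int p dvd 9" using not_dvd_smooth[of 0 2] by simp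
  have "int (card {B\<in>?S. int p dvd 4 * A ^ 3 + 27 * B ^ 2}) = (\<Sum>B\<in>?S. ?P (9 * B))"
    unfolding iff by (simp add: sum.If_cases Int_def)
  also have "\<dots> = (\<Sum>B\<in>?S. ?P B)"
    using sum_periodic_scale[OF per, of 9] \<open>\<not> int p dvd 9\<close> gt2 by (simp add: coprime_iff)
  also have "\<dots> = int (card {B\<in>?S. [B ^ 2 = - 12 * A ^ 3] (mod int p)})"
    by (simp add: sum.If_cases Int_def)
  also have "\<dots> \<le> 2" unfolding card_square_roots using Legendre_values[of "- 12 * A ^ 3" "int p"] by auto
  finally show ?thesis by simp
qed

text \<open>The sum of squares is exact, \<open>p * (p - 1)\<close> after normalization, so its mean
  over the \<open>p^2 - 1\<close> nonzero pairs is \<open>p / (p + 1)\<close>. With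
  \<open>e = 2\<close> the at most \<open>2 p\<close> singular pairs miss the weight. Both
  deviations have a numerator of at most \<open>5 p\<close>, and
  \<open>5 p^2 \<le> 8 (p^2 - 1)\<close>.\<close>

lemma sum_local_factor_even:
  assumes "e = 1 \<and> r = 2 \<or> e = 2 \<and> r = 1" "0 \<le> w" "w \<le> 2"
  shows "\<bar>(\<Sum>A\<in>{0..<int p}. \<Sum>B\<in>{0..<int p}. local_factor w p e r A B) / (real p ^ 2 - 1)
      - (if e = 1 then 1 else 1 - w)\<bar> \<le> 8 / real p"
proof -
  let ?S = "{0..<int p}"
  define x where "x = real p"
  have x: "x \<ge> 5" using ge5 by (simp add: x_def)
  define s where "s = x * x"
  have xx: "5 * x \<le> s" unfolding s_def using x by (intro mult_right_mono) auto
  define D where "D = x ^ 2 - 1"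
  have D: "D > 0" using x xx unfolding D_def power2_eq_square s_def[symmetric] by linarith
  have ratio: "\<bar>n / D\<bar> \<le> 8 / x" if "\<bar>n\<bar> * x \<le> 8 * D" for n
    using that x D by (simp add: abs_divide pos_divide_le_eq pos_le_divide_eq)
  have "(\<Sum>A\<in>?S. \<Sum>B\<in>?S. of_int (tr A B) ^ 2 / real p) = of_int (\<Sum>A\<in>?S. \<Sum>B\<in>?S. tr A B ^ 2) / real p"
    by (simp add: sum_divide_distrib)
  also have "\<dots> = x * (x - 1)" unfolding sum_tr_square using x by (simp add: x_def power2_eq_square)
  finally have sq: "(\<Sum>A\<in>?S. \<Sum>B\<in>?S. of_int (tr A B) ^ 2 / real p) = x * (x - 1)" .
  show ?thesis
  proof (cases "e = 1")
    case True
    then have "(\<Sum>A\<in>?S. \<Sum>B\<in>?S. local_factor w p e r A B) = x * (x - 1)"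
      using assms(1) sq by (simp add: local_factor_def power_divide)
    moreover have "x * (x - 1) / D - 1 = - (x - 1) / D"
    proof -
      have "x * (x - 1) = D - (x - 1)" by (simp add: D_def power2_eq_square algebra_simps)
      then show ?thesis using D by (simp add: diff_divide_distrib)
    qed
    moreover have "\<bar>- (x - 1) / D\<bar> \<le> 8 / x"
    proof (rule ratio)
      have "\<bar>- (x - 1)\<bar> * x = s - x" using x by (simp add: s_def algebra_simps)
      moreover have "s - x \<le> 8 * (s - 1)" using x xx by (simp add: algebra_simps)
      ultimately show "\<bar>- (x - 1)\<bar> * x \<le> 8 * D" unfolding D_def power2_eq_square s_def[symmetric] by simp
    qed
    ultimately show ?thesis using True unfolding x_def[symmetric] D_def[symmetric] by simp
  next
    case False
    define N where "N = (\<Sum>A\<in>?S. real (card {B\<in>?S. int p dvd 4 * A ^ 3 + 27 * B ^ 2}))"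
    have "N \<le> (\<Sum>A\<in>?S. 2)" unfolding N_def using card_singular_column by (intro sum_mono) simp
    then have N: "0 \<le> N" "N \<le> 2 * x" by (auto simp: N_def x_def intro: sum_nonneg)
    have "(\<Sum>A\<in>?S. \<Sum>B\<in>?S. if int p dvd 4 * A ^ 3 + 27 * B ^ 2 then 0 else w)
        = (\<Sum>A\<in>?S. \<Sum>B\<in>?S. w - w * (if int p dvd 4 * A ^ 3 + 27 * B ^ 2 then 1 else 0))"
      by (intro sum.cong) auto
    also have "\<dots> = w * x ^ 2 - w * N"
      by (simp add: sum_subtractf N_def x_def power2_eq_square sum_distrib_left[symmetric] sum.If_cases Int_def)
    finally have "(\<Sum>A\<in>?S. \<Sum>B\<in>?S. local_factor w p e r A B) = x * (x - 1) - (w * x ^ 2 - w * N)"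
      using False assms(1) sq by (simp add: local_factor_def sum_subtractf)
    moreover have "(x * (x - 1) - (w * x ^ 2 - w * N)) / D - (1 - w) = (1 - x + w * (N - 1)) / D"
    proof -
      have "x * (x - 1) - (w * x ^ 2 - w * N) = (1 - w) * D + (1 - x + w * (N - 1))"
        by (simp add: D_def power2_eq_square algebra_simps)
      then show ?thesis using D by (simp add: add_divide_distrib)
    qed
    moreover have "\<bar>(1 - x + w * (N - 1)) / D\<bar> \<le> 8 / x"
    proof (rule ratio)
      have "\<bar>w * (N - 1)\<bar> \<le> 2 * (2 * x)" unfolding abs_mult using assms N x by (intro mult_mono) auto
      then have "\<bar>1 - x + w * (N - 1)\<bar> \<le> 5 * x" using x by linarith
      then have "\<bar>1 - x + w * (N - 1)\<bar> * x \<le> 5 * x * x" using x by (intro mult_right_mono) auto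
      also have "5 * x * x = 5 * s" by (simp add: s_def)
      also have "\<dots> \<le> 8 * D"
        using x xx unfolding D_def power2_eq_square s_def[symmetric] by (simp add: algebra_simps)
      finally show "\<bar>1 - x + w * (N - 1)\<bar> * x \<le> 8 * D" .
    qed
    ultimately show ?thesis using False unfolding x_def[symmetric] D_def[symmetric] by simp
  qed
qed

end

section \<open>The trace formula\<close>

definition periodic2 :: "int \<Rightarrow> (int \<Rightarrow> int \<Rightarrow> 'a) \<Rightarrow> bool" where
  "periodic2 m f \<longleftrightarrow> (\<forall>A A' B B'. [A = A'] (mod m) \<longrightarrow> [B = B'] (mod m) \<longrightarrow> f A B = f A' B')"

lemma periodic2D: "periodic2 m f \<Longrightarrow> [A = A'] (mod m) \<Longrightarrow> [B = B'] (mod m) \<Longrightarrow> f A B = f A' B'"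
  unfolding periodic2_def by blast

lemma periodic2_dvd: "periodic2 m f \<Longrightarrow> m dvd n \<Longrightarrow> periodic2 n f"
  unfolding periodic2_def by (meson cong_dvd_modulus)

lemma sum_crt:
  fixes F :: "int \<Rightarrow> int \<Rightarrow> real"
  assumes "coprime m n" "m > 0" "n > 0"
  shows "(\<Sum>x\<in>{0..<m * n}. F (x mod m) (x mod n)) = (\<Sum>i\<in>{0..<m}. \<Sum>j\<in>{0..<n}. F i j)"
proof -
  let ?\<phi> = "\<lambda>x. (x mod m, x mod n)"
  have inj: "inj_on ?\<phi> {0..<m * n}"
  proof (rule inj_onI)
    fix x y assume xy: "x \<in> {0..<m * n}" "y \<in> {0..<m * n}" "?\<phi> x = ?\<phi> y"
    then have "[x = y] (mod m)" "[x = y] (mod n)" by (simp_all add: cong_def)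
    then have "[x = y] (mod m * n)" using assms(1) by (rule coprime_cong_mult)
    then show "x = y" using xy by (simp add: cong_def)
  qed
  have sub: "?\<phi> ` {0..<m * n} \<subseteq> {0..<m} \<times> {0..<n}" using assms by auto
  have "card ({0..<m} \<times> {0..<n}) = card {0..<m * n}"
    using assms by (simp add: nat_mult_distrib)
  then have "?\<phi> ` {0..<m * n} = {0..<m} \<times> {0..<n}"
    using sub inj by (intro card_subset_eq) (auto simp: card_image)
  then have "bij_betw ?\<phi> {0..<m * n} ({0..<m} \<times> {0..<n})" using inj by (simp add: bij_betw_def)
  then have "(\<Sum>x\<in>{0..<m * n}. case ?\<phi> x of (i, j) \<Rightarrow> F i j) = (\<Sum>(i, j)\<in>{0..<m} \<times> {0..<n}. F i j)"
    by (rule sum.reindex_bij_betw)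
  then show ?thesis by (simp add: sum.cartesian_product)
qed

lemma sum_crt2:
  fixes f g :: "int \<Rightarrow> int \<Rightarrow> real"
  assumes "coprime m n" "m > 0" "n > 0" and f: "periodic2 m f" and g: "periodic2 n g"
  shows "(\<Sum>A\<in>{0..<m * n}. \<Sum>B\<in>{0..<m * n}. f A B * g A B)
    = (\<Sum>A\<in>{0..<m}. \<Sum>B\<in>{0..<m}. f A B) * (\<Sum>A\<in>{0..<n}. \<Sum>B\<in>{0..<n}. g A B)"
proof -
  have red: "f A B = f (A mod m) (B mod m)" "g A B = g (A mod n) (B mod n)" for A B
    by (rule periodic2D[OF f] periodic2D[OF g]; simp add: cong_def)+
  have "(\<Sum>A\<in>{0..<m * n}. \<Sum>B\<in>{0..<m * n}. f A B * g A B)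
      = (\<Sum>A\<in>{0..<m * n}. \<Sum>B\<in>{0..<m * n}. f (A mod m) (B mod m) * g (A mod n) (B mod n))"
    by (intro sum.cong refl arg_cong2[of _ _ _ _ "(*)"] red)
  also have "\<dots> = (\<Sum>A\<in>{0..<m * n}. \<Sum>i\<in>{0..<m}. \<Sum>j\<in>{0..<n}. f (A mod m) i * g (A mod n) j)"
    by (intro sum.cong refl sum_crt[OF assms(1-3)])
  also have "\<dots> = (\<Sum>A\<in>{0..<m * n}. (\<Sum>i\<in>{0..<m}. f (A mod m) i) * (\<Sum>j\<in>{0..<n}. g (A mod n) j))"
    by (simp add: sum_product)
  also have "\<dots> = (\<Sum>a\<in>{0..<m}. \<Sum>b\<in>{0..<n}. (\<Sum>i\<in>{0..<m}. f a i) * (\<Sum>j\<in>{0..<n}. g b j))"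
    by (rule sum_crt[OF assms(1-3)])
  also have "\<dots> = (\<Sum>A\<in>{0..<m}. \<Sum>B\<in>{0..<m}. f A B) * (\<Sum>A\<in>{0..<n}. \<Sum>B\<in>{0..<n}. g A B)"
    by (simp add: sum_product)
  finally show ?thesis .
qed

lemma sum_crt_prod:
  fixes p :: "'i \<Rightarrow> nat" and g :: "'i \<Rightarrow> int \<Rightarrow> int \<Rightarrow> real"
  assumes "finite I" "\<And>i. i \<in> I \<Longrightarrow> p i > 0"
    and "\<And>i j. i \<in> I \<Longrightarrow> j \<in> I \<Longrightarrow> i \<noteq> j \<Longrightarrow> coprime (p i) (p j)"
    and "\<And>i. i \<in> I \<Longrightarrow> periodic2 (int (p i)) (g i)"
  shows "(\<Sum>A\<in>{0..<int (\<Prod>i\<in>I. p i)}. \<Sum>B\<in>{0..<int (\<Prod>i\<in>I. p i)}. \<Prod>i\<in>I. g i A B)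
    = (\<Prod>i\<in>I. \<Sum>A\<in>{0..<int (p i)}. \<Sum>B\<in>{0..<int (p i)}. g i A B)"
  using assms
proof (induction I)
  case (insert a I)
  let ?Q = "\<Prod>i\<in>I. p i"
  have "coprime (p a) ?Q" using insert by (intro prod_coprime_right) auto
  then have c: "coprime (int (p a)) (int ?Q)" by (simp only: coprime_int_iff)
  have Q: "int ?Q > 0" using insert.prems insert.hyps by (simp add: prod_pos)
  have per: "periodic2 (int ?Q) (\<lambda>A B. \<Prod>i\<in>I. g i A B)"
    unfolding periodic2_def
  proof (intro allI impI prod.cong refl)
    fix A A' B B' :: int and i
    assume *: "[A = A'] (mod int ?Q)" "[B = B'] (mod int ?Q)" and i: "i \<in> I"
    have "int (p i) dvd int ?Q" using i insert.hyps by (simp only: int_dvd_int_iff dvd_prodI)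
    then have "periodic2 (int ?Q) (g i)" using insert.prems(3) i periodic2_dvd by blast
    then show "g i A B = g i A' B'" using * by (rule periodic2D)
  qed
  have "int (\<Prod>i\<in>insert a I. p i) = int (p a) * int ?Q" using insert.hyps by simp
  moreover have "(\<Prod>i\<in>insert a I. g i A B) = g a A B * (\<Prod>i\<in>I. g i A B)" for A B
    using insert.hyps by simp
  ultimately have "(\<Sum>A\<in>{0..<int (\<Prod>i\<in>insert a I. p i)}. \<Sum>B\<in>{0..<int (\<Prod>i\<in>insert a I. p i)}. \<Prod>i\<in>insert a I. g i A B)
      = (\<Sum>A\<in>{0..<int (p a) * int ?Q}. \<Sum>B\<in>{0..<int (p a) * int ?Q}. g a A B * (\<Prod>i\<in>I. g i A B))"
    by simp
  also have "\<dots> = (\<Sum>A\<in>{0..<int (p a)}. \<Sum>B\<in>{0..<int (p a)}. g a A B)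
      * (\<Sum>A\<in>{0..<int ?Q}. \<Sum>B\<in>{0..<int ?Q}. \<Prod>i\<in>I. g i A B)"
    using insert.prems(1)[of a] by (intro sum_crt2[OF c _ Q _ per]) (use insert.prems in auto)
  also have "\<dots> = (\<Prod>i\<in>insert a I. \<Sum>A\<in>{0..<int (p i)}. \<Sum>B\<in>{0..<int (p i)}. g i A B)"
    using insert by simp
  finally show ?case .
qed auto

lemma abs_prod_diff_le:
  fixes s c :: "'i \<Rightarrow> real"
  assumes "finite I" "\<And>i. i \<in> I \<Longrightarrow> \<bar>s i\<bar> \<le> L" "\<And>i. i \<in> I \<Longrightarrow> \<bar>c i\<bar> \<le> 1" "L \<ge> 1"
  shows "\<bar>(\<Prod>i\<in>I. s i) - (\<Prod>i\<in>I. c i)\<bar> \<le> L ^ card I * (\<Sum>i\<in>I. \<bar>s i - c i\<bar>)"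
  using assms(1-3)
proof (induction I)
  case (insert a I)
  have C: "\<bar>\<Prod>i\<in>I. c i\<bar> \<le> 1"
    unfolding abs_prod using insert.prems by (intro prod_le_1) auto
  have L: "L ^ card I \<ge> 1" using assms(4) by simp
  have IH: "\<bar>(\<Prod>i\<in>I. s i) - (\<Prod>i\<in>I. c i)\<bar> \<le> L ^ card I * (\<Sum>i\<in>I. \<bar>s i - c i\<bar>)"
    using insert by simp
  have "s a * (\<Prod>i\<in>I. s i) - c a * (\<Prod>i\<in>I. c i)
      = s a * ((\<Prod>i\<in>I. s i) - (\<Prod>i\<in>I. c i)) + (s a - c a) * (\<Prod>i\<in>I. c i)" by (simp add: algebra_simps)
  also have "\<bar>\<dots>\<bar> \<le> \<bar>s a\<bar> * \<bar>(\<Prod>i\<in>I. s i) - (\<Prod>i\<in>I. c i)\<bar> + \<bar>s a - c a\<bar> * \<bar>\<Prod>i\<in>I. c i\<bar>"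
    by (metis abs_mult abs_triangle_ineq)
  also have "\<dots> \<le> L * (L ^ card I * (\<Sum>i\<in>I. \<bar>s i - c i\<bar>)) + \<bar>s a - c a\<bar> * (L * L ^ card I)"
  proof (intro add_mono mult_mono IH)
    have "1 * 1 \<le> L * L ^ card I" using L assms(4) by (intro mult_mono) auto
    then show "\<bar>\<Prod>i\<in>I. c i\<bar> \<le> L * L ^ card I" using C by simp
  qed (use insert.prems assms(4) in auto)
  also have "\<dots> = L ^ card (insert a I) * (\<Sum>i\<in>insert a I. \<bar>s i - c i\<bar>)"
    using insert.hyps by (simp add: algebra_simps)
  finally show ?case using insert.hyps by simp
qed auto

section \<open>Counting singular pairs and multiples in the box\<close>

lemma curves_upto_eq: "curves_upto X = {E \<in> minimal_box X. 4 * fst E ^ 3 + 27 * snd E ^ 2 \<noteq> 0}"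
  by (auto simp: curves_upto_def minimal_box_def box_def)

lemma finite_curves_upto [simp, intro]: "finite (curves_upto X)"
  by (simp add: curves_upto_eq)

lemma curves_upto_subset_box: "curves_upto X \<subseteq> box X"
  by (auto simp: curves_upto_eq minimal_box_def)

lemma int_cube_inject:
  fixes a b :: int
  assumes "a ^ 3 = b ^ 3"
  shows "a = b"
proof (rule ccontr)
  assume "a \<noteq> b"
  have "(a - b) * ((2 * a + b) ^ 2 + 3 * b ^ 2) = 0" using assms by Groebner_Basis.algebra
  then have *: "(2 * a + b) ^ 2 + 3 * b ^ 2 = 0" using \<open>a \<noteq> b\<close> by simp
  have "(2 * a + b) ^ 2 \<ge> 0" "b ^ 2 \<ge> 0" by simp_all
  then have "b ^ 2 = 0" "(2 * a + b) ^ 2 = 0" using * by linarith+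
  then show False using \<open>a \<noteq> b\<close> by simp
qed

text \<open>On the curve of singular pairs \<open>B\<close> determines \<open>A\<close>, so
  discarding them costs only the length of one side.\<close>

lemma card_singular_box:
  assumes "X \<ge> 1"
  shows "real (card {E \<in> box X. 4 * fst E ^ 3 + 27 * snd E ^ 2 = 0}) \<le> 3 * sqrt X"
proof -
  let ?Z = "{E \<in> box X. 4 * fst E ^ 3 + 27 * snd E ^ 2 = 0}"
  let ?J = "{- \<lfloor>root 2 X\<rfloor>..<- \<lfloor>root 2 X\<rfloor> + int (nat (2 * \<lfloor>root 2 X\<rfloor> + 1))}"
  have "inj_on snd ?Z"
  proof (rule inj_onI)
    fix E F assume *: "E \<in> ?Z" "F \<in> ?Z" "snd E = snd F"
    then have "fst E ^ 3 = fst F ^ 3" by simp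
    then have "fst E = fst F" by (rule int_cube_inject)
    then show "E = F" using * by (simp add: prod_eq_iff)
  qed
  moreover have "snd ` ?Z \<subseteq> ?J" using assms by (auto simp: box_eq)
  ultimately have "card ?Z \<le> card ?J" by (intro card_inj_on_le) auto
  also have "card ?J = nat (2 * \<lfloor>root 2 X\<rfloor> + 1)" by simp
  finally show ?thesis using root_bounds(2)[OF assms] by linarith
qed

lemma card_multiples_le:
  fixes a :: int
  assumes "p > 0" "a \<ge> 0"
  shows "real (card {x. \<bar>x\<bar> \<le> a \<and> int p dvd x}) \<le> 2 * real_of_int a / real p + 1"
proof -
  let ?b = "a div int p"
  have "{x. \<bar>x\<bar> \<le> a \<and> int p dvd x} \<subseteq> (\<lambda>y. int p * y) ` {- ?b..?b}"
  proof
    fix x assume "x \<in> {x. \<bar>x\<bar> \<le> a \<and> int p dvd x}"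
    then obtain y where y: "x = int p * y" "\<bar>x\<bar> \<le> a" by (auto elim: dvdE)
    then have "\<bar>y\<bar> * int p \<le> a" by (simp add: abs_mult mult.commute)
    then have "\<bar>y\<bar> * int p div int p \<le> ?b" using assms(1) by (intro zdiv_mono1) auto
    then have "\<bar>y\<bar> \<le> ?b" using assms(1) by simp
    then show "x \<in> (\<lambda>y. int p * y) ` {- ?b..?b}" using y by (auto simp: abs_le_iff)
  qed
  then have "card {x. \<bar>x\<bar> \<le> a \<and> int p dvd x} \<le> card {- ?b..?b}"
    by (meson card_image_le card_mono finite_atLeastAtMost_int finite_imageI le_trans)
  also have "card {- ?b..?b} = nat (2 * ?b + 1)" by simp
  finally have c: "card {x. \<bar>x\<bar> \<le> a \<and> int p dvd x} \<le> nat (2 * ?b + 1)" .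
  have "real (card {x. \<bar>x\<bar> \<le> a \<and> int p dvd x}) \<le> 2 * real_of_int ?b + 1"
  proof -
    have "?b \<ge> 0" using assms by (simp add: pos_imp_zdiv_nonneg_iff)
    then have "real (nat (2 * ?b + 1)) = 2 * real_of_int ?b + 1" by simp
    then show ?thesis using c by linarith
  qed
  moreover have "real_of_int ?b \<le> real_of_int a / real p"
    using real_of_int_div4[of a "int p"] by simp
  ultimately show ?thesis by simp
qed

lemma root3_mult_sqrt: "X \<ge> 0 \<Longrightarrow> root 3 X * sqrt X = X powr (5 / 6)"
  by (cases "X = 0") (simp_all add: root_powr_inverse sqrt_def powr_add[symmetric])

text \<open>The sides have at most \<open>2 y / p + 1\<close> and \<open>2 z / p + 1\<close>
  multiples of \<open>p\<close>, where \<open>y * z = X^(5/6)\<close>. The mixed terms are absorbed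
  by \<open>y * z / p\<close>, which gives \<open>8 = 4 + 2 + 2\<close>.\<close>

lemma card_box_multiples:
  assumes "X \<ge> 1" "p \<ge> 1"
  shows "real (card {E \<in> box X. int p dvd fst E \<and> int p dvd snd E}) \<le> 8 * (X powr (5 / 6) / real p) + 1"
proof -
  let ?a = "\<lfloor>root 3 X\<rfloor>" and ?b = "\<lfloor>root 2 X\<rfloor>"
  define y z x where "y = root 3 X" and "z = sqrt X" and "x = real p"
  have yz: "1 \<le> y" "1 \<le> z" "y \<le> z" using assms root_bounds(3)[OF assms(1)] by (auto simp: y_def z_def)
  have x: "x \<ge> 1" using assms by (simp add: x_def)
  have "{E \<in> box X. int p dvd fst E \<and> int p dvd snd E}
      \<subseteq> {x. \<bar>x\<bar> \<le> ?a \<and> int p dvd x} \<times> {x. \<bar>x\<bar> \<le> ?b \<and> int p dvd x}"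
    using assms abs_le_root_iff[of X 3] abs_le_root_iff[of X 2] by (auto simp: box_def)
  moreover have fin: "finite {x. \<bar>x\<bar> \<le> c \<and> int p dvd x}" for c
    by (rule finite_subset[of _ "{- c..c}"]) auto
  ultimately have "card {E \<in> box X. int p dvd fst E \<and> int p dvd snd E}
      \<le> card ({x. \<bar>x\<bar> \<le> ?a \<and> int p dvd x} \<times> {x. \<bar>x\<bar> \<le> ?b \<and> int p dvd x})"
    by (intro card_mono finite_cartesian_product)
  also have "\<dots> = card {x. \<bar>x\<bar> \<le> ?a \<and> int p dvd x} * card {x. \<bar>x\<bar> \<le> ?b \<and> int p dvd x}"
    by (rule card_cartesian_product)
  finally have "real (card {E \<in> box X. int p dvd fst E \<and> int p dvd snd E})
      \<le> real (card {x. \<bar>x\<bar> \<le> ?a \<and> int p dvd x}) * real (card {x. \<bar>x\<bar> \<le> ?b \<and> int p dvd x})"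
    by (simp only: of_nat_le_iff of_nat_mult[symmetric])
  also have "\<dots> \<le> (2 * y / x + 1) * (2 * z / x + 1)"
  proof (rule mult_mono)
    have "?a \<ge> 0" "?b \<ge> 0" using assms by auto
    then have "real (card {x. \<bar>x\<bar> \<le> ?a \<and> int p dvd x}) \<le> 2 * real_of_int ?a / x + 1"
      "real (card {x. \<bar>x\<bar> \<le> ?b \<and> int p dvd x}) \<le> 2 * real_of_int ?b / x + 1"
      using assms by (auto intro!: card_multiples_le simp: x_def)
    moreover have "2 * real_of_int ?a / x \<le> 2 * y / x" "2 * real_of_int ?b / x \<le> 2 * z / x"
      using x by (auto intro!: divide_right_mono simp: y_def z_def sqrt_def)
    ultimately show "real (card {x. \<bar>x\<bar> \<le> ?a \<and> int p dvd x}) \<le> 2 * y / x + 1"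
      "real (card {x. \<bar>x\<bar> \<le> ?b \<and> int p dvd x}) \<le> 2 * z / x + 1" by linarith+
  qed (use x yz in auto)
  also have "\<dots> = 4 * (y * z) / (x * x) + 2 * y / x + 2 * z / x + 1" using x by (simp add: field_simps)
  also have "\<dots> \<le> 4 * (y * z) / x + 2 * (y * z) / x + 2 * (y * z) / x + 1"
  proof -
    have yz0: "0 \<le> y * z" using yz by simp
    have xx: "x \<le> x * x" using mult_right_mono[of 1 x x] x by simp
    have "4 * (y * z) / (x * x) \<le> 4 * (y * z) / x"
      by (rule divide_left_mono[OF xx]) (use x yz0 in \<open>simp_all add: zero_less_mult_iff\<close>)
    moreover have "y * 1 \<le> y * z" by (rule mult_left_mono) (use yz in linarith)+
    then have "2 * y / x \<le> 2 * (y * z) / x" by (intro divide_right_mono) (use x in linarith)+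
    moreover have "1 * z \<le> y * z" by (rule mult_right_mono) (use yz in linarith)+
    then have "2 * z / x \<le> 2 * (y * z) / x" by (intro divide_right_mono) (use x in linarith)+
    ultimately show ?thesis by linarith
  qed
  also have "y * z = X powr (5 / 6)" unfolding y_def z_def using assms by (intro root3_mult_sqrt) simp
  finally show ?thesis by (simp add: x_def)
qed

lemma card_box_le:
  assumes "X \<ge> 1"
  shows "real (card (box X)) \<le> 9 * X powr (5 / 6)"
  using card_box_multiples[OF assms, of 1] ge_one_powr_ge_zero[of X "5 / 6"] assms by simp

definition nonzero_mod :: "nat \<Rightarrow> int \<Rightarrow> int \<Rightarrow> real" where
  "nonzero_mod p A B = (if int p dvd A \<and> int p dvd B then 0 else 1)"

lemma periodic2_nonzero_mod: "periodic2 (int p) (nonzero_mod p)"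
  unfolding periodic2_def nonzero_mod_def by (metis cong_dvd_iff)

lemma sum_nonzero_mod:
  assumes "p > 0"
  shows "(\<Sum>A\<in>{0..<int p}. \<Sum>B\<in>{0..<int p}. nonzero_mod p A B) = real p ^ 2 - 1"
proof -
  let ?S = "{0..<int p}"
  have "(\<Sum>A\<in>?S. \<Sum>B\<in>?S. nonzero_mod p A B)
      = (\<Sum>A\<in>?S. \<Sum>B\<in>?S. 1 - (if A = 0 then 1 else 0) * (if B = 0 then 1 else (0::real)))"
    by (intro sum.cong refl) (auto simp: nonzero_mod_def dvd_small_int)
  also have "\<dots> = real p ^ 2 - 1"
    using assms by (simp add: sum_subtractf sum_distrib_left[symmetric] power2_eq_square)
  finally show ?thesis .
qed

section \<open>Averages of products of local functions over the family\<close>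

locale local_data =
  fixes k :: nat and p :: "nat \<Rightarrow> nat" and g :: "nat \<Rightarrow> int \<Rightarrow> int \<Rightarrow> real" and M :: "nat \<Rightarrow> real"
  assumes k: "k \<ge> 1"
    and prime_p: "\<And>i. i \<in> {1..k} \<Longrightarrow> prime (p i)"
    and ge5: "\<And>i. i \<in> {1..k} \<Longrightarrow> p i \<ge> 5"
    and inj: "inj_on p {1..k}"
    and per: "\<And>i. i \<in> {1..k} \<Longrightarrow> periodic2 (int (p i)) (g i)"
    and zero: "\<And>i A B. i \<in> {1..k} \<Longrightarrow> int (p i) dvd A \<Longrightarrow> int (p i) dvd B \<Longrightarrow> g i A B = 0"
    and bound: "\<And>i A B. i \<in> {1..k} \<Longrightarrow> \<bar>g i A B\<bar> \<le> M i"
begin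

definition P :: nat where "P = (\<Prod>i=1..k. p i)"

text \<open>The mean over the nonzero pairs, since \<open>g i\<close> vanishes at the zero pair; the
  comparison function \<open>nonzero_mod\<close> has total \<open>p^2 - 1\<close>.\<close>

definition \<sigma> :: "nat \<Rightarrow> real" where
  "\<sigma> i = (\<Sum>A\<in>{0..<int (p i)}. \<Sum>B\<in>{0..<int (p i)}. g i A B) / (real (p i) ^ 2 - 1)"

definition \<alpha> :: real where "\<alpha> = (\<Prod>i=1..k. \<sigma> i)"

definition Mt :: real where "Mt = (\<Prod>i=1..k. M i)"

text \<open>The mean value is subtracted only off the pairs vanishing modulo some \<open>p i\<close>, so that \<open>h\<close>
  vanishes on all pairs scaled by a \<open>d\<close> that is not coprime to \<open>P\<close>.\<close>

definition h :: "int \<Rightarrow> int \<Rightarrow> real" where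
  "h A B = (\<Prod>i=1..k. g i A B) - \<alpha> * (\<Prod>i=1..k. nonzero_mod (p i) A B)"

lemma M_nonneg: "i \<in> {1..k} \<Longrightarrow> M i \<ge> 0"
  using bound[of i 0 0] by linarith

lemma p_sq: "i \<in> {1..k} \<Longrightarrow> real (p i) ^ 2 - 1 > 0"
proof -
  assume "i \<in> {1..k}"
  then have "1 < real (p i)" using ge5[of i] by simp
  then show ?thesis by (simp add: one_less_power)
qed

lemma P_gt_1: "P > 1" and P_pos: "real P \<ge> 1"
proof -
  have "p 1 dvd P" unfolding P_def using k by (intro dvd_prodI) auto
  moreover have "P > 0" unfolding P_def using prime_p by (intro prod_pos) (auto simp: prime_gt_0_nat)
  ultimately have "p 1 \<le> P" using dvd_imp_le by blast
  then show "P > 1" using ge5[of 1] k by simp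
  then show "real P \<ge> 1" by simp
qed

lemma p_dvd_P: "i \<in> {1..k} \<Longrightarrow> int (p i) dvd int P"
  unfolding P_def int_dvd_int_iff by (intro dvd_prodI) auto

lemma h_cong:
  assumes "[A = A'] (mod int P)" "[B = B'] (mod int P)"
  shows "h A B = h A' B'"
proof -
  have c: "[A = A'] (mod int (p i))" "[B = B'] (mod int (p i))" if "i \<in> {1..k}" for i
    using assms p_dvd_P[OF that] cong_dvd_modulus by blast+
  have "(\<Prod>i=1..k. g i A B) = (\<Prod>i=1..k. g i A' B')"
    by (intro prod.cong refl periodic2D[OF per] c)
  moreover have "(\<Prod>i=1..k. nonzero_mod (p i) A B) = (\<Prod>i=1..k. nonzero_mod (p i) A' B')"
    by (intro prod.cong refl periodic2D[OF periodic2_nonzero_mod] c)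
  ultimately show ?thesis by (simp add: h_def)
qed

lemma abs_\<sigma>_le: "i \<in> {1..k} \<Longrightarrow> \<bar>\<sigma> i\<bar> \<le> M i"
proof -
  assume i: "i \<in> {1..k}"
  let ?S = "{0..<int (p i)}"
  have "\<bar>\<Sum>A\<in>?S. \<Sum>B\<in>?S. g i A B\<bar> \<le> (\<Sum>A\<in>?S. \<Sum>B\<in>?S. \<bar>g i A B\<bar>)"
    by (rule order_trans[OF sum_abs]) (rule sum_mono, rule sum_abs)
  also have "\<dots> \<le> (\<Sum>A\<in>?S. \<Sum>B\<in>?S. M i * nonzero_mod (p i) A B)"
    using bound[OF i] zero[OF i] by (intro sum_mono) (auto simp: nonzero_mod_def)
  also have "\<dots> = M i * (real (p i) ^ 2 - 1)"
    using sum_nonzero_mod[of "p i"] ge5[OF i] by (simp add: sum_distrib_left[symmetric])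
  finally show ?thesis using p_sq[OF i] by (simp add: \<sigma>_def abs_divide pos_divide_le_eq)
qed

lemma Mt_nonneg: "Mt \<ge> 0"
  unfolding Mt_def using M_nonneg by (intro prod_nonneg) auto

lemma abs_\<alpha>_le: "\<bar>\<alpha>\<bar> \<le> Mt"
  unfolding \<alpha>_def Mt_def abs_prod using abs_\<sigma>_le by (intro prod_mono) auto

lemma prod_nonzero_mod: "0 \<le> (\<Prod>i=1..k. nonzero_mod (p i) A B)" "(\<Prod>i=1..k. nonzero_mod (p i) A B) \<le> 1"
  by (auto intro!: prod_nonneg prod_le_1 simp: nonzero_mod_def)

lemma abs_h_le: "\<bar>h A B\<bar> \<le> 2 * Mt"
proof -
  have "\<bar>\<Prod>i=1..k. g i A B\<bar> \<le> Mt"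
    unfolding Mt_def abs_prod using bound by (intro prod_mono) auto
  moreover have "\<bar>\<alpha> * (\<Prod>i=1..k. nonzero_mod (p i) A B)\<bar> \<le> Mt * 1"
    unfolding abs_mult using abs_\<alpha>_le prod_nonzero_mod[of A B] Mt_nonneg by (intro mult_mono) auto
  ultimately show ?thesis unfolding h_def by linarith
qed

lemma coprime_p: "i \<in> {1..k} \<Longrightarrow> j \<in> {1..k} \<Longrightarrow> i \<noteq> j \<Longrightarrow> coprime (p i) (p j)"
  using prime_p inj by (auto intro!: primes_coprime simp: inj_on_eq_iff)

text \<open>By the Chinese remainder theorem both products in \<open>h\<close> have the total
  \<open>\<alpha>\<close> times the product of the \<open>p^2 - 1\<close>. If \<open>d\<close> is
  not coprime to \<open>P\<close>, one factor of each product vanishes at the scaled pair.\<close>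

lemma admissible_h: "admissible P (2 * Mt) h"
  unfolding admissible_def
proof (intro conjI allI impI)
  show "periodic (int P) (\<lambda>A. h A B)" for B
    unfolding periodic_def using h_cong[OF _ cong_refl] by blast
  show "periodic (int P) (h A)" for A
    unfolding periodic_def using h_cong[OF cong_refl] by blast
  show "\<bar>h A B\<bar> \<le> 2 * Mt" for A B by (rule abs_h_le)
  have pos: "p i > 0" if "i \<in> {1..k}" for i using ge5[OF that] by simp
  have \<sigma>_eq: "(\<Sum>A\<in>{0..<int (p i)}. \<Sum>B\<in>{0..<int (p i)}. g i A B) = \<sigma> i * (real (p i) ^ 2 - 1)"
    if "i \<in> {1..k}" for i
    using p_sq[OF that] by (simp add: \<sigma>_def)
  have "(\<Sum>A\<in>{0..<int P}. \<Sum>B\<in>{0..<int P}. \<Prod>i=1..k. g i A B) = (\<Prod>i=1..k. \<sigma> i * (real (p i) ^ 2 - 1))"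
    unfolding P_def by (subst sum_crt_prod[OF _ pos coprime_p per]) (auto intro!: prod.cong simp: \<sigma>_eq)
  moreover have "(\<Sum>A\<in>{0..<int P}. \<Sum>B\<in>{0..<int P}. \<Prod>i=1..k. nonzero_mod (p i) A B)
      = (\<Prod>i=1..k. real (p i) ^ 2 - 1)"
    unfolding P_def using pos
    by (subst sum_crt_prod[OF _ pos coprime_p periodic2_nonzero_mod]) (auto intro!: prod.cong simp: sum_nonzero_mod)
  ultimately show "(\<Sum>A\<in>{0..<int P}. \<Sum>B\<in>{0..<int P}. h A B) = 0"
    by (simp add: h_def sum_subtractf sum_distrib_left[symmetric] \<alpha>_def prod.distrib)
  fix d A B :: int
  assume "\<not> coprime d (int P)"
  then have "\<exists>i\<in>{1..k}. \<not> coprime d (int (p i))"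
    unfolding P_def of_nat_prod using prod_coprime_right[of "{1..k}" d "\<lambda>i. int (p i)"] by blast
  then obtain i where i: "i \<in> {1..k}" "\<not> coprime d (int (p i))" by blast
  have "int (p i) dvd d"
    using i prime_p[OF i(1)] prime_imp_coprime[of "int (p i)" d] by (auto simp: coprime_commute)
  then have dv: "int (p i) dvd d ^ 4 * A" "int (p i) dvd d ^ 6 * B" by (auto simp: power_eq_if)
  then have "g i (d ^ 4 * A) (d ^ 6 * B) = 0" "nonzero_mod (p i) (d ^ 4 * A) (d ^ 6 * B) = 0"
    using zero[OF i(1)] by (auto simp: nonzero_mod_def)
  then have "(\<Prod>i=1..k. g i (d ^ 4 * A) (d ^ 6 * B)) = 0"
    "(\<Prod>i=1..k. nonzero_mod (p i) (d ^ 4 * A) (d ^ 6 * B)) = 0"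
    using i(1) by (auto intro!: prod_zero)
  then show "h (d ^ 4 * A) (d ^ 6 * B) = 0" by (simp only: h_def mult_zero_right diff_self)
qed

text \<open>The constant is \<open>20 = 14 + 6\<close>: the sieve bound for a function of size
  \<open>2 * Mt\<close>, and the singular minimal pairs that have to be removed.\<close>

lemma sum_h_curves:
  assumes X: "X \<ge> 1"
  shows "\<bar>\<Sum>E\<in>curves_upto X. h (fst E) (snd E)\<bar> \<le> 20 * Mt * (real P * sqrt X)"
proof -
  let ?S = "{E \<in> minimal_box X. 4 * fst E ^ 3 + 27 * snd E ^ 2 = 0}"
  let ?f = "\<lambda>E. h (fst E) (snd E)"
  have "(\<Sum>E\<in>minimal_box X. ?f E) = (\<Sum>E\<in>curves_upto X \<union> ?S. ?f E)"
    by (rule sum.cong) (auto simp: curves_upto_eq)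
  also have "\<dots> = (\<Sum>E\<in>curves_upto X. ?f E) + (\<Sum>E\<in>?S. ?f E)"
    by (rule sum.union_disjoint) (auto simp: curves_upto_eq)
  finally have split: "(\<Sum>E\<in>curves_upto X. ?f E) = (\<Sum>E\<in>minimal_box X. ?f E) - (\<Sum>E\<in>?S. ?f E)"
    by simp
  have "\<bar>\<Sum>E\<in>minimal_box X. ?f E\<bar> \<le> 7 * (2 * Mt) * real P * sqrt X"
    using minimal_box_cancellation[OF admissible_h P_gt_1, of X] X by (simp add: case_prod_unfold)
  then have 1: "\<bar>\<Sum>E\<in>minimal_box X. ?f E\<bar> \<le> 14 * (Mt * (real P * sqrt X))" by simp
  have "card ?S \<le> card {E \<in> box X. 4 * fst E ^ 3 + 27 * snd E ^ 2 = 0}"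
    by (rule card_mono) (auto simp: minimal_box_def)
  then have card: "real (card ?S) \<le> 3 * sqrt X" using card_singular_box[OF X] by linarith
  have "\<bar>\<Sum>E\<in>?S. ?f E\<bar> \<le> real (card ?S) * (2 * Mt)"
    by (rule sum_abs_le_card) (use abs_h_le Mt_nonneg in auto)
  also have "\<dots> \<le> (3 * sqrt X) * (2 * Mt)"
    using card Mt_nonneg by (intro mult_right_mono) auto
  also have "\<dots> = 6 * (Mt * (1 * sqrt X))" by simp
  also have "\<dots> \<le> 6 * (Mt * (real P * sqrt X))"
    using P_pos Mt_nonneg X by (intro mult_left_mono mult_right_mono) auto
  finally have 2: "\<bar>\<Sum>E\<in>?S. ?f E\<bar> \<le> 6 * (Mt * (real P * sqrt X))" .
  show ?thesis using 1 2 unfolding split mult.assoc by linarith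
qed

lemma sum_curves_of_zero_average:
  assumes "X \<ge> 1" "i \<in> {1..k}" "\<sigma> i = 0"
  shows "\<bar>\<Sum>E\<in>curves_upto X. \<Prod>i=1..k. g i (fst E) (snd E)\<bar> \<le> 20 * Mt * (real P * sqrt X)"
proof -
  have "\<alpha> = 0" unfolding \<alpha>_def using assms by (intro prod_zero) auto
  then have "h A B = (\<Prod>i=1..k. g i A B)" for A B by (simp add: h_def)
  then show ?thesis using sum_h_curves[OF assms(1)] by simp
qed

text \<open>A union bound over the curves divisible by some \<open>p i\<close>.\<close>

lemma sum_nonzero_mod_curves:
  assumes X: "X \<ge> 1"
  shows "\<bar>(\<Sum>E\<in>curves_upto X. \<Prod>i=1..k. nonzero_mod (p i) (fst E) (snd E)) - real (card (curves_upto X))\<bar>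
    \<le> 8 * ((\<Sum>i=1..k. 1 / real (p i)) * X powr (5 / 6)) + real k"
proof -
  let ?C = "curves_upto X"
  let ?D = "\<lambda>i. {E \<in> ?C. int (p i) dvd fst E \<and> int (p i) dvd snd E}"
  let ?u = "\<lambda>E. \<Prod>i=1..k. nonzero_mod (p i) (fst E) (snd E)"
  have pointwise: "1 - ?u E \<le> (\<Sum>i=1..k. 1 - nonzero_mod (p i) (fst E) (snd E))" for E
  proof (cases "\<exists>i\<in>{1..k}. nonzero_mod (p i) (fst E) (snd E) = 0")
    case True
    then obtain i where i: "i \<in> {1..k}" "nonzero_mod (p i) (fst E) (snd E) = 0" by blast
    have "1 - ?u E \<le> 1 - nonzero_mod (p i) (fst E) (snd E)" using prod_nonzero_mod(1)[of "fst E" "snd E"] i by simp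
    also have "\<dots> \<le> (\<Sum>i=1..k. 1 - nonzero_mod (p i) (fst E) (snd E))"
      using i by (intro member_le_sum) (auto simp: nonzero_mod_def)
    finally show ?thesis .
  next
    case False
    then have "?u E = 1" by (intro prod.neutral) (auto simp: nonzero_mod_def split: if_splits)
    moreover have "0 \<le> (\<Sum>i=1..k. 1 - nonzero_mod (p i) (fst E) (snd E))"
      by (intro sum_nonneg) (auto simp: nonzero_mod_def)
    ultimately show ?thesis by simp
  qed
  have "\<bar>(\<Sum>E\<in>?C. ?u E) - real (card ?C)\<bar> = (\<Sum>E\<in>?C. 1 - ?u E)"
  proof -
    have "(\<Sum>E\<in>?C. 1 - ?u E) = real (card ?C) - (\<Sum>E\<in>?C. ?u E)" by (simp add: sum_subtractf)
    moreover have "(\<Sum>E\<in>?C. 1 - ?u E) \<ge> 0" using prod_nonzero_mod(2) by (intro sum_nonneg) simp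
    ultimately show ?thesis by linarith
  qed
  also have "\<dots> \<le> (\<Sum>E\<in>?C. \<Sum>i=1..k. 1 - nonzero_mod (p i) (fst E) (snd E))"
    by (intro sum_mono pointwise)
  also have "\<dots> = (\<Sum>i=1..k. \<Sum>E\<in>?C. 1 - nonzero_mod (p i) (fst E) (snd E))" by (rule sum.swap)
  also have "\<dots> = (\<Sum>i=1..k. real (card (?D i)))"
  proof (intro sum.cong refl)
    fix i
    have "(\<Sum>E\<in>?C. 1 - nonzero_mod (p i) (fst E) (snd E)) = (\<Sum>E\<in>?C. if int (p i) dvd fst E \<and> int (p i) dvd snd E then 1 else 0)"
      by (intro sum.cong) (auto simp: nonzero_mod_def)
    then show "(\<Sum>E\<in>?C. 1 - nonzero_mod (p i) (fst E) (snd E)) = real (card (?D i))"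
      by (simp add: sum.If_cases Int_def)
  qed
  also have "\<dots> \<le> (\<Sum>i=1..k. 8 * (1 / real (p i) * X powr (5 / 6)) + 1)"
  proof (rule sum_mono)
    fix i assume i: "i \<in> {1..k}"
    have "card (?D i) \<le> card {E \<in> box X. int (p i) dvd fst E \<and> int (p i) dvd snd E}"
      by (rule card_mono) (use curves_upto_subset_box in auto)
    then show "real (card (?D i)) \<le> 8 * (1 / real (p i) * X powr (5 / 6)) + 1"
      using card_box_multiples[OF X, of "p i"] ge5[OF i] by simp
  qed
  also have "\<dots> = 8 * ((\<Sum>i=1..k. 1 / real (p i)) * X powr (5 / 6)) + real k"
    by (simp add: sum.distrib sum_distrib_left sum_distrib_right)
  finally show ?thesis .
qed

lemma sum_curves_of_close_average:
  assumes X: "X \<ge> 1" and c: "\<And>i. i \<in> {1..k} \<Longrightarrow> \<bar>c i\<bar> \<le> 1"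
    and close: "\<And>i. i \<in> {1..k} \<Longrightarrow> \<bar>\<sigma> i - c i\<bar> \<le> 8 / real (p i)"
  shows "\<bar>(\<Sum>E\<in>curves_upto X. \<Prod>i=1..k. g i (fst E) (snd E)) - (\<Prod>i=1..k. c i) * real (card (curves_upto X))\<bar>
    \<le> (20 * Mt + 9 ^ k * real k) * (real P * sqrt X) + 80 * 9 ^ k * ((\<Sum>i=1..k. 1 / real (p i)) * X powr (5 / 6))"
proof -
  let ?C = "curves_upto X"
  define N where "N = real (card ?C)"
  define Y where "Y = X powr (5 / 6)"
  define R where "R = (\<Sum>i=1..k. 1 / real (p i))"
  define Q where "Q = real P * sqrt X"
  define G where "G = (\<Sum>E\<in>?C. \<Prod>i=1..k. g i (fst E) (snd E))"
  define U where "U = (\<Sum>E\<in>?C. \<Prod>i=1..k. nonzero_mod (p i) (fst E) (snd E))"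
  define c0 where "c0 = (\<Prod>i=1..k. c i)"
  have L: "(1::real) \<le> 9 ^ k" by simp
  have \<sigma>: "\<bar>\<sigma> i\<bar> \<le> 9" if i: "i \<in> {1..k}" for i
  proof -
    have "8 / real (p i) \<le> 8 / 5" using ge5[OF i] by (intro divide_left_mono) auto
    then show ?thesis using close[OF i] c[OF i] by linarith
  qed
  have R0: "R \<ge> 0" unfolding R_def by (intro sum_nonneg) simp
  have Y0: "Y \<ge> 0" by (simp add: Y_def)
  have N: "0 \<le> N" "N \<le> 9 * Y"
  proof -
    have "card ?C \<le> card (box X)" by (rule card_mono[OF _ curves_upto_subset_box]) simp
    then show "0 \<le> N" "N \<le> 9 * Y" using card_box_le[OF X] by (simp_all add: N_def Y_def)
  qed
  have "\<bar>\<alpha> - c0\<bar> \<le> 9 ^ card {1..k} * (\<Sum>i=1..k. \<bar>\<sigma> i - c i\<bar>)"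
    unfolding \<alpha>_def c0_def by (rule abs_prod_diff_le) (use \<sigma> c in auto)
  also have "(\<Sum>i=1..k. \<bar>\<sigma> i - c i\<bar>) \<le> (\<Sum>i=1..k. 8 * (1 / real (p i)))"
    using close by (intro sum_mono) simp
  also have "\<dots> = 8 * R" by (simp add: R_def sum_distrib_left)
  finally have "\<bar>\<alpha> - c0\<bar> \<le> 9 ^ k * (8 * R)" by simp
  then have 3: "\<bar>(\<alpha> - c0) * N\<bar> \<le> 9 ^ k * (8 * R) * (9 * Y)"
    unfolding abs_mult using N R0 by (intro mult_mono) auto
  have "\<bar>\<alpha>\<bar> \<le> (\<Prod>i=1..k. 9)"
    unfolding \<alpha>_def abs_prod using \<sigma> by (intro prod_mono) auto
  then have \<alpha>: "\<bar>\<alpha>\<bar> \<le> 9 ^ k" by simp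
  \<comment> \<open>The additive \<open>k\<close> left by counting multiples is absorbed by the
    first error term.\<close>
  have "1 * 1 \<le> real P * sqrt X" using P_pos X by (intro mult_mono) auto
  then have "real k * 1 \<le> real k * Q" unfolding Q_def by (intro mult_left_mono) auto
  then have "\<bar>U - N\<bar> \<le> 8 * (R * Y) + real k * Q"
    using sum_nonzero_mod_curves[OF X] unfolding U_def N_def R_def Y_def by linarith
  then have 2: "\<bar>\<alpha> * (U - N)\<bar> \<le> 9 ^ k * (8 * (R * Y) + real k * Q)"
    unfolding abs_mult using \<alpha> by (intro mult_mono) auto
  have "(\<Sum>E\<in>?C. h (fst E) (snd E)) = G - \<alpha> * U"
    by (simp add: h_def G_def U_def sum_subtractf sum_distrib_left)
  then have 1: "\<bar>G - \<alpha> * U\<bar> \<le> 20 * Mt * Q" using sum_h_curves[OF X] by (simp add: Q_def)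
  \<comment> \<open>The three terms are the sieve error, the curves divisible by some
    \<open>p i\<close>, and the deviation of the local means from their limits. The last two give
    \<open>80 = 8 + 72\<close>.\<close>
  have "G - c0 * N = (G - \<alpha> * U) + \<alpha> * (U - N) + (\<alpha> - c0) * N" by (simp add: algebra_simps)
  then have "\<bar>G - c0 * N\<bar> \<le> 20 * Mt * Q + 9 ^ k * (8 * (R * Y) + real k * Q) + 9 ^ k * (8 * R) * (9 * Y)"
    using 1 2 3 by linarith
  also have "\<dots> = (20 * Mt + 9 ^ k * real k) * Q + 80 * 9 ^ k * (R * Y)" by (simp add: algebra_simps)
  finally show ?thesis unfolding G_def N_def c0_def Q_def R_def Y_def .
qed

end

text \<open>The limits of the local means for both weights: \<open>1 - w\<close> is -1 for
  \<open>w = 2\<close> and 0 for \<open>w = 1\<close>, so this unifies \<open>c_const\<close> and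
  \<open>d_const\<close>.\<close>

definition mean_value :: "real \<Rightarrow> nat \<Rightarrow> (nat \<Rightarrow> nat) \<Rightarrow> (nat \<Rightarrow> nat) \<Rightarrow> real" where
  "mean_value w k e r = (if \<exists>j\<in>{1..k}. e j = 1 \<and> odd (r j) then 0 else \<Prod>i=1..k. if e i = 1 then 1 else 1 - w)"

text \<open>The local bounds multiply to 2 to the sum of all odd exponents. The smallest one stays
  in the error term; the others go into the constant.\<close>

lemma prod_two_power_odd:
  "(\<Prod>i=1..k. 2 ^ (if odd (r i) then r i else 0)) = (2::real) ^ (smallest_odd k r + remaining_odd k r)"
proof -
  let ?O = "{i\<in>{1..k}. odd (r i)}"
  have "smallest_odd k r \<le> (\<Sum>i\<in>?O. r i)"
  proof (cases "\<exists>i\<in>{1..k}. odd (r i)")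
    case True
    let ?R = "{r i |i. i \<in> {1..k} \<and> odd (r i)}"
    have R: "?R = r ` ?O" by auto
    have "Min ?R \<in> ?R" unfolding R using True by (intro Min_in) auto
    then obtain i where "i \<in> ?O" "Min ?R = r i" by auto
    then have "Min ?R \<le> (\<Sum>i\<in>?O. r i)" using member_le_sum[of i ?O r] by simp
    then show ?thesis using True by (simp add: smallest_odd_def)
  qed (auto simp: smallest_odd_def)
  then have "smallest_odd k r + remaining_odd k r = (\<Sum>i\<in>?O. r i)" by (simp add: remaining_odd_def)
  also have "\<dots> = (\<Sum>i=1..k. if odd (r i) then r i else 0)" by (rule sum.inter_filter) simp
  finally show ?thesis by (simp only: power_sum)
qed

text \<open>If some \<open>e j = 1\<close> has \<open>r j\<close> odd, its local mean is 0, and only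
  the sieve error remains, matching the missing second summand of \<open>error_size\<close>.
  Otherwise all local means are within \<open>8 / p\<close> of their limits. In the constant,
  \<open>20 * 4^k * 2^(remaining_odd k r)\<close> is \<open>20 * Mt\<close> without
  \<open>2^r\<close>, and \<open>9^k * (k + 80)\<close> pays for replacing the means by their
  limits.\<close>

lemma trace_formula:
  assumes k: "k \<ge> 1" and w: "0 \<le> w" "w \<le> 2" and X: "X \<ge> 1"
    and p: "\<forall>i\<in>{1..k}. prime (p i) \<and> p i \<ge> 5" and inj: "inj_on p {1..k}"
    and er: "\<forall>i\<in>{1..k}. e i = 1 \<and> (odd (r i) \<or> r i = 2) \<or> e i = 2 \<and> r i = 1"
  shows "\<bar>(\<Sum>E\<in>curves_upto X. \<Prod>i=1..k. local_factor w (p i) (e i) (r i) (fst E) (snd E))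
      - mean_value w k e r * real (card (curves_upto X))\<bar>
    \<le> (20 * 4 ^ k * 2 ^ remaining_odd k r + 9 ^ k * (real k + 80)) * error_size k p e r X"
proof -
  let ?M = "\<lambda>i. 4 * 2 ^ (if odd (r i) then r i else 0) :: real"
  have lp: "large_prime (p i)" if "i \<in> {1..k}" for i
  proof -
    have "prime (p i)" "p i \<ge> 5" using p that by blast+
    then show ?thesis by unfold_locales auto
  qed
  interpret local_data k p "\<lambda>i. local_factor w (p i) (e i) (r i)" ?M
  proof
    fix i A B assume i: "i \<in> {1..k}"
    show "periodic2 (int (p i)) (local_factor w (p i) (e i) (r i))"
      unfolding periodic2_def using large_prime.local_factor_cong[OF lp[OF i]] by blast
    show "\<bar>local_factor w (p i) (e i) (r i) A B\<bar> \<le> ?M i"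
      by (rule large_prime.local_factor_bound[OF lp[OF i]]) (use er i w in auto)
    have "r i > 0" using er i by (metis odd_pos zero_less_numeral zero_less_one)
    then show "local_factor w (p i) (e i) (r i) A B = 0" if "int (p i) dvd A" "int (p i) dvd B"
      using large_prime.local_factor_zero[OF lp[OF i]] that by blast
  qed (use k p inj in auto)
  define Q where "Q = real P * sqrt X"
  have Q0: "Q \<ge> 0" using X by (simp add: Q_def)
  define S :: real where "S = 2 ^ smallest_odd k r"
  define T :: real where "T = 20 * 4 ^ k * 2 ^ remaining_odd k r"
  have S: "S \<ge> 1" by (simp add: S_def)
  have T0: "T \<ge> 0" by (simp add: T_def)
  have Mt: "20 * Mt = T * S"
    using prod_two_power_odd[where k = k and r = r] by (simp add: Mt_def prod.distrib power_add S_def T_def)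
  have Q: "(\<Prod>i=1..k. real (p i)) * X powr (1 / 2) = Q"
    using X by (simp add: Q_def P_def powr_half_sqrt)
  show ?thesis
  proof (cases "\<exists>j\<in>{1..k}. e j = 1 \<and> odd (r j)")
    case True
    then obtain j where j: "j \<in> {1..k}" "e j = 1" "odd (r j)" by blast
    have "\<not> (\<forall>i\<in>{1..k}. e i = 1 \<and> r i = 2 \<or> e i = 2)" using j by force
    then have err: "error_size k p e r X = S * Q"
      unfolding error_size_def mult.assoc Q S_def by (simp only: if_False add_0_right)
    have "\<sigma> j = 0"
      using large_prime.sum_local_factor_odd[OF lp[OF j(1)] j(3)] j(2) by (simp add: \<sigma>_def)
    then have "\<bar>\<Sum>E\<in>curves_upto X. \<Prod>i=1..k. local_factor w (p i) (e i) (r i) (fst E) (snd E)\<bar> \<le> 20 * Mt * Q"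
      unfolding Q_def by (rule sum_curves_of_zero_average[OF X j(1)])
    also have "\<dots> = T * (S * Q)" unfolding Mt by simp
    also have "\<dots> \<le> (T + 9 ^ k * (real k + 80)) * (S * Q)"
      using S Q0 by (intro mult_right_mono) auto
    finally show ?thesis using True by (simp add: mean_value_def err T_def)
  next
    case False
    then have even: "e i = 1 \<and> r i = 2 \<or> e i = 2 \<and> r i = 1" if "i \<in> {1..k}" for i
      using er that by blast
    then have "\<forall>i\<in>{1..k}. e i = 1 \<and> r i = 2 \<or> e i = 2" by blast
    then have err: "error_size k p e r X = S * Q + (\<Sum>i=1..k. 1 / real (p i)) * X powr (5 / 6)"
      unfolding error_size_def mult.assoc Q S_def by simp
    define Z where "Z = (\<Sum>i=1..k. 1 / real (p i)) * X powr (5 / 6)"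
    have Z0: "Z \<ge> 0" unfolding Z_def by (intro mult_nonneg_nonneg sum_nonneg) auto
    have "\<bar>(\<Sum>E\<in>curves_upto X. \<Prod>i=1..k. local_factor w (p i) (e i) (r i) (fst E) (snd E))
        - (\<Prod>i=1..k. if e i = 1 then 1 else 1 - w) * real (card (curves_upto X))\<bar>
      \<le> (20 * Mt + 9 ^ k * real k) * Q + 80 * 9 ^ k * Z"
      unfolding Q_def Z_def
    proof (rule sum_curves_of_close_average[OF X])
      fix i assume i: "i \<in> {1..k}"
      show "\<bar>if e i = 1 then 1 else 1 - w\<bar> \<le> 1" using w by auto
      show "\<bar>\<sigma> i - (if e i = 1 then 1 else 1 - w)\<bar> \<le> 8 / real (p i)"
        unfolding \<sigma>_def by (rule large_prime.sum_local_factor_even[OF lp[OF i] even[OF i] w])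
    qed
    also have "\<dots> \<le> (T + 9 ^ k * (real k + 80)) * (S * Q) + (T + 9 ^ k * (real k + 80)) * Z"
    proof (intro add_mono)
      have "9 ^ k * real k * 1 \<le> 9 ^ k * real k * S" using S by (intro mult_left_mono) auto
      then have "20 * Mt + 9 ^ k * real k \<le> (T + 9 ^ k * (real k + 80)) * S"
        using S by (simp add: Mt algebra_simps add_increasing2)
      then have "(20 * Mt + 9 ^ k * real k) * Q \<le> (T + 9 ^ k * (real k + 80)) * S * Q"
        using Q0 by (rule mult_right_mono)
      then show "(20 * Mt + 9 ^ k * real k) * Q \<le> (T + 9 ^ k * (real k + 80)) * (S * Q)" by (simp only: mult.assoc)
      show "80 * 9 ^ k * Z \<le> (T + 9 ^ k * (real k + 80)) * Z"
        using T0 Z0 by (intro mult_right_mono) (auto simp: algebra_simps)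
    qed
    also have "\<dots> = (T + 9 ^ k * (real k + 80)) * error_size k p e r X"
      by (simp only: err Z_def distrib_left)
    finally show ?thesis unfolding mean_value_def if_not_P[OF False] T_def .
  qed
qed

theorem theorem3p1:
  fixes k :: nat and \<epsilon> C :: real
  assumes "k \<ge> 1" and "\<epsilon> > 0"
  shows "\<exists>K :: nat \<Rightarrow> real. \<forall>(X::real) (p :: nat \<Rightarrow> nat) (e :: nat \<Rightarrow> nat) (r :: nat \<Rightarrow> nat).
    X > 0 \<longrightarrow>
    (\<forall>i\<in>{1..k}. prime (p i) \<and> p i \<ge> 5) \<longrightarrow>
    inj_on p {1..k} \<longrightarrow>
    (\<Prod>i=1..k. real (p i)) \<le> C * X powr (1/3 - \<epsilon>) \<longrightarrow>
    (\<forall>i\<in>{1..k}. e i = 1 \<and> (odd (r i) \<or> r i = 2) \<or> e i = 2 \<and> r i = 1) \<longrightarrow>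
      \<bar>(\<Sum>E\<in>curves_upto X. \<Prod>i=1..k. ahat E (p i ^ e i) ^ r i)
         - c_const k e r * real (card (curves_upto X))\<bar>
        \<le> K (remaining_odd k r) * error_size k p e r X \<and>
      \<bar>(\<Sum>E\<in>curves_upto X. \<Prod>i=1..k. lambda_coeff E (p i ^ e i) ^ r i)
         - d_const k e r * real (card (curves_upto X))\<bar>
        \<le> K (remaining_odd k r) * error_size k p e r X"
proof (intro exI[of _ "\<lambda>n. 20 * 4 ^ k * 2 ^ n + 9 ^ k * (real k + 80)"] allI impI)
  fix X :: real and p e r :: "nat \<Rightarrow> nat"
  let ?K = "20 * 4 ^ k * 2 ^ remaining_odd k r + 9 ^ k * (real k + 80) :: real"
  assume p: "\<forall>i\<in>{1..k}. prime (p i) \<and> p i \<ge> 5" and inj: "inj_on p {1..k}"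
    and er: "\<forall>i\<in>{1..k}. e i = 1 \<and> (odd (r i) \<or> r i = 2) \<or> e i = 2 \<and> r i = 1"
  show "\<bar>(\<Sum>E\<in>curves_upto X. \<Prod>i=1..k. ahat E (p i ^ e i) ^ r i)
         - c_const k e r * real (card (curves_upto X))\<bar> \<le> ?K * error_size k p e r X \<and>
      \<bar>(\<Sum>E\<in>curves_upto X. \<Prod>i=1..k. lambda_coeff E (p i ^ e i) ^ r i)
         - d_const k e r * real (card (curves_upto X))\<bar> \<le> ?K * error_size k p e r X"
  proof (cases "X \<ge> 1")
    case False
    then have "curves_upto X = {}" by (simp add: curves_upto_eq minimal_box_less_1)
    moreover have "0 \<le> error_size k p e r X"
      unfolding error_size_def by (auto intro!: add_nonneg_nonneg mult_nonneg_nonneg prod_nonneg sum_nonneg)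
    ultimately show ?thesis by simp
  next
    case X: True
    have terms: "(\<Prod>i=1..k. ahat E (p i ^ e i) ^ r i) = (\<Prod>i=1..k. local_factor 2 (p i) (e i) (r i) (fst E) (snd E))"
      "(\<Prod>i=1..k. lambda_coeff E (p i ^ e i) ^ r i) = (\<Prod>i=1..k. local_factor 1 (p i) (e i) (r i) (fst E) (snd E))"
      if E: "E \<in> curves_upto X" for E
    proof -
      have nz: "4 * fst E ^ 3 + 27 * snd E ^ 2 \<noteq> 0" and min: "minimal_condition E"
        using E by (auto simp: curves_upto_eq minimal_box_def)
      have "ahat E (p i ^ e i) ^ r i = local_factor 2 (p i) (e i) (r i) (fst E) (snd E) \<and>
          lambda_coeff E (p i ^ e i) ^ r i = local_factor 1 (p i) (e i) (r i) (fst E) (snd E)" if i: "i \<in> {1..k}" for i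
      proof -
        interpret large_prime "p i"
        proof -
          have "prime (p i)" "p i \<ge> 5" using p i by blast+
          then show "large_prime (p i)" by unfold_locales auto
        qed
        have e: "e i = 1 \<or> e i = 2" using er i by blast
        have pw: "local_factor w (p i) (e i) (r i) A B = local_factor w (p i) (e i) 1 A B ^ r i" for w A B
          by (simp add: local_factor_def)
        show ?thesis unfolding pw
          using e ahat_prime[OF nz min, of 2] ahat_prime_square[OF nz min]
            lambda_coeff_prime[OF nz min, of 1] lambda_coeff_prime_square[OF nz min] by auto
      qed
      then show "(\<Prod>i=1..k. ahat E (p i ^ e i) ^ r i) = (\<Prod>i=1..k. local_factor 2 (p i) (e i) (r i) (fst E) (snd E))"
        "(\<Prod>i=1..k. lambda_coeff E (p i ^ e i) ^ r i) = (\<Prod>i=1..k. local_factor 1 (p i) (e i) (r i) (fst E) (snd E))"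
        by (auto intro!: prod.cong)
    qed
    have c: "c_const k e r = mean_value 2 k e r"
    proof (cases "\<exists>j\<in>{1..k}. e j = 1 \<and> odd (r j)")
      case False
      \<comment> \<open>Since \<open>e i = 2\<close> forces \<open>r i = 1\<close>, each factor
        \<open>1 - 2\<close> equals \<open>(-1)^(r i)\<close>, and the parity in
        \<open>c_const\<close> appears.\<close>
      have "(\<Prod>i=1..k. if e i = 1 then 1 else 1 - 2) = (\<Prod>i\<in>{j\<in>{1..k}. e j = 2}. (-1::real) ^ r i)"
        unfolding prod.inter_filter[OF finite_atLeastAtMost] using er by (intro prod.cong) auto
      also have "\<dots> = (-1) ^ (\<Sum>j\<in>{j\<in>{1..k}. e j = 2}. r j)" by (rule power_sum[symmetric])
      finally have "(\<Prod>i=1..k. if e i = 1 then 1 else 1 - 2) = (-1::real) ^ (\<Sum>j\<in>{j\<in>{1..k}. e j = 2}. r j)" .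
      moreover have "\<forall>j\<in>{1..k}. e j = 1 \<longrightarrow> r j = 2" using er False by force
      ultimately show ?thesis using False unfolding c_const_def mean_value_def by auto
    qed (simp add: c_const_def mean_value_def)
    have d: "d_const k e r = mean_value 1 k e r"
    proof (cases "\<exists>j\<in>{1..k}. e j = 1 \<and> odd (r j)")
      case False
      have "(\<Prod>i=1..k. if e i = 1 then 1 else 1 - 1) = (if \<exists>j\<in>{1..k}. e j = 2 then 0 else (1::real))"
      proof (cases "\<exists>j\<in>{1..k}. e j = 2")
        case True
        then obtain j where j: "j \<in> {1..k}" "e j = 2" by blast
        then have "(\<Prod>i=1..k. if e i = 1 then 1 else 1 - 1) = (0::real)"
          by (intro prod_zero) (auto intro!: bexI[of _ j])
        then show ?thesis using True by (simp only: if_True)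
      next
        case False
        then have "\<forall>i\<in>{1..k}. e i = 1" using er by blast
        then show ?thesis using False by simp
      qed
      then show ?thesis using False unfolding d_const_def mean_value_def by auto
    qed (auto simp: d_const_def mean_value_def)
    have sums: "(\<Sum>E\<in>curves_upto X. \<Prod>i=1..k. ahat E (p i ^ e i) ^ r i)
        = (\<Sum>E\<in>curves_upto X. \<Prod>i=1..k. local_factor 2 (p i) (e i) (r i) (fst E) (snd E))"
      "(\<Sum>E\<in>curves_upto X. \<Prod>i=1..k. lambda_coeff E (p i ^ e i) ^ r i)
        = (\<Sum>E\<in>curves_upto X. \<Prod>i=1..k. local_factor 1 (p i) (e i) (r i) (fst E) (snd E))"
      by (rule sum.cong[OF refl], erule terms)+
    show ?thesis
      unfolding c d sums by (intro conjI trace_formula assms(1) X p inj er) simp_all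
  qed
qed

end
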